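(* Let $d\ge 2$ be an integer, let $\mu$ be a Radon measure on $\mathsf{T}_d$ such that $$\sum_{\boldsymbol{\xi}\in\mathbb{Z}^d}|\widehat{\mu}(\boldsymbol{\xi})|\ll 1$$ (that is, the series converges), and let $\mathbf{a}=(a_n)_{n=1}^\infty$ be a sequence of complex numbers with $a_n=n^{o(1)}$ as $n\to\infty$. Then $$\int_{\mathsf{T}_d}|S_{\mathbf{a},d}(\mathbf{x};N)|^{2s(d)}\,d\mu(\mathbf{x})\le N^{s(d)+o(1)},\qquad N\to\infty.$$
   Context: $\mathsf{T}_d=(\mathbb{R}/\mathbb{Z})^d$ is the unit torus, identified with $[0,1)^d$; a Radon measure $\mu$ on $\mathsf{T}_d$ is a (nonnegative) Borel measure with $\mu(\mathsf{T}_d)<\infty$, regarded also as a measure on $\mathbb{R}^d$. Write $\mathbf{e}(x)=\exp(2\pi i x)$ and $s(d)=d(d+1)/2$. The Fourier transform is $\widehat{\mu}(\boldsymbol{\xi})=\int_{\mathbb{R}^d}\mathbf{e}(-\mathbf{x}\cdot\boldsymbol{\xi})\,d\mu(\mathbf{x})$. For $\mathbf{x}=(x_1,\dots,x_d)$ and $N\in\mathbb{N}$, $S_{\mathbf{a},d}(\mathbf{x};N)=\sum_{n=1}^N a_n\,\mathbf{e}(x_1n+x_2n^2+\ldots+x_dn^d)$. $U=V^{o(1)}$ means that for every $\varepsilon>0$, $|U|\le V^{\varepsilon}$ once $V$ is large enough; accordingly $A(N)\le N^{c+o(1)}$ means that for every $\varepsilon>0$, $A(N)\le N^{c+\varepsilon}$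 for all sufficiently large $N$. *)

theory Defs
  imports "HOL-Analysis.Analysis"
begin

text \<open>
  Points of $\mathbb{R}^d$ are functions on the index set \<open>{1..d}\<close>, so that the coordinate
  with index \<open>j\<close> is the coefficient of \<open>n ^ j\<close> in the Weyl sums below.

  The torus is identified with $[0,1)^d$. The identification is a Borel isomorphism, so a Borel
  measure on the torus is a measure \<open>M\<close> with \<open>sets M = sets (torus d)\<close>. Only the measurable
  space \<open>torus d\<close> is used; the measure it carries as a term plays no role.
\<close>

definition torus :: "nat \<Rightarrow> (nat \<Rightarrow> real) measure" where
  "torus d = (\<Pi>\<^sub>M j\<in>{1..d}. restrict_space borel {0..<1})"

definition radon_measure_on_torus :: "nat \<Rightarrow> (nat \<Rightarrow> real) measure \<Rightarrow> bool" where
  "radon_measure_on_torus d \<mu> \<longleftrightarrow> sets \<mu> = sets (torus d) \<and> finite_measure \<mu>"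

definition unit_exp :: "real \<Rightarrow> complex" where
  "unit_exp x = exp (2 * of_real pi * \<i> * of_real x)"

definition vinogradov_s :: "nat \<Rightarrow> nat" where
  "vinogradov_s d = d * (d + 1) div 2"

definition fourier :: "nat \<Rightarrow> (nat \<Rightarrow> real) measure \<Rightarrow> (nat \<Rightarrow> real) \<Rightarrow> complex" where
  "fourier d \<mu> \<xi> = (\<integral>x. unit_exp (- (\<Sum>j\<in>{1..d}. x j * \<xi> j)) \<partial>\<mu>)"

definition integer_lattice :: "nat \<Rightarrow> (nat \<Rightarrow> real) set" where
  "integer_lattice d = (\<Pi>\<^sub>E j\<in>{1..d}. \<int>)"

definition weyl_sum :: "(nat \<Rightarrow> complex) \<Rightarrow> nat \<Rightarrow> (nat \<Rightarrow> real) \<Rightarrow> nat \<Rightarrow> complex" where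
  "weyl_sum a d x N = (\<Sum>n\<in>{1..N}. a n * unit_exp (\<Sum>j\<in>{1..d}. x j * real n ^ j))"

text \<open>\<open>le_power_o1 A c\<close> is the relation $A(N) \le N^{c+o(1)}$ as $N \to \infty$.\<close>

definition le_power_o1 :: "(nat \<Rightarrow> real) \<Rightarrow> real \<Rightarrow> bool" where
  "le_power_o1 A c \<longleftrightarrow>
     (\<forall>\<epsilon>>0. \<forall>\<^sub>F N in sequentially. A N \<le> real N powr (c + \<epsilon>))"

text \<open>
  The Bochner integral is 0 by convention for non-integrable functions;
  \<open>fourier_integrable\<close> and \<open>weyl_sum_integrable\<close> show that this case never arises here.
\<close>

lemma unit_exp_measurable [measurable]: "unit_exp \<in> borel_measurable borel"
  unfolding unit_exp_def by (intro borel_measurable_continuous_onI continuous_intros)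

lemma norm_unit_exp: "norm (unit_exp x) = 1"
  by (simp add: unit_exp_def)

lemma coordinate_measurable:
  assumes "radon_measure_on_torus d \<mu>" and "j \<in> {1..d}"
  shows "(\<lambda>x. x j) \<in> borel_measurable \<mu>"
proof -
  have "(\<lambda>x. x j) \<in> torus d \<rightarrow>\<^sub>M restrict_space borel {0..<1::real}"
    unfolding torus_def using assms(2) by (rule measurable_component_singleton)
  then have "(\<lambda>x. x j) \<in> borel_measurable (torus d)"
    by (simp add: measurable_restrict_space2_iff)
  moreover have "sets \<mu> = sets (torus d)"
    using assms(1) by (simp add: radon_measure_on_torus_def)
  ultimately show ?thesis
    using measurable_cong_sets by blast
qed

lemma fourier_integrable:
  assumes "radon_measure_on_torus d \<mu>"
  shows "integrable \<mu> (\<lambda>x. unit_exp (- (\<Sum>j\<in>{1..d}. x j * \<xi> j)))"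
proof (rule finite_measure.integrable_const_bound[where B = 1])
  show "finite_measure \<mu>"
    using assms by (simp add: radon_measure_on_torus_def)
  have [measurable]: "(\<lambda>x. x j) \<in> borel_measurable \<mu>" if "j \<in> {1..d}" for j
    using coordinate_measurable[OF assms that] .
  show "(\<lambda>x. unit_exp (- (\<Sum>j\<in>{1..d}. x j * \<xi> j))) \<in> borel_measurable \<mu>"
    by measurable
qed (simp add: norm_unit_exp)

lemma weyl_sum_integrable:
  assumes "radon_measure_on_torus d \<mu>"
  shows "integrable \<mu> (\<lambda>x. norm (weyl_sum a d x N) ^ k)"
proof (rule finite_measure.integrable_const_bound[where B = "(\<Sum>n\<in>{1..N}. norm (a n)) ^ k"])
  show "finite_measure \<mu>"
    using assms by (simp add: radon_measure_on_torus_def)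
  have [measurable]: "(\<lambda>x. x j) \<in> borel_measurable \<mu>" if "j \<in> {1..d}" for j
    using coordinate_measurable[OF assms that] .
  show "(\<lambda>x. norm (weyl_sum a d x N) ^ k) \<in> borel_measurable \<mu>"
    unfolding weyl_sum_def by measurable
  have "norm (weyl_sum a d x N) \<le> (\<Sum>n\<in>{1..N}. norm (a n))" for x
    unfolding weyl_sum_def by (rule order_trans[OF norm_sum]) (simp add: norm_mult norm_unit_exp)
  then show "AE x in \<mu>. norm (norm (weyl_sum a d x N) ^ k) \<le> (\<Sum>n\<in>{1..N}. norm (a n)) ^ k"
    by (simp add: power_mono)
qed

end

(* The argument of Guo, Li, Yung and Zorin-Kranich for l^2 decoupling of the moment curve, run
   p-adically with a fixed prime p > d, so that all integrals become finite sums and no constant is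
   lost in the broad-narrow step.

   If P(eta) says that the squared decoupling constant at scale p^(-n) is O(p^(eta n)), the bilinear
   estimates between residue classes modulo p^a and p^b are improved repeatedly: transversality makes
   the larger class decouple like a moment curve of lower degree, and Hoelder's inequality then
   exchanges the roles of a and b. Enough repetitions with b a small multiple of n give
   P(eta - delta) with delta bounded below, so P(eta) holds for every eta > 0.

   Decoupling bounds the number of solutions of the Vinogradov system, also with shifted right-hand
   sides, by N^(s(d)+o(1)). Expanding the moment with respect to mu writes it as a sum of Fourier
   coefficients of mu, each occurring with such a multiplicity, and the coefficients are summable. *)

theory Submission
  imports Defs "HOL-Number_Theory.Cong" "HOL-Computational_Algebra.Computational_Algebra"
begin

text \<open>Transversality rests on a count of coefficients. A polynomial of degree k has room for a
  zero of order k - l + 1 at one point and for l prescribed Taylor coefficients at a second one. The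
  zero makes the corresponding phase trivial on a class around the first point, so a weight built
  from that class does not notice it, while around the second point every phase of degree l arises
  up to a constant. Solving for the coefficients divides by the difference of the points and by
  integers up to k; hence the separation modulo p and the size of p.

  The obstacle is the factor p^b lost on the way back from bilinear to linear inequalities.
  Hoelder's inequality alone saves at most p^(eta b), too little when eta is small. Each round
  raises the exponent of the saving by a fixed multiple of eta b, so about 1/eta rounds are needed;
  this is why the descent runs down to a fixed positive eta, with steps whose size is uniform above
  it. Throughout, majorants of squared norms are carried instead of norms, so that the inequalities
  involve integer powers only.\<close>

section \<open>Hoelder and Minkowski inequalities for weighted finite sums\<close>

lemma weighted_am_gm_nat:
  fixes u x y :: real
  assumes "0 \<le> u" "0 \<le> x" "0 \<le> y" "u ^ (m + r) \<le> x ^ m * y ^ r" "m + r > 0"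
  shows "real (m + r) * u \<le> real m * x + real r * y"
proof (cases "u = 0")
  case True
  then show ?thesis using assms by simp
next
  case False
  then have u: "u > 0" using assms by simp
  then have "x ^ m * y ^ r > 0" using assms(4) by (smt (verit) zero_less_power)
  then have xm: "x ^ m > 0" and yr: "y ^ r > 0"
    using assms(2,3) by (auto simp: zero_less_mult_iff dest: zero_le_power[of x m])
  \<comment> \<open>With \<open>m = 0\<close> the base \<open>x\<close> may be 0, where
    \<open>powr\<close> gives 0 even for the exponent 0. A positive stand-in makes Young's
    inequality applicable and changes neither the power nor the weighted term.\<close>
  define x' where "x' = (if m = 0 then 1 else x)"
  define y' where "y' = (if r = 0 then 1 else y)"
  have x': "x' > 0" "x' ^ m = x ^ m" "real m * x' = real m * x"
    using xm assms(2) unfolding x'_def by (cases "x = 0"; cases m; simp)+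
  have y': "y' > 0" "y' ^ r = y ^ r" "real r * y' = real r * y"
    using yr assms(3) unfolding y'_def by (cases "y = 0"; cases r; simp)+
  define M where "M = real (m + r)"
  have M: "M > 0" using assms(5) unfolding M_def by linarith
  have "u = (u ^ (m + r)) powr (1 / M)"
    using u M unfolding M_def by (simp flip: powr_realpow add: powr_powr)
  also have "\<dots> \<le> (x' ^ m * y' ^ r) powr (1 / M)"
    using assms(4) u M x' y' by (intro powr_mono2) auto
  also have "\<dots> = x' powr (real m / M) * y' powr (real r / M)"
    by (simp only: powr_realpow[OF x'(1), symmetric] powr_realpow[OF y'(1), symmetric] powr_mult powr_powr times_divide_eq_right mult_1_right)
  also have "\<dots> \<le> real m / M * x' + real r / M * y'"
    using x'(1) y'(1) M by (intro Youngs_inequality_0) (auto simp: M_def simp flip: add_divide_distrib)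
  finally have "M * u \<le> real m * x' + real r * y'"
    using M by (simp add: field_simps)
  then show ?thesis using x' y' M_def by simp
qed

text \<open>Hoelder's inequality with integer exponents, raised to the power \<open>m + r\<close> so
  that its statement contains no roots. Both factors are normalized and the pointwise inequality of
  arithmetic and geometric means is summed; a vanishing factor cannot be normalized and is treated
  apart.\<close>

lemma weighted_sum_holder:
  fixes w U U1 U2 :: "'a \<Rightarrow> real"
  assumes A: "finite A" and w: "\<And>x. x \<in> A \<Longrightarrow> 0 \<le> w x"
    and nn: "\<And>x. x \<in> A \<Longrightarrow> 0 \<le> U x" "\<And>x. x \<in> A \<Longrightarrow> 0 \<le> U1 x" "\<And>x. x \<in> A \<Longrightarrow> 0 \<le> U2 x"
    and le: "\<And>x. x \<in> A \<Longrightarrow> U x ^ (m + r) \<le> U1 x ^ m * U2 x ^ r"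
    and pos: "m + r > 0"
  shows "(\<Sum>x\<in>A. w x * U x) ^ (m + r) \<le> (\<Sum>x\<in>A. w x * U1 x) ^ m * (\<Sum>x\<in>A. w x * U2 x) ^ r"
proof -
  define S1 where "S1 = (\<Sum>x\<in>A. w x * U1 x)"
  define S2 where "S2 = (\<Sum>x\<in>A. w x * U2 x)"
  have S: "S1 \<ge> 0" "S2 \<ge> 0" unfolding S1_def S2_def using w nn by (auto intro!: sum_nonneg)
  have Unn: "(\<Sum>x\<in>A. w x * U x) \<ge> 0" using w nn by (auto intro!: sum_nonneg)
  consider "S1 = 0" "m > 0" | "S2 = 0" "r > 0" | "(S1 > 0 \<or> m = 0)" "(S2 > 0 \<or> r = 0)"
    using S by fastforce
  then show ?thesis
  proof cases
    case 1
    have "w x * U x = 0" if x: "x \<in> A" for x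
    proof -
      have "w x * U1 x = 0" using 1(1) x A w nn unfolding S1_def by (subst (asm) sum_nonneg_eq_0_iff) auto
      moreover have "U x = 0" if "U1 x = 0"
        using le[OF x] that 1(2) nn(1)[OF x] by (simp add: power_0_left) (metis add_gr_0 le_less not_le zero_less_power)
      ultimately show ?thesis by auto
    qed
    then have "(\<Sum>x\<in>A. w x * U x) = 0" by (simp add: sum.neutral)
    then show ?thesis using pos S unfolding S1_def S2_def by (simp add: power_0_left)
  next
    case 2
    have "w x * U x = 0" if x: "x \<in> A" for x
    proof -
      have "w x * U2 x = 0" using 2(1) x A w nn unfolding S2_def by (subst (asm) sum_nonneg_eq_0_iff) auto
      moreover have "U x = 0" if "U2 x = 0"
        using le[OF x] that 2(2) nn(1)[OF x] by (simp add: power_0_left) (metis add_gr_0 le_less not_le zero_less_power)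
      ultimately show ?thesis by auto
    qed
    then have "(\<Sum>x\<in>A. w x * U x) = 0" by (simp add: sum.neutral)
    then show ?thesis using pos S unfolding S1_def S2_def by (simp add: power_0_left)
  next
    case 3
    define a where "a = (if m = 0 then 1 else S1)"
    define b where "b = (if r = 0 then 1 else S2)"
    have ab: "a > 0" "b > 0" "a ^ m = S1 ^ m" "b ^ r = S2 ^ r" "real m * S1 / a = real m" "real r * S2 / b = real r"
      using 3 unfolding a_def b_def by auto
    define g where "g = root (m + r) (a ^ m * b ^ r)"
    have g: "g > 0" "g ^ (m + r) = a ^ m * b ^ r"
    proof -
      have "a ^ m * b ^ r > 0" using ab(1,2) by simp
      then show "g > 0" "g ^ (m + r) = a ^ m * b ^ r"
        using pos unfolding g_def by (auto intro!: real_root_pow_pos2)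
    qed
    have pt: "real (m + r) * (U x / g) \<le> real m * (U1 x / a) + real r * (U2 x / b)" if x: "x \<in> A" for x
    proof (rule weighted_am_gm_nat)
      show "(U x / g) ^ (m + r) \<le> (U1 x / a) ^ m * (U2 x / b) ^ r"
      proof -
        have "(U x / g) ^ (m + r) = U x ^ (m + r) / (a ^ m * b ^ r)"
          using g(2) by (simp only: power_divide)
        also have "\<dots> \<le> (U1 x ^ m * U2 x ^ r) / (a ^ m * b ^ r)"
          using le[OF x] ab(1,2) by (intro divide_right_mono) auto
        finally show ?thesis by (simp add: power_divide)
      qed
    qed (use nn x g ab pos in auto)
    have "real (m + r) * ((\<Sum>x\<in>A. w x * U x) / g) = (\<Sum>x\<in>A. w x * (real (m + r) * (U x / g)))"
      unfolding sum_distrib_left sum_divide_distrib by (intro sum.cong) auto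
    also have "\<dots> \<le> (\<Sum>x\<in>A. w x * (real m * (U1 x / a) + real r * (U2 x / b)))"
      using pt w by (intro sum_mono mult_left_mono) auto
    also have "\<dots> = real m * S1 / a + real r * S2 / b"
      unfolding S1_def S2_def sum_distrib_left sum_divide_distrib sum.distrib[symmetric]
      by (intro sum.cong) (auto simp: algebra_simps)
    also have "\<dots> = real (m + r)" using ab by simp
    finally have "real (m + r) * ((\<Sum>x\<in>A. w x * U x) / g) \<le> real (m + r) * 1" by simp
    moreover have "real (m + r) > 0" using pos by (simp only: of_nat_0_less_iff)
    ultimately have "(\<Sum>x\<in>A. w x * U x) / g \<le> 1"
      using mult_le_cancel_left_pos by blast
    then have "(\<Sum>x\<in>A. w x * U x) \<le> g" using g by (simp add: field_simps)
    then have "(\<Sum>x\<in>A. w x * U x) ^ (m + r) \<le> g ^ (m + r)" using Unn by (intro power_mono)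
    then show ?thesis using g ab unfolding S1_def S2_def by simp
  qed
qed

text \<open>The triangle inequality in L^s, with upper bounds \<open>c i\<close> in place of the
  norms. If C is the sum of the bounds, U / C is at most the average of the functions g i / c i with
  weights c i / C, and convexity of the s-th power does the rest.\<close>

lemma weighted_sum_minkowski:
  fixes w U :: "'a \<Rightarrow> real" and g :: "'i \<Rightarrow> 'a \<Rightarrow> real" and c :: "'i \<Rightarrow> real"
  assumes A: "finite A" and w: "\<And>x. x \<in> A \<Longrightarrow> 0 \<le> w x" and I: "finite I"
    and U: "\<And>x. x \<in> A \<Longrightarrow> 0 \<le> U x" "\<And>x. x \<in> A \<Longrightarrow> U x \<le> (\<Sum>i\<in>I. g i x)"
    and g: "\<And>i x. i \<in> I \<Longrightarrow> x \<in> A \<Longrightarrow> 0 \<le> g i x"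
    and c: "\<And>i. i \<in> I \<Longrightarrow> 0 \<le> c i"
    and le: "\<And>i. i \<in> I \<Longrightarrow> (\<Sum>x\<in>A. w x * g i x ^ s) \<le> c i ^ s"
    and s: "s > 0"
  shows "(\<Sum>x\<in>A. w x * U x ^ s) \<le> (\<Sum>i\<in>I. c i) ^ s"
proof (cases "I = {}")
  case True
  then have "(\<Sum>x\<in>A. w x * U x ^ s) = (\<Sum>x\<in>A. 0)"
    using U s by (intro sum.cong) (force simp: power_0_left)+
  then show ?thesis using s True by simp
next
  case False
  have pos: "(\<Sum>x\<in>A. w x * U x ^ s) \<le> (\<Sum>i\<in>I. c' i) ^ s"
    if c': "\<And>i. i \<in> I \<Longrightarrow> 0 < c' i" and le': "\<And>i. i \<in> I \<Longrightarrow> (\<Sum>x\<in>A. w x * g i x ^ s) \<le> c' i ^ s" for c'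
  proof -
    define C where "C = (\<Sum>i\<in>I. c' i)"
    have C: "C > 0" unfolding C_def using I False c' by (simp add: sum_pos)
    have pt: "U x ^ s \<le> C ^ s * (\<Sum>i\<in>I. c' i / C * (g i x / c' i) ^ s)" if x: "x \<in> A" for x
    proof -
      have "U x / C \<le> (\<Sum>i\<in>I. (c' i / C) *\<^sub>R (g i x / c' i))"
      proof -
        have "(\<Sum>i\<in>I. (c' i / C) *\<^sub>R (g i x / c' i)) = (\<Sum>i\<in>I. g i x / C)"
          using c' by (intro sum.cong) (auto simp: less_imp_neq[symmetric])
        then show ?thesis using U(2)[OF x] C by (simp add: sum_divide_distrib[symmetric] divide_right_mono)
      qed
      then have "(U x / C) ^ s \<le> (\<Sum>i\<in>I. (c' i / C) *\<^sub>R (g i x / c' i)) ^ s"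
        using U(1)[OF x] C by (intro power_mono) auto
      also have "\<dots> \<le> (\<Sum>i\<in>I. c' i / C * (g i x / c' i) ^ s)"
      proof (rule convex_on_sum[where C = "{0..}" and f = "\<lambda>x. x ^ s"])
        show "convex_on {0..} (\<lambda>x::real. x ^ s)"
          using convex_power_odd[of s] convex_on_subset[OF convex_power_even[of s], of "{0..}"]
          by (cases "even s") auto
        show "(\<Sum>i\<in>I. c' i / C) = 1" using C unfolding C_def by (simp add: sum_divide_distrib[symmetric])
      qed (use I False c' C g x in \<open>auto simp: less_imp_le\<close>)
      finally show ?thesis using C by (simp add: power_divide divide_simps mult.commute)
    qed
    have "(\<Sum>x\<in>A. w x * U x ^ s) \<le> (\<Sum>x\<in>A. w x * (C ^ s * (\<Sum>i\<in>I. c' i / C * (g i x / c' i) ^ s)))"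
      using pt w by (intro sum_mono mult_left_mono) auto
    also have "\<dots> = C ^ s * (\<Sum>x\<in>A. \<Sum>i\<in>I. c' i / C * ((w x * g i x ^ s) / c' i ^ s))"
      by (simp add: sum_distrib_left power_divide mult_ac)
    also have "\<dots> = C ^ s * (\<Sum>i\<in>I. c' i / C * ((\<Sum>x\<in>A. w x * g i x ^ s) / c' i ^ s))"
      by (subst sum.swap) (simp add: sum_distrib_left sum_divide_distrib)
    also have "\<dots> \<le> C ^ s * (\<Sum>i\<in>I. c' i / C * 1)"
    proof (intro mult_left_mono sum_mono)
      fix i assume i: "i \<in> I"
      show "(\<Sum>x\<in>A. w x * g i x ^ s) / c' i ^ s \<le> 1" using le'[OF i] c'[OF i] by simp
    qed (use C c' in \<open>auto simp: less_imp_le\<close>)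
    also have "\<dots> = C ^ s" using C unfolding C_def by (simp add: sum_divide_distrib[symmetric])
    finally show ?thesis unfolding C_def .
  qed
  \<comment> \<open>The convexity argument divides by the bounds. Bounds equal to 0 are reached by
    raising all of them by e and letting e tend to 0.\<close>
  have "((\<lambda>e. (\<Sum>i\<in>I. c i + e) ^ s) \<longlongrightarrow> (\<Sum>i\<in>I. c i + 0) ^ s) (at_right 0)"
    by (intro tendsto_intros)
  moreover have "\<forall>\<^sub>F e in at_right 0. (\<Sum>x\<in>A. w x * U x ^ s) \<le> (\<Sum>i\<in>I. c i + e) ^ s"
    using eventually_at_right_less[of 0]
  proof eventually_elim
    case (elim e)
    show ?case
    proof (rule pos)
      fix i assume i: "i \<in> I"
      show "0 < c i + e" using c[OF i] elim by simp
      have "c i ^ s \<le> (c i + e) ^ s" using c[OF i] elim by (intro power_mono) auto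
      then show "(\<Sum>x\<in>A. w x * g i x ^ s) \<le> (c i + e) ^ s" using le[OF i] by linarith
    qed
  qed
  ultimately have "(\<Sum>x\<in>A. w x * U x ^ s) \<le> (\<Sum>i\<in>I. c i + 0) ^ s"
    by (intro tendsto_lowerbound) auto
  then show ?thesis by simp
qed

section \<open>Polynomials modulo a prime power, and transversality\<close>

lemma poly_eq_sum_atMost:
  fixes Q :: "'a::comm_ring_1 poly"
  assumes "degree Q \<le> n"
  shows "poly Q x = (\<Sum>i\<le>n. coeff Q i * x ^ i)"
  unfolding poly_altdef using assms
  by (intro sum.mono_neutral_left) (auto simp: coeff_eq_0)

text \<open>As a power series modulo q, \<open>[:c, 1:]\<close> is a unit because its constant term
  is one. The induction computes the quotient coefficient by coefficient.\<close>

lemma linear_factor_quotient_mod: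
  fixes c q :: int
  assumes "coprime c q"
  shows "\<exists>T. (\<forall>i\<ge>l. coeff T i = 0) \<and> (\<forall>i<l. [coeff ([:c, 1:] * T) i = coeff g i] (mod q))"
proof (induction l)
  case 0
  show ?case by (rule exI[of _ 0]) simp
next
  case (Suc l)
  obtain c' where c': "[c * c' = 1] (mod q)"
    using assms coprime_iff_invertible_int by blast
  obtain T where T: "\<forall>i\<ge>l. coeff T i = 0" "\<forall>i<l. [coeff ([:c, 1:] * T) i = coeff g i] (mod q)"
    using Suc by blast
  \<comment> \<open>The defect left at degree l, divided by c; the new monomial does not disturb the
    lower degrees.\<close>
  define x where "x = c' * (coeff g l - coeff ([:c, 1:] * T) l)"
  define T' where "T' = T + monom x l"
  have mon: "coeff ([:c, 1:] * monom x l) i = (if i = l then c * x else if i = Suc l then x else 0)" for i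
    by (auto simp: coeff_pCons split: nat.splits)
  have "[coeff ([:c, 1:] * T') i = coeff g i] (mod q)" if "i < Suc l" for i
  proof (cases "i = l")
    case True
    have "[c * c' * (coeff g l - coeff ([:c, 1:] * T) l) = 1 * (coeff g l - coeff ([:c, 1:] * T) l)] (mod q)"
      by (intro cong_mult c' cong_refl)
    then have "[coeff ([:c, 1:] * T) l + c * x = coeff ([:c, 1:] * T) l + (coeff g l - coeff ([:c, 1:] * T) l)] (mod q)"
      unfolding x_def by (intro cong_add cong_refl) (simp add: mult.assoc)
    then show ?thesis using True mon[of l] unfolding T'_def by (simp only: distrib_left coeff_add) simp
  next
    case False
    then have "i < l" using that by simp
    then show ?thesis using T(2) mon[of i] unfolding T'_def by (simp only: distrib_left coeff_add) simp
  qed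
  moreover have "\<forall>i\<ge>Suc l. coeff T' i = 0" using T(1) unfolding T'_def by auto
  ultimately show ?case by blast
qed

lemma coeff_mult_cong_mod:
  fixes f g h :: "int poly"
  assumes "\<And>i. i < l \<Longrightarrow> [coeff g i = coeff h i] (mod q)" "i < l"
  shows "[coeff (f * g) i = coeff (f * h) i] (mod q)"
  unfolding coeff_mult using assms by (intro cong_sum cong_mult cong_refl) auto

lemma linear_power_quotient_mod:
  fixes c q :: int
  assumes "coprime c q"
  shows "\<exists>T. (\<forall>i\<ge>l. coeff T i = 0) \<and> (\<forall>i<l. [coeff ([:c, 1:] ^ e * T) i = coeff g i] (mod q))"
proof (induction e)
  case 0
  show ?case by (rule exI[of _ "poly_cutoff l g"]) (simp add: coeff_poly_cutoff)
next
  case (Suc e)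
  obtain T1 where T1: "\<forall>i<l. [coeff ([:c, 1:] ^ e * T1) i = coeff g i] (mod q)"
    using Suc by blast
  obtain T where T: "\<forall>i\<ge>l. coeff T i = 0" "\<forall>i<l. [coeff ([:c, 1:] * T) i = coeff T1 i] (mod q)"
    using linear_factor_quotient_mod[OF assms] by blast
  have "[coeff ([:c, 1:] ^ Suc e * T) i = coeff g i] (mod q)" if "i < l" for i
  proof -
    have "[coeff ([:c, 1:] ^ e * ([:c, 1:] * T)) i = coeff ([:c, 1:] ^ e * T1) i] (mod q)"
      using T(2) that by (intro coeff_mult_cong_mod[where l = l]) auto
    then show ?thesis using T1 that cong_trans by (simp only: power_Suc2 mult.assoc) blast
  qed
  then show ?case using T(1) by blast
qed

text \<open>On polynomials of degree below l, the operator sending R to h R + (v + c) R' is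
  triangular with the units h + i on the diagonal. Each induction step fixes the top coefficient and
  moves its contribution to the next lower degree into the right-hand side
  \<open>T'\<close>.\<close>

lemma triangular_solution_mod:
  fixes c q :: int
  assumes "\<And>i. i < l \<Longrightarrow> coprime (int (h + i)) q"
  shows "\<exists>R. (\<forall>i\<ge>l. coeff R i = 0) \<and>
    (\<forall>i<l. [int (h + i) * coeff R i + c * (int (Suc i) * coeff R (Suc i)) = coeff T i] (mod q))"
  using assms
proof (induction l arbitrary: T)
  case 0
  show ?case by (rule exI[of _ 0]) simp
next
  case (Suc l)
  obtain y where y: "[int (h + l) * y = 1] (mod q)"
    using Suc.prems[of l] coprime_iff_invertible_int by blast
  define x where "x = y * coeff T l"
  define T' where "T' = T - (if l = 0 then 0 else monom (c * (int l * x)) (l - 1))"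
  obtain R where R: "\<forall>i\<ge>l. coeff R i = 0"
    "\<forall>i<l. [int (h + i) * coeff R i + c * (int (Suc i) * coeff R (Suc i)) = coeff T' i] (mod q)"
    using Suc.IH[of T'] Suc.prems by fastforce
  define R' where "R' = R + monom x l"
  have "[int (h + i) * coeff R' i + c * (int (Suc i) * coeff R' (Suc i)) = coeff T i] (mod q)"
    if i: "i < Suc l" for i
  proof -
    consider "i = l" | "Suc i = l" | "Suc i < l" using i by linarith
    then show ?thesis
    proof cases
      case 1
      have "[int (h + l) * y * coeff T l = 1 * coeff T l] (mod q)"
        by (intro cong_mult y cong_refl)
      then show ?thesis using 1 R(1) unfolding R'_def x_def by (simp add: mult.assoc)
    next
      case 2
      have "[int (h + i) * coeff R i + c * (int (Suc i) * coeff R (Suc i)) + c * (int l * x)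
        = coeff T' i + c * (int l * x)] (mod q)"
        using R(2) 2 by (intro cong_add cong_refl) auto
      then show ?thesis using 2 R(1) unfolding R'_def T'_def by (auto simp: algebra_simps)
    next
      case 3
      then show ?thesis using R(2)[rule_format, of i] unfolding R'_def T'_def by (auto split: if_splits)
    qed
  qed
  moreover have "\<forall>i\<ge>Suc l. coeff R' i = 0" using R(1) unfolding R'_def by auto
  ultimately show ?case by blast
qed

text \<open>The derivative of \<open>(v + c)\<^sup>h R(v)\<close> is \<open>(v + c)\<^sup>h\<^sup>-\<^sup>1 (h R + (v + c) R')\<close>,
  so one first inverts the power of \<open>v + c\<close> and then the triangular operator in brackets.\<close>

lemma polynomial_with_root_and_prefix_mod:
  fixes c q :: int
  assumes cq: "coprime c q" and h: "h > 0" and l: "l > 0"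
    and cop: "\<And>i. 0 < i \<Longrightarrow> i < h + l \<Longrightarrow> coprime (int i) q"
  shows "\<exists>R. degree ([:c, 1:] ^ h * R) < h + l \<and>
    (\<forall>i. 0 < i \<longrightarrow> i \<le> l \<longrightarrow> [coeff ([:c, 1:] ^ h * R) i = coeff g i] (mod q))"
proof -
  obtain h' where h': "h = Suc h'" using h by (cases h) auto
  obtain T where T: "\<forall>i<l. [coeff ([:c, 1:] ^ h' * T) i = coeff (pderiv g) i] (mod q)"
    using linear_power_quotient_mod[OF cq] by blast
  have "coprime (int (h + i)) q" if "i < l" for i
    using cop[of "h + i"] h that by simp
  from triangular_solution_mod[OF this, of l c T]
  obtain R where R: "\<forall>i\<ge>l. coeff R i = 0"
    "\<forall>i<l. [int (h + i) * coeff R i + c * (int (Suc i) * coeff R (Suc i)) = coeff T i] (mod q)"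
    by blast
  define Q where "Q = [:c, 1:] ^ h * R"
  have degR: "degree R \<le> l - 1"
    using R(1) l by (intro degree_le) auto
  have "degree Q \<le> degree ([:c, 1:] ^ h) + degree R" unfolding Q_def by (rule degree_mult_le)
  also have "degree ([:c, 1:] ^ h) \<le> h" using degree_power_le[of "[:c, 1:]" h] by simp
  finally have dQ: "degree Q < h + l" using degR l by simp
  have dp: "pderiv Q = [:c, 1:] ^ h' * (smult (int h) R + [:c, 1:] * pderiv R)"
  proof -
    have "pderiv Q = [:c, 1:] ^ h * pderiv R + R * pderiv ([:c, 1:] ^ Suc h')"
      unfolding Q_def h' by (rule pderiv_mult)
    also have "pderiv ([:c, 1:] ^ Suc h') = smult (int h) ([:c, 1:] ^ h')"
      unfolding pderiv_power_Suc h' by (simp add: pderiv_pCons)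
    finally show ?thesis unfolding h' by (simp add: algebra_simps)
  qed
  have br: "coeff (smult (int h) R + [:c, 1:] * pderiv R) i
    = int (h + i) * coeff R i + c * (int (Suc i) * coeff R (Suc i))" for i
    by (cases i) (auto simp: coeff_pderiv algebra_simps)
  have "[coeff Q i = coeff g i] (mod q)" if i: "0 < i" "i \<le> l" for i
  proof -
    obtain j where j: "i = Suc j" "j < l" using i by (cases i) auto
    have "[coeff (pderiv Q) j = coeff ([:c, 1:] ^ h' * T) j] (mod q)"
      unfolding dp using R(2) j(2) by (intro coeff_mult_cong_mod[where l = l]) (simp_all only: br)
    then have "[coeff (pderiv Q) j = coeff (pderiv g) j] (mod q)"
      using T j(2) cong_trans by blast
    then have "[int i * coeff Q i = int i * coeff g i] (mod q)"
      unfolding coeff_pderiv j(1) by simp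
    moreover have "coprime (int i) q" using cop i h by simp
    ultimately show ?thesis by (simp add: cong_mult_lcancel)
  qed
  then show ?thesis using dQ unfolding Q_def by blast
qed

text \<open>In the variable v = x - \<xi> the polynomial is (v + c)^h R with h = k - l + 1. Its zero
  of order h at \<eta> gives the divisibility, by the second bound on \<open>a'\<close>. Near \<xi>,
  the coefficients of degrees 1 to l are prescribed, the higher ones are killed by the powers of p^a
  and the first bound on \<open>a'\<close>, and the constant term is left free. The h + l = k + 1
  conditions just fit into degree k.\<close>

lemma transversal_polynomial:
  fixes p \<xi> \<eta> :: int
  assumes p: "prime p" "int k < p" and l: "0 < l" "l \<le> k" and sep: "\<not> [\<xi> = \<eta>] (mod p)"
    and a': "l * a' \<le> (l + 1) * a" "l * a' \<le> (k - l + 1) * b" and deg: "degree \<gamma> \<le> l"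
  shows "\<exists>P. degree P \<le> k \<and> (\<forall>x. [x = \<eta>] (mod p ^ b) \<longrightarrow> p ^ (l * a') dvd poly P x) \<and>
    (\<exists>c0. \<forall>u. [poly P (\<xi> + p ^ a * u) = c0 + p ^ (a * l) * poly \<gamma> u] (mod p ^ (l * a')))"
proof -
  define q where "q = p ^ (l * a')"
  define c where "c = \<xi> - \<eta>"
  define h where "h = k - l + 1"
  have cop: "coprime i q" if "\<not> p dvd i" for i
    using prime_imp_coprime[OF p(1) that] unfolding q_def by (simp add: coprime_commute)
  have cq: "coprime c q" using sep cop unfolding c_def by (simp add: cong_iff_dvd_diff)
  have hl: "h + l = k + 1" "h > 0" using l unfolding h_def by auto
  \<comment> \<open>The weight \<open>p ^ (a * (l - m))\<close> complements the factor
    \<open>p ^ (a * m)\<close> produced by v = p^a u, so that all degrees up to l carry the same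
    power \<open>p ^ (a * l)\<close>.\<close>
  define g where "g = (\<Sum>m\<le>l. monom (p ^ (a * (l - m)) * coeff \<gamma> m) m)"
  have g: "coeff g i = p ^ (a * (l - i)) * coeff \<gamma> i" if "i \<le> l" for i
    unfolding g_def coeff_sum using that by (simp add: coeff_monom if_distrib)
  have "coprime (int i) q" if "0 < i" "i < h + l" for i
  proof (rule cop)
    show "\<not> p dvd int i" using that p(2) hl(1) zdvd_imp_le[of p "int i"] by auto
  qed
  from polynomial_with_root_and_prefix_mod[OF cq hl(2) l(1) this, of g]
  obtain R where R: "degree ([:c, 1:] ^ h * R) < h + l"
    "\<And>i. 0 < i \<Longrightarrow> i \<le> l \<Longrightarrow> [coeff ([:c, 1:] ^ h * R) i = coeff g i] (mod q)" by blast
  define Q where "Q = [:c, 1:] ^ h * R"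
  define P where "P = pcompose Q [:- \<xi>, 1:]"
  have dQ: "degree Q \<le> k" using R(1) hl unfolding Q_def by simp
  have Px: "poly P x = poly Q (x - \<xi>)" for x unfolding P_def by (simp add: poly_pcompose)
  have "degree P \<le> k" using dQ unfolding P_def by (simp add: degree_pcompose)
  moreover have "q dvd poly P x" if x: "[x = \<eta>] (mod p ^ b)" for x
  proof -
    have "p ^ b dvd x - \<eta>" using x by (simp add: cong_iff_dvd_diff)
    then have "(p ^ b) ^ h dvd (x - \<eta>) ^ h" by (rule dvd_power_same)
    moreover have "q dvd (p ^ b) ^ h"
    proof -
      have "(p ^ b) ^ h = p ^ (h * b)" by (simp only: power_mult[symmetric] mult.commute)
      then show ?thesis unfolding q_def using a'(2) by (simp only: h_def le_imp_power_dvd)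
    qed
    moreover have "poly P x = (x - \<eta>) ^ h * poly R (x - \<xi>)"
      unfolding Px Q_def c_def by simp
    ultimately show ?thesis by (metis dvd_mult2 dvd_trans)
  qed
  moreover have "[poly P (\<xi> + p ^ a * u) = (coeff Q 0 - p ^ (a * l) * coeff \<gamma> 0) + p ^ (a * l) * poly \<gamma> u] (mod q)" for u
  proof -
    have "poly P (\<xi> + p ^ a * u) = (\<Sum>m\<le>k. coeff Q m * (p ^ a * u) ^ m)"
      unfolding Px using poly_eq_sum_atMost[OF dQ] by simp
    also have "\<dots> = coeff Q 0 + (\<Sum>m\<in>{1..k}. coeff Q m * (p ^ a * u) ^ m)"
      by (simp add: atMost_atLeast0 sum.atLeast_Suc_atMost)
    finally have e1: "poly P (\<xi> + p ^ a * u) = coeff Q 0 + (\<Sum>m\<in>{1..k}. coeff Q m * (p ^ a * u) ^ m)" .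
    have "poly \<gamma> u = (\<Sum>m\<le>l. coeff \<gamma> m * u ^ m)"
      by (rule poly_eq_sum_atMost[OF deg])
    also have "\<dots> = coeff \<gamma> 0 + (\<Sum>m\<in>{1..l}. coeff \<gamma> m * u ^ m)"
      by (simp add: atMost_atLeast0 sum.atLeast_Suc_atMost)
    finally have e2: "poly \<gamma> u = coeff \<gamma> 0 + (\<Sum>m\<in>{1..l}. coeff \<gamma> m * u ^ m)" .
    have "(\<Sum>m\<in>{1..l}. p ^ (a * l) * (coeff \<gamma> m * u ^ m)) = (\<Sum>m\<in>{1..k}. if m \<le> l then p ^ (a * l) * (coeff \<gamma> m * u ^ m) else 0)"
      using l by (intro sum.mono_neutral_cong_left) auto
    moreover have "[(\<Sum>m\<in>{1..k}. coeff Q m * (p ^ a * u) ^ m) = (\<Sum>m\<in>{1..k}. if m \<le> l then p ^ (a * l) * (coeff \<gamma> m * u ^ m) else 0)] (mod q)"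
    proof (rule cong_sum)
      fix m assume m: "m \<in> {1..k}"
      show "[coeff Q m * (p ^ a * u) ^ m = (if m \<le> l then p ^ (a * l) * (coeff \<gamma> m * u ^ m) else 0)] (mod q)"
      proof (cases "m \<le> l")
        case True
        have "[coeff Q m * (p ^ a * u) ^ m = coeff g m * (p ^ a * u) ^ m] (mod q)"
          using R(2)[of m] m True unfolding Q_def by (intro cong_mult cong_refl) auto
        moreover have "coeff g m * (p ^ a * u) ^ m = p ^ (a * (l - m) + a * m) * (coeff \<gamma> m * u ^ m)"
          using g[OF True] by (simp add: power_mult_distrib power_add power_mult)
        moreover have "a * (l - m) + a * m = a * l" using True by (simp add: distrib_left[symmetric])
        ultimately show ?thesis using True by simp
      next
        case False
        then have "(l + 1) * a \<le> a * m" using mult_le_mono2[of "l + 1" m a] by (simp add: mult.commute)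
        then have "q dvd p ^ (a * m)" unfolding q_def using a'(1) by (intro le_imp_power_dvd) linarith
        then have "q dvd coeff Q m * (p ^ a * u) ^ m"
          by (simp add: power_mult_distrib power_mult)
        then show ?thesis using False by (simp add: cong_0_iff)
      qed
    qed
    ultimately show ?thesis unfolding e1 e2
      by (simp add: distrib_left sum_distrib_left cong_add_lcancel)
  qed
  ultimately show ?thesis unfolding q_def by blast
qed

section \<open>Linear and bilinear decoupling over residue classes\<close>

definition residue_sum :: "(int \<Rightarrow> 'a::comm_monoid_add) \<Rightarrow> int set \<Rightarrow> int \<Rightarrow> int \<Rightarrow> 'a" where
  "residue_sum h X q \<xi> = (\<Sum>x\<in>{x \<in> X. [x = \<xi>] (mod q)}. h x)"

text \<open>Multiplying F by a polynomial phase amounts to permuting \<open>\<Omega>\<close>, as a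
  translation permutes the points of a torus. The factor \<kappa> leaves room for constant phases,
  which arise from constant terms and from restriction to a residue class.\<close>

definition phase_invariant ::
  "nat \<Rightarrow> int \<Rightarrow> (nat \<Rightarrow> int) set \<Rightarrow> ((nat \<Rightarrow> int) \<Rightarrow> real) \<Rightarrow> ((nat \<Rightarrow> int) \<Rightarrow> int \<Rightarrow> complex) \<Rightarrow> bool" where
  "phase_invariant k q \<Omega> w F \<longleftrightarrow> finite \<Omega> \<and> (\<forall>\<omega>\<in>\<Omega>. 0 \<le> w \<omega>) \<and>
    (\<forall>P. degree P \<le> k \<longrightarrow> (\<exists>\<tau>. bij_betw \<tau> \<Omega> \<Omega> \<and> (\<forall>\<omega>\<in>\<Omega>. w (\<tau> \<omega>) = w \<omega> \<and>
      (\<exists>\<kappa>. norm \<kappa> = 1 \<and> (\<forall>x. F (\<tau> \<omega>) x = \<kappa> * F \<omega> x * unit_exp (real_of_int (poly P x) / real_of_int q))))))"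

text \<open>\<open>t J\<close> majorizes the squared L^(2s)-norm of the piece at J, where s is
  \<open>vinogradov_s k\<close>. Majorants may be supplied by another inequality, as happens in
  \<open>bilinear_decoupling_transverse\<close>. The modulus p^(k n) is matched to rescaling:
  passing to a class modulo p^b turns it into p^(k (n - b)).\<close>

definition decoupling_data where
  "decoupling_data p k n \<Omega> w F X t \<longleftrightarrow> phase_invariant k (p ^ (k * n)) \<Omega> w F \<and> finite X \<and> (\<forall>J. 0 \<le> t J) \<and>
    (\<forall>J\<in>{0..<p ^ n}. (\<Sum>\<omega>\<in>\<Omega>. w \<omega> * norm (residue_sum (F \<omega>) X (p ^ n) J) ^ (2 * vinogradov_s k)) \<le> (t J :: real) ^ vinogradov_s k)"

text \<open>\<open>decoupling p k n D\<close> is a $p$-adic $\ell^2 L^{k(k+1)}$ decoupling inequality for the moment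
  curve at scale $p^{-n}$; \<open>D\<close> is the square of the usual constant. Phase invariance replaces the
  integration over the torus, and makes the hypotheses stable under twisting the weight.\<close>

definition decoupling :: "int \<Rightarrow> nat \<Rightarrow> nat \<Rightarrow> real \<Rightarrow> bool" where
  "decoupling p k n D \<longleftrightarrow> 0 \<le> D \<and> (\<forall>\<Omega> w F X t. decoupling_data p k n \<Omega> w F X t \<longrightarrow>
     (\<Sum>\<omega>\<in>\<Omega>. w \<omega> * norm (\<Sum>x\<in>X. F \<omega> x) ^ (2 * vinogradov_s k)) \<le> (D * (\<Sum>J\<in>{0..<p ^ n}. t J)) ^ vinogradov_s k)"

text \<open>The exponent \<open>2 * vinogradov_s l\<close> is the critical one for degree l, so the
  class of \<xi> can be decoupled in degree l with the other factor absorbed in the weight. The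
  exponent at \<eta> completes the total to \<open>2 * vinogradov_s k\<close>.\<close>

definition bilinear_decoupling :: "int \<Rightarrow> nat \<Rightarrow> nat \<Rightarrow> nat \<Rightarrow> nat \<Rightarrow> nat \<Rightarrow> real \<Rightarrow> bool" where
  "bilinear_decoupling p k l a b n B \<longleftrightarrow> 0 \<le> B \<and> (\<forall>\<Omega> w F X t \<xi> \<eta>. decoupling_data p k n \<Omega> w F X t \<longrightarrow> \<not> [\<xi> = \<eta>] (mod p) \<longrightarrow>
     (\<Sum>\<omega>\<in>\<Omega>. w \<omega> * (norm (residue_sum (F \<omega>) X (p ^ a) \<xi>) ^ (2 * vinogradov_s l) *
        norm (residue_sum (F \<omega>) X (p ^ b) \<eta>) ^ (2 * (vinogradov_s k - vinogradov_s l))))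
     \<le> B ^ vinogradov_s k * (residue_sum t {0..<p ^ n} (p ^ a) \<xi> ^ vinogradov_s l *
        residue_sum t {0..<p ^ n} (p ^ b) \<eta> ^ (vinogradov_s k - vinogradov_s l)))"

section \<open>Exponents, additive characters and sums over residue classes\<close>

lemma vinogradov_s_simps [simp]:
  "vinogradov_s 0 = 0" "vinogradov_s (Suc k) = vinogradov_s k + Suc k"
  by (simp_all add: vinogradov_s_def)

lemma vinogradov_s_double: "2 * vinogradov_s k = k * (k + 1)"
  by (simp add: vinogradov_s_def)

lemma vinogradov_s_mono: "l \<le> k \<Longrightarrow> vinogradov_s l \<le> vinogradov_s k"
  by (induction rule: dec_induct) auto

lemma vinogradov_s_pos: "0 < k \<Longrightarrow> 0 < vinogradov_s k"
  by (cases k) auto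

lemma unit_exp_0 [simp]: "unit_exp 0 = 1"
  by (simp add: unit_exp_def)

lemma unit_exp_add: "unit_exp (x + y) = unit_exp x * unit_exp y"
  by (simp add: unit_exp_def exp_add[symmetric] algebra_simps)

lemma unit_exp_of_int [simp]: "unit_exp (of_int m) = 1"
proof -
  have "exp (2 * of_real pi * \<i> * of_real (real_of_int m)) = exp (\<i> * (of_int m * (of_real pi * 2)))"
    by (simp add: mult_ac)
  also have "\<dots> = 1" by (rule exp_2pi_1_int)
  finally show ?thesis unfolding unit_exp_def .
qed

lemma unit_exp_cong_mod:
  assumes "[i = j] (mod q)" "q \<noteq> 0"
  shows "unit_exp (real_of_int i / real_of_int q) = unit_exp (real_of_int j / real_of_int q)"
proof -
  obtain m where "i = j + q * m" using assms(1) by (metis cong_iff_lin cong_sym)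
  then have "real_of_int i / real_of_int q = real_of_int j / real_of_int q + of_int m"
    using assms(2) by (simp add: field_simps)
  then show ?thesis by (simp only: unit_exp_add unit_exp_of_int mult_1_right)
qed

lemma residue_sum_cong:
  "[\<xi> = \<eta>] (mod q) \<Longrightarrow> residue_sum h X q \<xi> = residue_sum h X q \<eta>"
  unfolding residue_sum_def by (intro sum.cong) (auto intro: cong_trans cong_sym)

lemma residue_sum_nonneg:
  fixes t :: "int \<Rightarrow> real"
  shows "(\<And>J. 0 \<le> t J) \<Longrightarrow> 0 \<le> residue_sum t X q \<xi>"
  unfolding residue_sum_def by (simp add: sum_nonneg)

lemma residue_sum_one [simp]: "residue_sum h X 1 \<xi> = sum h X"
  unfolding residue_sum_def by simp

lemma residue_sum_full_system:
  assumes "q > 0"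
  shows "residue_sum t {0..<q} q \<xi> = t (\<xi> mod q)"
proof -
  have "{x \<in> {0..<q}. [x = \<xi>] (mod q)} = {\<xi> mod q}"
    using assms by (auto simp: cong_def)
  then show ?thesis unfolding residue_sum_def by simp
qed

lemma residue_sum_refine:
  fixes p :: int
  assumes p: "p > 0" and X: "finite X"
  shows "residue_sum h X (p ^ a) \<xi> = (\<Sum>J\<in>{0..<p ^ m}. residue_sum h X (p ^ (a + m)) (\<xi> + p ^ a * J))"
proof -
  define S where "S = {x \<in> X. [x = \<xi>] (mod p ^ a)}"
  \<comment> \<open>\<open>g x\<close> reads off the m digits of x - \<xi> in base p that follow the
    lowest a ones; grouping by it splits the class.\<close>
  define g where "g x = ((x - \<xi>) div p ^ a) mod p ^ m" for x
  have fin: "finite S" using X unfolding S_def by simp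
  have "{x \<in> S. g x = J} = {x \<in> X. [x = \<xi> + p ^ a * J] (mod p ^ (a + m))}" if J: "J \<in> {0..<p ^ m}" for J
  proof (intro set_eqI iffI)
    fix x assume x: "x \<in> {x \<in> S. g x = J}"
    then obtain y where y: "x - \<xi> = p ^ a * y" unfolding S_def by (auto simp: cong_iff_dvd_diff)
    then have "y mod p ^ m = J mod p ^ m" using x J p unfolding g_def by simp
    then have "p ^ m dvd y - J" by (simp add: mod_eq_dvd_iff)
    then have "p ^ (a + m) dvd p ^ a * (y - J)" by (simp add: power_add)
    moreover have "x - (\<xi> + p ^ a * J) = p ^ a * (y - J)" using y by (simp add: algebra_simps)
    ultimately show "x \<in> {x \<in> X. [x = \<xi> + p ^ a * J] (mod p ^ (a + m))}"
      using x unfolding S_def by (simp add: cong_iff_dvd_diff)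
  next
    fix x assume x: "x \<in> {x \<in> X. [x = \<xi> + p ^ a * J] (mod p ^ (a + m))}"
    then have "p ^ (a + m) dvd x - (\<xi> + p ^ a * J)" by (simp add: cong_iff_dvd_diff)
    then obtain z where z: "x - (\<xi> + p ^ a * J) = p ^ (a + m) * z" by blast
    then have z': "x - \<xi> = p ^ a * (J + p ^ m * z)" by (simp add: algebra_simps power_add)
    then have "g x = J" using J p unfolding g_def by simp
    then show "x \<in> {x \<in> S. g x = J}" using x z' unfolding S_def by (simp add: cong_iff_dvd_diff)
  qed
  then have "(\<Sum>J\<in>{0..<p ^ m}. residue_sum h X (p ^ (a + m)) (\<xi> + p ^ a * J)) = (\<Sum>J\<in>{0..<p ^ m}. \<Sum>x\<in>{x \<in> S. g x = J}. h x)"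
    unfolding residue_sum_def by (intro sum.cong) auto
  also have "\<dots> = sum h S"
    by (rule sum.group) (use fin p in \<open>auto simp: g_def\<close>)
  finally show ?thesis unfolding residue_sum_def S_def by simp
qed

lemma sum_eq_residue_sums:
  fixes p :: int
  assumes "p > 0" "finite X"
  shows "sum h X = (\<Sum>J\<in>{0..<p ^ m}. residue_sum h X (p ^ m) J)"
  using residue_sum_refine[OF assms, of h 0 0 m] by simp

lemma residue_sum_rescale:
  fixes p :: int
  assumes p: "p > 0"
  shows "residue_sum h X (p ^ (a + m)) (\<xi> + p ^ a * J) =
    residue_sum (\<lambda>u. h (\<xi> + p ^ a * u)) {u. \<xi> + p ^ a * u \<in> X} (p ^ m) J"
  unfolding residue_sum_def
proof (rule sum.reindex_bij_witness[where i = "\<lambda>u. \<xi> + p ^ a * u" and j = "\<lambda>x. (x - \<xi>) div p ^ a"])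
  fix x assume x: "x \<in> {x \<in> X. [x = \<xi> + p ^ a * J] (mod p ^ (a + m))}"
  then have "p ^ (a + m) dvd x - (\<xi> + p ^ a * J)" by (simp add: cong_iff_dvd_diff)
  then obtain z where z: "x - (\<xi> + p ^ a * J) = p ^ (a + m) * z" by blast
  then have z': "x = \<xi> + p ^ a * (J + p ^ m * z)" by (simp add: algebra_simps power_add)
  then have d: "(x - \<xi>) div p ^ a = J + p ^ m * z" using p by simp
  show "\<xi> + p ^ a * ((x - \<xi>) div p ^ a) = x" using d z' by simp
  show "(x - \<xi>) div p ^ a \<in> {u \<in> {u. \<xi> + p ^ a * u \<in> X}. [u = J] (mod p ^ m)}"
    using d z' x by (simp add: cong_iff_dvd_diff)
  show "h (\<xi> + p ^ a * ((x - \<xi>) div p ^ a)) = h x" using d z' by simp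
next
  fix u assume u: "u \<in> {u \<in> {u. \<xi> + p ^ a * u \<in> X}. [u = J] (mod p ^ m)}"
  then have "p ^ m dvd u - J" by (simp add: cong_iff_dvd_diff)
  then have "p ^ (a + m) dvd p ^ a * (u - J)" by (simp add: power_add)
  moreover have "\<xi> + p ^ a * u - (\<xi> + p ^ a * J) = p ^ a * (u - J)" by (simp add: algebra_simps)
  ultimately show "\<xi> + p ^ a * u \<in> {x \<in> X. [x = \<xi> + p ^ a * J] (mod p ^ (a + m))}"
    using u by (simp add: cong_iff_dvd_diff)
  show "(\<xi> + p ^ a * u - \<xi>) div p ^ a = u" using p by simp
qed

lemma residue_sum_rescale_total:
  fixes p :: int
  assumes p: "p > 0"
  shows "residue_sum h X (p ^ a) \<xi> = (\<Sum>u\<in>{u. \<xi> + p ^ a * u \<in> X}. h (\<xi> + p ^ a * u))"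
  using residue_sum_rescale[OF p, of h X a 0 \<xi> 0] by simp

lemma finite_rescaled:
  fixes p :: int
  assumes "p > 0" "finite X"
  shows "finite {u. \<xi> + p ^ a * u \<in> X}"
proof -
  have "inj (\<lambda>u. \<xi> + p ^ a * u)" using assms(1) by (auto simp: inj_on_def)
  from finite_vimageI[OF assms(2) this] show ?thesis by (simp add: vimage_def)
qed

section \<open>Rescaling and pullback of phases\<close>

text \<open>The polynomial is r^k \<gamma>((x - \<xi>) / r); since \<gamma> has degree at most k,
  the factor r^k clears the denominators. This is the affine self-similarity of the moment
  curve.\<close>

lemma polynomial_rescale:
  fixes \<xi> r :: int
  assumes "degree \<gamma> \<le> k"
  shows "\<exists>P. degree P \<le> k \<and> (\<forall>u. poly P (\<xi> + r * u) = r ^ k * poly \<gamma> u)"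
proof -
  define G where "G = (\<Sum>i\<le>k. monom (r ^ (k - i) * coeff \<gamma> i) i)"
  have "degree G \<le> k" unfolding G_def
    by (intro degree_sum_le) (auto intro: order_trans[OF degree_monom_le])
  moreover have "poly G (r * u) = r ^ k * poly \<gamma> u" for u
  proof -
    have "poly G (r * u) = (\<Sum>i\<le>k. r ^ k * (coeff \<gamma> i * u ^ i))"
      unfolding G_def poly_sum poly_monom
      by (intro sum.cong) (auto simp: power_mult_distrib mult_ac simp flip: power_add)
    also have "\<dots> = r ^ k * poly \<gamma> u"
      by (simp add: poly_eq_sum_atMost[OF assms] sum_distrib_left)
    finally show ?thesis .
  qed
  ultimately show ?thesis
    by (intro exI[of _ "pcompose G [:- \<xi>, 1:]"]) (auto simp: poly_pcompose degree_pcompose)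
qed

lemma residue_sum_phase:
  assumes "\<And>x. F' x = \<kappa> * F x * unit_exp (\<phi> x)" "\<And>x. [x = \<eta>] (mod r) \<Longrightarrow> unit_exp (\<phi> x) = c"
  shows "residue_sum F' X r \<eta> = \<kappa> * c * residue_sum F X r \<eta>"
  unfolding residue_sum_def sum_distrib_left using assms by (intro sum.cong) auto

text \<open>A phase in u is lifted to a phase in x = \<xi> + r u, which a permutation of
  \<open>\<Omega>\<close> realizes. If the lift is trivial on the class of \<eta>, the sum over that
  class changes by a unimodular factor only, so the weight may be multiplied by a power of its norm.
  For \<open>m = 0\<close> there is no such twist and no condition at \<eta>.\<close>

lemma phase_invariant_pullback:
  assumes inv: "phase_invariant k q \<Omega> w F"
    and lift: "\<And>\<gamma>. degree \<gamma> \<le> l \<Longrightarrow> \<exists>P c. degree P \<le> k \<and> norm c = 1 \<and>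
      (\<forall>u. unit_exp (real_of_int (poly P (\<xi> + r * u)) / real_of_int q) = c * unit_exp (real_of_int (poly \<gamma> u) / real_of_int q')) \<and>
      (m = 0 \<or> (\<forall>x. [x = \<eta>] (mod r') \<longrightarrow> unit_exp (real_of_int (poly P x) / real_of_int q) = 1))"
  shows "phase_invariant l q' \<Omega> (\<lambda>\<omega>. w \<omega> * norm (residue_sum (F \<omega>) X r' \<eta>) ^ m) (\<lambda>\<omega> u. F \<omega> (\<xi> + r * u))"
  unfolding phase_invariant_def
proof (intro conjI allI impI ballI)
  show "finite \<Omega>" using inv unfolding phase_invariant_def by simp
  show "0 \<le> w \<omega> * norm (residue_sum (F \<omega>) X r' \<eta>) ^ m" if "\<omega> \<in> \<Omega>" for \<omega>
    using inv that unfolding phase_invariant_def by simp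
  fix \<gamma> :: "int poly" assume "degree \<gamma> \<le> l"
  from lift[OF this] obtain P c where P: "degree P \<le> k" "norm c = 1"
      "\<And>u. unit_exp (real_of_int (poly P (\<xi> + r * u)) / real_of_int q) = c * unit_exp (real_of_int (poly \<gamma> u) / real_of_int q')"
      "m = 0 \<or> (\<forall>x. [x = \<eta>] (mod r') \<longrightarrow> unit_exp (real_of_int (poly P x) / real_of_int q) = 1)"
    by blast
  from inv P(1) obtain \<tau> where \<tau>: "bij_betw \<tau> \<Omega> \<Omega>" "\<And>\<omega>. \<omega> \<in> \<Omega> \<Longrightarrow> w (\<tau> \<omega>) = w \<omega>"
    "\<And>\<omega>. \<omega> \<in> \<Omega> \<Longrightarrow> \<exists>\<kappa>. norm \<kappa> = 1 \<and> (\<forall>x. F (\<tau> \<omega>) x = \<kappa> * F \<omega> x * unit_exp (real_of_int (poly P x) / real_of_int q))"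
    unfolding phase_invariant_def by metis
  show "\<exists>\<tau>. bij_betw \<tau> \<Omega> \<Omega> \<and> (\<forall>\<omega>\<in>\<Omega>. w (\<tau> \<omega>) * norm (residue_sum (F (\<tau> \<omega>)) X r' \<eta>) ^ m = w \<omega> * norm (residue_sum (F \<omega>) X r' \<eta>) ^ m \<and>
      (\<exists>\<kappa>. norm \<kappa> = 1 \<and> (\<forall>u. F (\<tau> \<omega>) (\<xi> + r * u) = \<kappa> * F \<omega> (\<xi> + r * u) * unit_exp (real_of_int (poly \<gamma> u) / real_of_int q'))))"
  proof (intro exI[of _ \<tau>] conjI ballI \<tau>(1))
    fix \<omega> assume \<omega>: "\<omega> \<in> \<Omega>"
    obtain \<kappa> where \<kappa>: "norm \<kappa> = 1" "\<And>x. F (\<tau> \<omega>) x = \<kappa> * F \<omega> x * unit_exp (real_of_int (poly P x) / real_of_int q)"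
      using \<tau>(3)[OF \<omega>] by blast
    show "w (\<tau> \<omega>) * norm (residue_sum (F (\<tau> \<omega>)) X r' \<eta>) ^ m = w \<omega> * norm (residue_sum (F \<omega>) X r' \<eta>) ^ m"
    proof (cases "m = 0")
      case False
      then have "residue_sum (F (\<tau> \<omega>)) X r' \<eta> = \<kappa> * 1 * residue_sum (F \<omega>) X r' \<eta>"
        using P(4) by (intro residue_sum_phase[OF \<kappa>(2)]) auto
      then show ?thesis using \<tau>(2)[OF \<omega>] \<kappa>(1) by (simp add: norm_mult)
    qed (use \<tau>(2)[OF \<omega>] in simp)
    show "\<exists>\<kappa>. norm \<kappa> = 1 \<and> (\<forall>u. F (\<tau> \<omega>) (\<xi> + r * u) = \<kappa> * F \<omega> (\<xi> + r * u) * unit_exp (real_of_int (poly \<gamma> u) / real_of_int q'))"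
      using \<kappa> P(2,3) by (intro exI[of _ "\<kappa> * c"]) (auto simp: norm_mult mult_ac)
  qed
qed

lemma decoupling_dataD:
  assumes "decoupling_data p k n \<Omega> w F X t"
  shows "phase_invariant k (p ^ (k * n)) \<Omega> w F" "finite X" "0 \<le> t J" "finite \<Omega>" "\<omega> \<in> \<Omega> \<Longrightarrow> 0 \<le> w \<omega>"
    "J \<in> {0..<p ^ n} \<Longrightarrow> (\<Sum>\<omega>\<in>\<Omega>. w \<omega> * norm (residue_sum (F \<omega>) X (p ^ n) J) ^ (2 * vinogradov_s k)) \<le> t J ^ vinogradov_s k"
  using assms unfolding decoupling_data_def phase_invariant_def by auto

lemma decouplingD:
  assumes "decoupling p k n D" "decoupling_data p k n \<Omega> w F X t"
  shows "(\<Sum>\<omega>\<in>\<Omega>. w \<omega> * norm (\<Sum>x\<in>X. F \<omega> x) ^ (2 * vinogradov_s k)) \<le> (D * (\<Sum>J\<in>{0..<p ^ n}. t J)) ^ vinogradov_s k"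
  using assms unfolding decoupling_def by blast

text \<open>The map sending u to \<eta> + p^b u carries the classes modulo p^(n - b) to the
  subclasses modulo p^n of the class of \<eta>, and \<open>polynomial_rescale\<close> adapts the
  phases. A single class is thus an instance of the inequality at scale n - b.\<close>

lemma decoupling_rescaled:
  fixes p :: int
  assumes p: "p > 0" and dec: "decoupling p k (n - b) D" and bn: "b \<le> n"
    and data: "decoupling_data p k n \<Omega> w F X t"
  shows "(\<Sum>\<omega>\<in>\<Omega>. w \<omega> * norm (residue_sum (F \<omega>) X (p ^ b) \<eta>) ^ (2 * vinogradov_s k))
    \<le> (D * residue_sum t {0..<p ^ n} (p ^ b) \<eta>) ^ vinogradov_s k"
proof -
  define F' where "F' = (\<lambda>\<omega> u. F \<omega> (\<eta> + p ^ b * u))"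
  define X' where "X' = {u. \<eta> + p ^ b * u \<in> X}"
  \<comment> \<open>Reduction modulo p^n returns to the standard representative of the subclass,
    where \<open>t\<close> is known to be a bound.\<close>
  define t' where "t' J = t ((\<eta> + p ^ b * J) mod p ^ n)" for J
  have n: "n = b + (n - b)" using bn by simp
  have resc: "residue_sum h X (p ^ n) (\<eta> + p ^ b * J) = residue_sum (\<lambda>u. h (\<eta> + p ^ b * u)) X' (p ^ (n - b)) J"
    for h :: "int \<Rightarrow> complex" and J
    unfolding X'_def by (subst n) (rule residue_sum_rescale[OF p])
  \<comment> \<open>The twist has exponent 0 and equals 1; the pullback only changes the scale
    here.\<close>
  have "phase_invariant k (p ^ (k * (n - b))) \<Omega> (\<lambda>\<omega>. w \<omega> * norm (residue_sum (F \<omega>) X 1 0) ^ 0) F'"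
    unfolding F'_def
  proof (rule phase_invariant_pullback[OF decoupling_dataD(1)[OF data]])
    fix \<gamma> :: "int poly" assume "degree \<gamma> \<le> k"
    from polynomial_rescale[OF this, of \<eta> "p ^ b"] obtain P
      where P: "degree P \<le> k" "\<And>u. poly P (\<eta> + p ^ b * u) = (p ^ b) ^ k * poly \<gamma> u" by blast
    have kn: "k * n = b * k + k * (n - b)" using bn by (simp add: algebra_simps diff_mult_distrib2)
    have "real_of_int (poly P (\<eta> + p ^ b * u)) / real_of_int (p ^ (k * n)) = real_of_int (poly \<gamma> u) / real_of_int (p ^ (k * (n - b)))" for u
      unfolding P kn using p by (simp add: power_add power_mult)
    then show "\<exists>P c. degree P \<le> k \<and> norm c = 1 \<and>
      (\<forall>u. unit_exp (real_of_int (poly P (\<eta> + p ^ b * u)) / real_of_int (p ^ (k * n))) = c * unit_exp (real_of_int (poly \<gamma> u) / real_of_int (p ^ (k * (n - b))))) \<and>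
      ((0::nat) = 0 \<or> (\<forall>x. [x = 0] (mod 1) \<longrightarrow> unit_exp (real_of_int (poly P x) / real_of_int (p ^ (k * n))) = 1))"
      using P(1) by (intro exI[of _ P] exI[of _ 1]) simp
  qed
  then have "phase_invariant k (p ^ (k * (n - b))) \<Omega> w F'" by simp
  then have "decoupling_data p k (n - b) \<Omega> w F' X' t'"
    unfolding decoupling_data_def
  proof (intro conjI allI ballI)
    show "finite X'" unfolding X'_def using finite_rescaled[OF p decoupling_dataD(2)[OF data]] .
    show "0 \<le> t' J" for J unfolding t'_def using decoupling_dataD(3)[OF data] .
    fix J assume J: "J \<in> {0..<p ^ (n - b)}"
    have "residue_sum (F' \<omega>) X' (p ^ (n - b)) J = residue_sum (F \<omega>) X (p ^ n) ((\<eta> + p ^ b * J) mod p ^ n)" for \<omega>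
      unfolding F'_def resc[symmetric] by (rule residue_sum_cong) (simp add: cong_def)
    then show "(\<Sum>\<omega>\<in>\<Omega>. w \<omega> * norm (residue_sum (F' \<omega>) X' (p ^ (n - b)) J) ^ (2 * vinogradov_s k)) \<le> t' J ^ vinogradov_s k"
      unfolding t'_def using decoupling_dataD(6)[OF data] p by simp
  qed
  note decouplingD[OF dec this]
  moreover have "(\<Sum>J\<in>{0..<p ^ (n - b)}. t' J) = residue_sum t {0..<p ^ n} (p ^ b) \<eta>"
  proof -
    have "residue_sum t {0..<p ^ n} (p ^ b) \<eta> = (\<Sum>J\<in>{0..<p ^ (n - b)}. residue_sum t {0..<p ^ n} (p ^ (b + (n - b))) (\<eta> + p ^ b * J))"
      by (rule residue_sum_refine[OF p]) simp
    then show ?thesis unfolding n[symmetric] t'_def using p by (simp add: residue_sum_full_system)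
  qed
  moreover have "(\<Sum>u\<in>X'. F' \<omega> u) = residue_sum (F \<omega>) X (p ^ b) \<eta>" for \<omega>
    unfolding X'_def F'_def by (rule residue_sum_rescale_total[OF p, symmetric])
  ultimately show ?thesis by simp
qed

section \<open>Bilinear inequalities: starting estimates, transversality and exchange of the
  classes\<close>

text \<open>The class of \<xi> has exponent 0, so only the rescaled linear inequality at \<eta>
  remains.\<close>

lemma bilinear_decoupling_0:
  fixes p :: int
  assumes "p > 0" "decoupling p k (n - b) D" "b \<le> n"
  shows "bilinear_decoupling p k 0 a b n D"
  unfolding bilinear_decoupling_def
  using decoupling_rescaled[OF assms] assms(2) by (simp add: decoupling_def power_mult_distrib)

text \<open>Hoelder's inequality separates the classes without any use of transversality, and the
  linear inequality is applied to each of them. This only starts the bootstrap.\<close>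

lemma bilinear_decoupling_holder:
  fixes p :: int
  assumes p: "p > 0" and k: "k > 0" and l: "l \<le> k" and ab: "a \<le> n" "b \<le> n"
    and dec: "decoupling p k (n - a) D1" "decoupling p k (n - b) D2"
    and B: "B \<ge> 0" "D1 ^ vinogradov_s l * D2 ^ (vinogradov_s k - vinogradov_s l) \<le> B ^ vinogradov_s k"
  shows "bilinear_decoupling p k l a b n B"
  unfolding bilinear_decoupling_def
proof (intro conjI allI impI B(1))
  fix \<Omega> w F X t \<xi> \<eta> assume data: "decoupling_data p k n \<Omega> w F X t"
  define m where "m = vinogradov_s l"
  define r where "r = vinogradov_s k - vinogradov_s l"
  have mr: "vinogradov_s k = m + r" "m + r > 0"
    using vinogradov_s_mono[OF l] vinogradov_s_pos[OF k] unfolding m_def r_def by auto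
  define f where "f \<omega> = norm (residue_sum (F \<omega>) X (p ^ a) \<xi>)" for \<omega>
  define g where "g \<omega> = norm (residue_sum (F \<omega>) X (p ^ b) \<eta>)" for \<omega>
  define Ta where "Ta = residue_sum t {0..<p ^ n} (p ^ a) \<xi>"
  define Tb where "Tb = residue_sum t {0..<p ^ n} (p ^ b) \<eta>"
  have T: "Ta \<ge> 0" "Tb \<ge> 0" unfolding Ta_def Tb_def using decoupling_dataD(3)[OF data] by (auto intro: residue_sum_nonneg)
  have D: "D1 \<ge> 0" "D2 \<ge> 0" using dec unfolding decoupling_def by auto
  have w: "\<And>\<omega>. \<omega> \<in> \<Omega> \<Longrightarrow> 0 \<le> w \<omega>" using decoupling_dataD(5)[OF data] .
  have fg: "f \<omega> \<ge> 0" "g \<omega> \<ge> 0" for \<omega> unfolding f_def g_def by auto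
  have "(\<Sum>\<omega>\<in>\<Omega>. w \<omega> * (f \<omega> ^ (2 * m) * g \<omega> ^ (2 * r))) ^ (m + r)
    \<le> (\<Sum>\<omega>\<in>\<Omega>. w \<omega> * f \<omega> ^ (2 * (m + r))) ^ m * (\<Sum>\<omega>\<in>\<Omega>. w \<omega> * g \<omega> ^ (2 * (m + r))) ^ r"
    by (rule weighted_sum_holder)
      (use decoupling_dataD(4)[OF data] w fg mr(2) in \<open>auto simp: power_mult_distrib mult_ac simp flip: power_mult\<close>)
  also have "\<dots> \<le> ((D1 * Ta) ^ (m + r)) ^ m * ((D2 * Tb) ^ (m + r)) ^ r"
    using decoupling_rescaled[OF p dec(1) ab(1) data, of \<xi>] decoupling_rescaled[OF p dec(2) ab(2) data, of \<eta>] D T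
    unfolding f_def[symmetric] g_def[symmetric] Ta_def[symmetric] Tb_def[symmetric] mr(1)
    by (intro mult_mono power_mono) (auto intro!: sum_nonneg mult_nonneg_nonneg zero_le_power w fg)
  also have "\<dots> = ((D1 ^ m * D2 ^ r) * (Ta ^ m * Tb ^ r)) ^ (m + r)"
    by (simp add: power_mult_distrib mult_ac flip: power_mult)
  also have "\<dots> \<le> (B ^ (m + r) * (Ta ^ m * Tb ^ r)) ^ (m + r)"
    using B(2) D T unfolding mr(1) m_def[symmetric] r_def[symmetric]
    by (intro power_mono mult_right_mono) (auto simp: r_def)
  finally have "(\<Sum>\<omega>\<in>\<Omega>. w \<omega> * (f \<omega> ^ (2 * m) * g \<omega> ^ (2 * r))) ^ Suc (m + r - 1) \<le> (B ^ (m + r) * (Ta ^ m * Tb ^ r)) ^ Suc (m + r - 1)"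
    by (simp only: Suc_diff_1[OF mr(2)])
  then have "(\<Sum>\<omega>\<in>\<Omega>. w \<omega> * (f \<omega> ^ (2 * m) * g \<omega> ^ (2 * r))) \<le> B ^ (m + r) * (Ta ^ m * Tb ^ r)"
    by (rule power_le_imp_le_base) (use B T in auto)
  then show "(\<Sum>\<omega>\<in>\<Omega>. w \<omega> * (norm (residue_sum (F \<omega>) X (p ^ a) \<xi>) ^ (2 * vinogradov_s l) *
        norm (residue_sum (F \<omega>) X (p ^ b) \<eta>) ^ (2 * (vinogradov_s k - vinogradov_s l))))
     \<le> B ^ vinogradov_s k * (residue_sum t {0..<p ^ n} (p ^ a) \<xi> ^ vinogradov_s l *
        residue_sum t {0..<p ^ n} (p ^ b) \<eta> ^ (vinogradov_s k - vinogradov_s l))"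
    unfolding f_def g_def Ta_def Tb_def mr(1) m_def[symmetric] by simp
qed

text \<open>With the factor at \<eta> absorbed in the weight, the class of \<xi> is invariant under
  phases of degree l: \<open>transversal_polynomial\<close> realizes them without affecting the
  class of \<eta>. Degree l decoupling therefore splits the class modulo p^a into classes modulo
  p^a', and the assumed inequality at \<open>a'\<close> bounds the pieces.\<close>

lemma bilinear_decoupling_transverse:
  fixes p :: int
  assumes p: "prime p" "int k < p" and l: "0 < l" "l \<le> k"
    and a': "l * a' \<le> (l + 1) * a" "l * a' \<le> (k - l + 1) * b" and a: "0 < a" "a \<le> a'" "a' \<le> n"
    and dec: "decoupling p l (a' - a) D" "1 \<le> D" and bil: "bilinear_decoupling p k l a' b n B"
  shows "bilinear_decoupling p k l a b n (D * B)"
  unfolding bilinear_decoupling_def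
proof (intro conjI allI impI)
  have B: "B \<ge> 0" using bil unfolding bilinear_decoupling_def by simp
  then show "0 \<le> D * B" using dec(2) by simp
  have p0: "p > 0" using p(1) by (simp add: prime_gt_0_int)
  fix \<Omega> w F X t \<xi> \<eta> assume data: "decoupling_data p k n \<Omega> w F X t" and sep: "\<not> [\<xi> = \<eta>] (mod p)"
  define m where "m = vinogradov_s l"
  define r where "r = vinogradov_s k - vinogradov_s l"
  have mr: "vinogradov_s k = m + r" "m > 0"
    using vinogradov_s_mono[OF l(2)] vinogradov_s_pos[OF l(1)] unfolding m_def r_def by auto
  define Tb where "Tb = residue_sum t {0..<p ^ n} (p ^ b) \<eta>"
  define K where "K = B ^ (m + r) * Tb ^ r"
  have T: "residue_sum t {0..<p ^ n} q z \<ge> 0" for q z using decoupling_dataD(3)[OF data] by (auto intro: residue_sum_nonneg)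
  have K: "K \<ge> 0" unfolding K_def Tb_def using B T by simp
  \<comment> \<open>The bound for a piece is K times the power m of its t-sum, whereas decoupling
    data ask for a pure power; the m-th root of K is therefore moved into \<open>t'\<close>.\<close>
  define \<rho> where "\<rho> = root m K"
  have \<rho>: "\<rho> \<ge> 0" "\<rho> ^ m = K" unfolding \<rho>_def using K mr(2) by (auto simp: real_root_pow_pos2)
  define w' where "w' \<omega> = w \<omega> * norm (residue_sum (F \<omega>) X (p ^ b) \<eta>) ^ (2 * r)" for \<omega>
  define F' where "F' = (\<lambda>\<omega> u. F \<omega> (\<xi> + p ^ a * u))"
  define X' where "X' = {u. \<xi> + p ^ a * u \<in> X}"
  define t' where "t' J = \<rho> * residue_sum t {0..<p ^ n} (p ^ a') (\<xi> + p ^ a * J)" for J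
  have aa: "a + (a' - a) = a'" using a by simp
  have la: "l * a' \<le> k * n" using l a by (intro mult_le_mono) auto
  have "phase_invariant l (p ^ (l * (a' - a))) \<Omega> w' F'"
    unfolding w'_def F'_def
  proof (rule phase_invariant_pullback[OF decoupling_dataD(1)[OF data]])
    fix \<gamma> :: "int poly" assume "degree \<gamma> \<le> l"
    from transversal_polynomial[OF p l sep a' this] obtain P c0
      where P: "degree P \<le> k" "\<And>x. [x = \<eta>] (mod p ^ b) \<Longrightarrow> p ^ (l * a') dvd poly P x"
        "\<And>u. [poly P (\<xi> + p ^ a * u) = c0 + p ^ (a * l) * poly \<gamma> u] (mod p ^ (l * a'))" by blast
    \<comment> \<open>The extra power of p rewrites the phase P / p^(l a') with the denominator p^(k
      n) of the given invariance.\<close>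
    define Q where "Q = smult (p ^ (k * n - l * a')) P"
    have pk: "p ^ (k * n) = p ^ (k * n - l * a') * p ^ (l * a')" using la by (simp flip: power_add)
    have Q: "real_of_int (poly Q x) / real_of_int (p ^ (k * n)) = real_of_int (poly P x) / real_of_int (p ^ (l * a'))" for x
      unfolding Q_def pk using p0 by simp
    have lal: "l * a' = a * l + l * (a' - a)" using a by (simp add: algebra_simps diff_mult_distrib2)
    have "unit_exp (real_of_int (poly Q (\<xi> + p ^ a * u)) / real_of_int (p ^ (k * n))) =
      unit_exp (real_of_int c0 / real_of_int (p ^ (l * a'))) * unit_exp (real_of_int (poly \<gamma> u) / real_of_int (p ^ (l * (a' - a))))" for u
    proof -
      have "unit_exp (real_of_int (poly Q (\<xi> + p ^ a * u)) / real_of_int (p ^ (k * n))) =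
        unit_exp (real_of_int (c0 + p ^ (a * l) * poly \<gamma> u) / real_of_int (p ^ (l * a')))"
        unfolding Q using P(3) p0 by (intro unit_exp_cong_mod) auto
      also have "real_of_int (c0 + p ^ (a * l) * poly \<gamma> u) / real_of_int (p ^ (l * a')) =
        real_of_int c0 / real_of_int (p ^ (l * a')) + real_of_int (poly \<gamma> u) / real_of_int (p ^ (l * (a' - a)))"
        unfolding add_divide_distrib of_int_add using p0 by (subst (2) lal) (simp add: power_add)
      finally show ?thesis by (simp only: unit_exp_add)
    qed
    moreover have "unit_exp (real_of_int (poly Q x) / real_of_int (p ^ (k * n))) = 1" if "[x = \<eta>] (mod p ^ b)" for x
    proof -
      have "unit_exp (real_of_int (poly Q x) / real_of_int (p ^ (k * n))) = unit_exp (real_of_int 0 / real_of_int (p ^ (l * a')))"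
        unfolding Q using P(2)[OF that] p0 by (intro unit_exp_cong_mod) (auto simp: cong_0_iff)
      then show ?thesis by simp
    qed
    ultimately show "\<exists>P c. degree P \<le> k \<and> norm c = 1 \<and>
      (\<forall>u. unit_exp (real_of_int (poly P (\<xi> + p ^ a * u)) / real_of_int (p ^ (k * n))) = c * unit_exp (real_of_int (poly \<gamma> u) / real_of_int (p ^ (l * (a' - a))))) \<and>
      (2 * r = 0 \<or> (\<forall>x. [x = \<eta>] (mod p ^ b) \<longrightarrow> unit_exp (real_of_int (poly P x) / real_of_int (p ^ (k * n))) = 1))"
      using P(1) by (intro exI[of _ Q] exI[of _ "unit_exp (real_of_int c0 / real_of_int (p ^ (l * a')))"])
        (auto simp: Q_def norm_unit_exp intro: order_trans[OF degree_smult_le])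
  qed
  then have "decoupling_data p l (a' - a) \<Omega> w' F' X' t'"
    unfolding decoupling_data_def
  proof (intro conjI allI ballI)
    show "finite X'" unfolding X'_def using finite_rescaled[OF p0 decoupling_dataD(2)[OF data]] .
    show "0 \<le> t' J" for J unfolding t'_def using \<rho> T by simp
    fix J
    have "residue_sum (F' \<omega>) X' (p ^ (a' - a)) J = residue_sum (F \<omega>) X (p ^ a') (\<xi> + p ^ a * J)" for \<omega>
      using residue_sum_rescale[OF p0, of "F \<omega>" X a "a' - a" \<xi> J] unfolding F'_def X'_def aa by simp
    then have "(\<Sum>\<omega>\<in>\<Omega>. w' \<omega> * norm (residue_sum (F' \<omega>) X' (p ^ (a' - a)) J) ^ (2 * m)) =
      (\<Sum>\<omega>\<in>\<Omega>. w \<omega> * (norm (residue_sum (F \<omega>) X (p ^ a') (\<xi> + p ^ a * J)) ^ (2 * m) * norm (residue_sum (F \<omega>) X (p ^ b) \<eta>) ^ (2 * r)))"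
      unfolding w'_def by (simp add: mult_ac)
    also have "\<dots> \<le> B ^ (m + r) * (residue_sum t {0..<p ^ n} (p ^ a') (\<xi> + p ^ a * J) ^ m * Tb ^ r)"
    proof -
      \<comment> \<open>As a > 0, all subclasses of the class of \<xi> stay separated from \<eta>
        modulo p.\<close>
      have "p dvd p ^ a * J" using a(1) by (simp add: dvd_power dvd_mult2)
      then have "[\<xi> + p ^ a * J = \<xi>] (mod p)" by (simp add: cong_iff_dvd_diff)
      then have "\<not> [\<xi> + p ^ a * J = \<eta>] (mod p)" using sep cong_sym cong_trans by blast
      then show ?thesis using bil data unfolding bilinear_decoupling_def Tb_def mr(1) m_def[symmetric] r_def[symmetric]
        by (simp add: r_def)
    qed
    also have "\<dots> = t' J ^ m" unfolding t'_def power_mult_distrib \<rho>(2) K_def by (simp add: mult_ac)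
    finally show "(\<Sum>\<omega>\<in>\<Omega>. w' \<omega> * norm (residue_sum (F' \<omega>) X' (p ^ (a' - a)) J) ^ (2 * vinogradov_s l)) \<le> t' J ^ vinogradov_s l"
      unfolding m_def .
  qed
  note decouplingD[OF dec(1) this]
  moreover have "(\<Sum>u\<in>X'. F' \<omega> u) = residue_sum (F \<omega>) X (p ^ a) \<xi>" for \<omega>
    unfolding X'_def F'_def by (rule residue_sum_rescale_total[OF p0, symmetric])
  ultimately have "(\<Sum>\<omega>\<in>\<Omega>. w \<omega> * (norm (residue_sum (F \<omega>) X (p ^ a) \<xi>) ^ (2 * m) * norm (residue_sum (F \<omega>) X (p ^ b) \<eta>) ^ (2 * r)))
    \<le> (D * (\<Sum>J\<in>{0..<p ^ (a' - a)}. t' J)) ^ m"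
    unfolding w'_def m_def by (simp add: mult_ac)
  also have "(\<Sum>J\<in>{0..<p ^ (a' - a)}. t' J) = \<rho> * residue_sum t {0..<p ^ n} (p ^ a) \<xi>"
    using residue_sum_refine[OF p0, of "{0..<p ^ n}" t a \<xi> "a' - a"] unfolding t'_def aa by (simp add: sum_distrib_left)
  also have "(D * (\<rho> * residue_sum t {0..<p ^ n} (p ^ a) \<xi>)) ^ m = D ^ m * (B ^ (m + r) * (residue_sum t {0..<p ^ n} (p ^ a) \<xi> ^ m * Tb ^ r))"
    unfolding power_mult_distrib \<rho>(2) K_def by (simp add: mult_ac)
  \<comment> \<open>Only the power m of D has arisen; D >= 1 fits it to the normalization by the
    power \<open>vinogradov_s k\<close>.\<close>
  also have "\<dots> \<le> D ^ (m + r) * (B ^ (m + r) * (residue_sum t {0..<p ^ n} (p ^ a) \<xi> ^ m * Tb ^ r))"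
    using dec(2) B T unfolding Tb_def by (intro mult_right_mono power_increasing) auto
  finally show "(\<Sum>\<omega>\<in>\<Omega>. w \<omega> * (norm (residue_sum (F \<omega>) X (p ^ a) \<xi>) ^ (2 * vinogradov_s l) *
        norm (residue_sum (F \<omega>) X (p ^ b) \<eta>) ^ (2 * (vinogradov_s k - vinogradov_s l))))
     \<le> (D * B) ^ vinogradov_s k * (residue_sum t {0..<p ^ n} (p ^ a) \<xi> ^ vinogradov_s l *
        residue_sum t {0..<p ^ n} (p ^ b) \<eta> ^ (vinogradov_s k - vinogradov_s l))"
    unfolding mr(1) m_def[symmetric] Tb_def by (simp add: power_mult_distrib mult_ac)
qed

text \<open>With s for \<open>vinogradov_s\<close>: the exponents (s(l), s(k) - s(l)) are the convex
  combination, with weights (k - l)/(k - l + 1) and 1/(k - l + 1), of the pair belonging to l - 1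
  and the reversed pair belonging to k - l.\<close>

lemma vinogradov_s_interpolation:
  assumes "0 < l" "l < k"
  shows "(k - l) * vinogradov_s (l - 1) + (vinogradov_s k - vinogradov_s (k - l)) = (k - l + 1) * vinogradov_s l"
    and "(k - l) * (vinogradov_s k - vinogradov_s (l - 1)) + vinogradov_s (k - l) = (k - l + 1) * (vinogradov_s k - vinogradov_s l)"
proof -
  obtain j m where lj: "l = Suc j" "k = l + m" using assms by (metis less_imp_add_positive gr0_implies_Suc)
  have le: "vinogradov_s m \<le> vinogradov_s k" "vinogradov_s j \<le> vinogradov_s k" "vinogradov_s l \<le> vinogradov_s k"
    by (auto simp: lj simp del: vinogradov_s_simps intro!: vinogradov_s_mono)
  have real_s: "real (vinogradov_s i) = real i * (real i + 1) / 2" for i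
    using arg_cong[OF vinogradov_s_double[of i], of real] by (simp add: algebra_simps)
  have "real ((k - l) * vinogradov_s (l - 1) + (vinogradov_s k - vinogradov_s (k - l))) = real ((k - l + 1) * vinogradov_s l)"
    using le unfolding lj by (simp add: of_nat_diff real_s del: vinogradov_s_simps) (simp add: field_simps)
  then show "(k - l) * vinogradov_s (l - 1) + (vinogradov_s k - vinogradov_s (k - l)) = (k - l + 1) * vinogradov_s l"
    using of_nat_eq_iff by blast
  have "real ((k - l) * (vinogradov_s k - vinogradov_s (l - 1)) + vinogradov_s (k - l)) = real ((k - l + 1) * (vinogradov_s k - vinogradov_s l))"
    using le unfolding lj by (simp add: of_nat_diff real_s del: vinogradov_s_simps) (simp add: field_simps)
  then show "(k - l) * (vinogradov_s k - vinogradov_s (l - 1)) + vinogradov_s (k - l) = (k - l + 1) * (vinogradov_s k - vinogradov_s l)"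
    using of_nat_eq_iff by blast
qed

text \<open>Hoelder's inequality with the weights of \<open>vinogradov_s_interpolation\<close>. One
  factor lowers l, the other has degree k - l with the two classes exchanged, which is allowed
  because separation is symmetric.\<close>

lemma bilinear_decoupling_swap:
  assumes l: "0 < l" "l < k"
    and bil: "bilinear_decoupling p k (l - 1) a b n B1" "bilinear_decoupling p k (k - l) b a n B2"
    and B: "0 \<le> B" "B1 ^ (k - l) * B2 \<le> B ^ (k - l + 1)"
  shows "bilinear_decoupling p k l a b n B"
  unfolding bilinear_decoupling_def
proof (intro conjI allI impI B(1))
  fix \<Omega> w F X t \<xi> \<eta> assume data: "decoupling_data p k n \<Omega> w F X t" and sep: "\<not> [\<xi> = \<eta>] (mod p)"
  define s where "s = vinogradov_s k"
  define m where "m = k - l"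
  define \<alpha> where "\<alpha> = vinogradov_s l"
  define \<alpha>1 where "\<alpha>1 = vinogradov_s (l - 1)"
  define \<alpha>2 where "\<alpha>2 = s - vinogradov_s (k - l)"
  define \<beta> where "\<beta> = s - \<alpha>"
  define \<beta>1 where "\<beta>1 = s - \<alpha>1"
  define \<beta>2 where "\<beta>2 = vinogradov_s (k - l)"
  have ex: "m * \<alpha>1 + \<alpha>2 = (m + 1) * \<alpha>" "m * \<beta>1 + \<beta>2 = (m + 1) * \<beta>"
    using vinogradov_s_interpolation[OF l] unfolding m_def \<alpha>_def \<alpha>1_def \<alpha>2_def \<beta>_def \<beta>1_def \<beta>2_def s_def by auto
  define f where "f \<omega> = norm (residue_sum (F \<omega>) X (p ^ a) \<xi>)" for \<omega>
  define g where "g \<omega> = norm (residue_sum (F \<omega>) X (p ^ b) \<eta>)" for \<omega>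
  define Ta where "Ta = residue_sum t {0..<p ^ n} (p ^ a) \<xi>"
  define Tb where "Tb = residue_sum t {0..<p ^ n} (p ^ b) \<eta>"
  have T: "Ta \<ge> 0" "Tb \<ge> 0" unfolding Ta_def Tb_def using decoupling_dataD(3)[OF data] by (auto intro: residue_sum_nonneg)
  have BB: "B1 \<ge> 0" "B2 \<ge> 0" using bil unfolding bilinear_decoupling_def by auto
  have w: "\<And>\<omega>. \<omega> \<in> \<Omega> \<Longrightarrow> 0 \<le> w \<omega>" using decoupling_dataD(5)[OF data] .
  have fg: "f \<omega> \<ge> 0" "g \<omega> \<ge> 0" for \<omega> unfolding f_def g_def by auto
  have sep': "\<not> [\<eta> = \<xi>] (mod p)" using sep by (simp add: cong_sym_eq)
  have i1: "(\<Sum>\<omega>\<in>\<Omega>. w \<omega> * (f \<omega> ^ (2 * \<alpha>1) * g \<omega> ^ (2 * \<beta>1))) \<le> B1 ^ s * (Ta ^ \<alpha>1 * Tb ^ \<beta>1)"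
    using bil(1) data sep unfolding bilinear_decoupling_def f_def g_def Ta_def Tb_def s_def \<alpha>1_def \<beta>1_def by blast
  have i2: "(\<Sum>\<omega>\<in>\<Omega>. w \<omega> * (f \<omega> ^ (2 * \<alpha>2) * g \<omega> ^ (2 * \<beta>2))) \<le> B2 ^ s * (Ta ^ \<alpha>2 * Tb ^ \<beta>2)"
    using bil(2) data sep' unfolding bilinear_decoupling_def f_def g_def Ta_def Tb_def s_def \<alpha>2_def \<beta>2_def
    by (simp add: mult.commute)
  have pw: "x ^ (2 * ((m + 1) * e)) = (x ^ (2 * e1)) ^ m * x ^ (2 * e2)" if "m * e1 + e2 = (m + 1) * e" for x :: real and e e1 e2
    unfolding that[symmetric] by (simp add: power_add power_mult[symmetric] distrib_left mult_ac)
  have pw': "(x ^ e1) ^ m * x ^ e2 = (x ^ e) ^ (m + 1)" if "m * e1 + e2 = (m + 1) * e" for x :: real and e e1 e2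
    using arg_cong[OF that, of "\<lambda>i. x ^ i"] by (simp add: power_add power_mult[symmetric] mult_ac)
  have "(\<Sum>\<omega>\<in>\<Omega>. w \<omega> * (f \<omega> ^ (2 * \<alpha>) * g \<omega> ^ (2 * \<beta>))) ^ (m + 1)
    \<le> (\<Sum>\<omega>\<in>\<Omega>. w \<omega> * (f \<omega> ^ (2 * \<alpha>1) * g \<omega> ^ (2 * \<beta>1))) ^ m * (\<Sum>\<omega>\<in>\<Omega>. w \<omega> * (f \<omega> ^ (2 * \<alpha>2) * g \<omega> ^ (2 * \<beta>2))) ^ 1"
  proof (rule weighted_sum_holder)
    fix \<omega>
    have "(f \<omega> ^ (2 * \<alpha>) * g \<omega> ^ (2 * \<beta>)) ^ (m + 1) = f \<omega> ^ (2 * ((m + 1) * \<alpha>)) * g \<omega> ^ (2 * ((m + 1) * \<beta>))"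
      unfolding power_mult_distrib power_mult[symmetric] by (simp only: mult_ac)
    also have "\<dots> = (f \<omega> ^ (2 * \<alpha>1) * g \<omega> ^ (2 * \<beta>1)) ^ m * (f \<omega> ^ (2 * \<alpha>2) * g \<omega> ^ (2 * \<beta>2)) ^ 1"
      unfolding pw[OF ex(1)] pw[OF ex(2)] power_mult_distrib by (simp only: mult_ac power_one_right)
    finally show "(f \<omega> ^ (2 * \<alpha>) * g \<omega> ^ (2 * \<beta>)) ^ (m + 1) \<le> (f \<omega> ^ (2 * \<alpha>1) * g \<omega> ^ (2 * \<beta>1)) ^ m * (f \<omega> ^ (2 * \<alpha>2) * g \<omega> ^ (2 * \<beta>2)) ^ 1"
      by simp
  qed (use decoupling_dataD(4)[OF data] w fg in auto)
  also have "\<dots> \<le> (B1 ^ s * (Ta ^ \<alpha>1 * Tb ^ \<beta>1)) ^ m * (B2 ^ s * (Ta ^ \<alpha>2 * Tb ^ \<beta>2)) ^ 1"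
    using i1 i2 BB T by (intro mult_mono power_mono) (auto intro!: sum_nonneg mult_nonneg_nonneg w fg zero_le_power)
  also have "\<dots> = (B1 ^ m * B2) ^ s * (((Ta ^ \<alpha>1) ^ m * Ta ^ \<alpha>2) * ((Tb ^ \<beta>1) ^ m * Tb ^ \<beta>2))"
    unfolding power_mult_distrib power_one_right power_mult[symmetric] mult.commute[of s m] by (simp only: mult_ac)
  also have "\<dots> = (B1 ^ m * B2) ^ s * (Ta ^ \<alpha> * Tb ^ \<beta>) ^ (m + 1)"
    unfolding pw'[OF ex(1)] pw'[OF ex(2)] by (simp only: power_mult_distrib)
  also have "\<dots> \<le> (B ^ (m + 1)) ^ s * (Ta ^ \<alpha> * Tb ^ \<beta>) ^ (m + 1)"
    using B(2) BB T unfolding m_def[symmetric] by (intro mult_right_mono power_mono) auto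
  also have "\<dots> = (B ^ s * (Ta ^ \<alpha> * Tb ^ \<beta>)) ^ Suc m"
    unfolding power_mult_distrib power_mult[symmetric] by (simp add: mult_ac)
  finally have "(\<Sum>\<omega>\<in>\<Omega>. w \<omega> * (f \<omega> ^ (2 * \<alpha>) * g \<omega> ^ (2 * \<beta>))) ^ Suc m \<le> (B ^ s * (Ta ^ \<alpha> * Tb ^ \<beta>)) ^ Suc m" by simp
  then have "(\<Sum>\<omega>\<in>\<Omega>. w \<omega> * (f \<omega> ^ (2 * \<alpha>) * g \<omega> ^ (2 * \<beta>))) \<le> B ^ s * (Ta ^ \<alpha> * Tb ^ \<beta>)"
    by (rule power_le_imp_le_base) (use B T in auto)
  then show "(\<Sum>\<omega>\<in>\<Omega>. w \<omega> * (norm (residue_sum (F \<omega>) X (p ^ a) \<xi>) ^ (2 * vinogradov_s l) *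
        norm (residue_sum (F \<omega>) X (p ^ b) \<eta>) ^ (2 * (vinogradov_s k - vinogradov_s l))))
     \<le> B ^ vinogradov_s k * (residue_sum t {0..<p ^ n} (p ^ a) \<xi> ^ vinogradov_s l *
        residue_sum t {0..<p ^ n} (p ^ b) \<eta> ^ (vinogradov_s k - vinogradov_s l))"
    unfolding f_def g_def Ta_def Tb_def s_def \<alpha>_def \<beta>_def .
qed

section \<open>Linear inequalities: orthogonality, the trivial bound and the broad-narrow
  step\<close>

lemma unit_exp_eq_1_iff: "unit_exp x = 1 \<longleftrightarrow> x \<in> \<int>"
proof
  assume "unit_exp x = 1"
  then obtain n :: int where "2 * pi * x = of_int (2 * n) * pi"
    unfolding unit_exp_def exp_eq_1 by auto
  then have "x = of_int n" by simp
  then show "x \<in> \<int>" by simp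
next
  assume "x \<in> \<int>"
  then obtain n where "x = of_int n" by (auto elim: Ints_cases)
  then show "unit_exp x = 1" by simp
qed

lemma cnj_unit_exp: "cnj (unit_exp x) = unit_exp (- x)"
  by (simp add: unit_exp_def exp_cnj)

text \<open>The permutation realizing the phase x / q multiplies the inner product by
  \<open>z\<close>, the character value at (I - J) / q, which differs from 1.\<close>

lemma phase_invariant_orthogonal:
  assumes inv: "phase_invariant 1 q \<Omega> w F" and ne: "q > 0" "\<not> [I = J] (mod q)"
  shows "(\<Sum>\<omega>\<in>\<Omega>. of_real (w \<omega>) * (residue_sum (F \<omega>) X q I * cnj (residue_sum (F \<omega>) X q J))) = 0" (is "sum ?h \<Omega> = 0")
proof -
  define z where "z = unit_exp (real_of_int (I - J) / real_of_int q)"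
  have "z \<noteq> 1"
  proof
    assume "z = 1"
    then obtain m :: int where "real_of_int (I - J) / real_of_int q = of_int m"
      unfolding z_def unit_exp_eq_1_iff by (auto elim: Ints_cases)
    then have "real_of_int (I - J) = real_of_int (q * m)" using ne(1) by (simp add: field_simps)
    then have "I - J = q * m" by (simp only: of_int_eq_iff)
    then show False using ne(2) by (simp add: cong_iff_dvd_diff)
  qed
  have "degree ([:0, 1:] :: int poly) \<le> 1" by simp
  then obtain \<tau> where \<tau>: "bij_betw \<tau> \<Omega> \<Omega>" "\<And>\<omega>. \<omega> \<in> \<Omega> \<Longrightarrow> w (\<tau> \<omega>) = w \<omega>"
    "\<And>\<omega>. \<omega> \<in> \<Omega> \<Longrightarrow> \<exists>\<kappa>. norm \<kappa> = 1 \<and> (\<forall>x. F (\<tau> \<omega>) x = \<kappa> * F \<omega> x * unit_exp (real_of_int (poly [:0, 1:] x) / real_of_int q))"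
    using inv unfolding phase_invariant_def by metis
  have "?h (\<tau> \<omega>) = z * ?h \<omega>" if \<omega>: "\<omega> \<in> \<Omega>" for \<omega>
  proof -
    obtain \<kappa> where \<kappa>: "norm \<kappa> = 1" "\<And>x. F (\<tau> \<omega>) x = \<kappa> * F \<omega> x * unit_exp (real_of_int (poly [:0, 1:] x) / real_of_int q)"
      using \<tau>(3)[OF \<omega>] by blast
    have r: "residue_sum (F (\<tau> \<omega>)) X q L = \<kappa> * unit_exp (real_of_int L / real_of_int q) * residue_sum (F \<omega>) X q L" for L
      using ne(1) by (intro residue_sum_phase[OF \<kappa>(2)] unit_exp_cong_mod) auto
    have k: "\<kappa> * cnj \<kappa> = 1" using \<kappa>(1) by (simp flip: complex_norm_square)
    have "unit_exp (real_of_int I / real_of_int q) * cnj (unit_exp (real_of_int J / real_of_int q)) = z"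
      unfolding cnj_unit_exp unit_exp_add[symmetric] z_def by (simp add: diff_divide_distrib)
    then have "?h (\<tau> \<omega>) = (\<kappa> * cnj \<kappa>) * z * ?h \<omega>"
      unfolding r \<tau>(2)[OF \<omega>] by (auto simp: mult_ac)
    then show ?thesis using k by simp
  qed
  then have "sum ?h \<Omega> = z * sum ?h \<Omega>"
    using sum.reindex_bij_betw[OF \<tau>(1), of ?h] by (simp add: sum_distrib_left)
  then have "(1 - z) * sum ?h \<Omega> = 0" unfolding left_diff_distrib mult_1_left by simp
  then show ?thesis using \<open>z \<noteq> 1\<close> by simp
qed

text \<open>In degree 1 the exponent is 2, and the pieces are orthogonal, so Pythagoras' theorem
  suffices. This begins the induction on the degree.\<close>

lemma decoupling_1:
  fixes p :: int
  assumes p: "p > 0"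
  shows "decoupling p 1 n 1"
  unfolding decoupling_def
proof (intro conjI allI impI)
  fix \<Omega> w F X t assume data: "decoupling_data p 1 n \<Omega> w F X t"
  define f where "f \<omega> J = residue_sum (F \<omega>) X (p ^ n) J" for \<omega> J
  let ?N = "{0..<p ^ n}"
  have inv: "phase_invariant 1 (p ^ n) \<Omega> w F" using decoupling_dataD(1)[OF data] by simp
  have tot: "(\<Sum>x\<in>X. F \<omega> x) = (\<Sum>J\<in>?N. f \<omega> J)" for \<omega>
    unfolding f_def by (rule sum_eq_residue_sums[OF p decoupling_dataD(2)[OF data]])
  have "complex_of_real (\<Sum>\<omega>\<in>\<Omega>. w \<omega> * norm (\<Sum>x\<in>X. F \<omega> x) ^ 2)
    = (\<Sum>\<omega>\<in>\<Omega>. of_real (w \<omega>) * ((\<Sum>I\<in>?N. f \<omega> I) * cnj (\<Sum>J\<in>?N. f \<omega> J)))"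
    unfolding tot by (simp only: of_real_sum of_real_mult complex_norm_square)
  also have "\<dots> = (\<Sum>\<omega>\<in>\<Omega>. \<Sum>I\<in>?N. \<Sum>J\<in>?N. of_real (w \<omega>) * (f \<omega> I * cnj (f \<omega> J)))"
    unfolding cnj_sum sum_product unfolding sum_distrib_left by (rule refl)
  also have "\<dots> = (\<Sum>I\<in>?N. \<Sum>J\<in>?N. \<Sum>\<omega>\<in>\<Omega>. of_real (w \<omega>) * (f \<omega> I * cnj (f \<omega> J)))"
    by (subst sum.swap) (intro sum.cong refl sum.swap)
  also have "\<dots> = (\<Sum>I\<in>?N. \<Sum>J\<in>?N. if J = I then \<Sum>\<omega>\<in>\<Omega>. of_real (w \<omega>) * (f \<omega> I * cnj (f \<omega> I)) else 0)"
  proof (intro sum.cong refl)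
    fix I J assume IJ: "I \<in> ?N" "J \<in> ?N"
    show "(\<Sum>\<omega>\<in>\<Omega>. of_real (w \<omega>) * (f \<omega> I * cnj (f \<omega> J))) = (if J = I then \<Sum>\<omega>\<in>\<Omega>. of_real (w \<omega>) * (f \<omega> I * cnj (f \<omega> I)) else 0)"
    proof (cases "J = I")
      case False
      then have "\<not> [I = J] (mod p ^ n)" using IJ by (simp add: cong_def)
      then show ?thesis using phase_invariant_orthogonal[OF inv, of I J X] p False unfolding f_def by simp
    qed simp
  qed
  also have "\<dots> = complex_of_real (\<Sum>I\<in>?N. \<Sum>\<omega>\<in>\<Omega>. w \<omega> * norm (f \<omega> I) ^ 2)"
    by (simp flip: complex_norm_square)
  finally have "(\<Sum>\<omega>\<in>\<Omega>. w \<omega> * norm (\<Sum>x\<in>X. F \<omega> x) ^ 2) = (\<Sum>I\<in>?N. \<Sum>\<omega>\<in>\<Omega>. w \<omega> * norm (f \<omega> I) ^ 2)"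
    by (simp only: of_real_eq_iff)
  also have "\<dots> \<le> (\<Sum>I\<in>?N. t I)"
    using decoupling_dataD(6)[OF data] unfolding f_def by (intro sum_mono) simp
  finally show "(\<Sum>\<omega>\<in>\<Omega>. w \<omega> * norm (\<Sum>x\<in>X. F \<omega> x) ^ (2 * vinogradov_s 1)) \<le> (1 * (\<Sum>J\<in>?N. t J)) ^ vinogradov_s 1"
    by simp
qed simp

text \<open>Cauchy-Schwarz over the p^n classes, then Minkowski. The exponent 1 obtained here is
  where the descent starts, and the bound also settles small n.\<close>

lemma decoupling_trivial:
  fixes p :: int
  assumes p: "p > 0" and k: "k > 0"
  shows "decoupling p k n (of_int p ^ n)"
  unfolding decoupling_def
proof (intro conjI allI impI)
  fix \<Omega> w F X t assume data: "decoupling_data p k n \<Omega> w F X t"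
  define f where "f \<omega> J = norm (residue_sum (F \<omega>) X (p ^ n) J)" for \<omega> J
  let ?N = "{0..<p ^ n}" and ?s = "vinogradov_s k" and ?q = "real_of_int p ^ n"
  have "(\<Sum>\<omega>\<in>\<Omega>. w \<omega> * (norm (\<Sum>x\<in>X. F \<omega> x) ^ 2) ^ ?s) \<le> (\<Sum>J\<in>?N. ?q * t J) ^ ?s"
  proof (rule weighted_sum_minkowski[where g = "\<lambda>J \<omega>. ?q * f \<omega> J ^ 2"])
    fix \<omega>
    have "norm (\<Sum>x\<in>X. F \<omega> x) \<le> (\<Sum>J\<in>?N. f \<omega> J)"
      unfolding f_def sum_eq_residue_sums[OF p decoupling_dataD(2)[OF data], of _ n] by (rule norm_sum)
    then have "norm (\<Sum>x\<in>X. F \<omega> x) ^ 2 \<le> (\<Sum>J\<in>?N. f \<omega> J) ^ 2" by (intro power_mono) auto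
    also have "\<dots> \<le> (\<Sum>J\<in>?N. f \<omega> J ^ 2) * card ?N" by (rule sum_squared_le_sum_of_squares)
    also have "\<dots> = (\<Sum>J\<in>?N. ?q * f \<omega> J ^ 2)" using p by (simp add: sum_distrib_left mult.commute)
    finally show "norm (\<Sum>x\<in>X. F \<omega> x) ^ 2 \<le> (\<Sum>J\<in>?N. ?q * f \<omega> J ^ 2)" .
  next
    fix J assume J: "J \<in> ?N"
    have "(\<Sum>\<omega>\<in>\<Omega>. w \<omega> * (?q * f \<omega> J ^ 2) ^ ?s) = ?q ^ ?s * (\<Sum>\<omega>\<in>\<Omega>. w \<omega> * f \<omega> J ^ (2 * ?s))"
      by (simp add: power_mult_distrib sum_distrib_left mult_ac flip: power_mult)
    also have "\<dots> \<le> ?q ^ ?s * t J ^ ?s"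
      using decoupling_dataD(6)[OF data J] p unfolding f_def by (intro mult_left_mono) auto
    finally show "(\<Sum>\<omega>\<in>\<Omega>. w \<omega> * (?q * f \<omega> J ^ 2) ^ ?s) \<le> (?q * t J) ^ ?s" by (simp add: power_mult_distrib)
  qed (use decoupling_dataD[OF data] p vinogradov_s_pos[OF k] in auto)
  then show "(\<Sum>\<omega>\<in>\<Omega>. w \<omega> * norm (\<Sum>x\<in>X. F \<omega> x) ^ (2 * ?s)) \<le> (?q * (\<Sum>J\<in>?N. t J)) ^ ?s"
    by (simp add: power_mult sum_distrib_left)
qed (use p in auto)

text \<open>The square of the full sum is a double sum over classes i, j modulo p. The diagonal
  terms are rescaled copies at scale n - 1 and contribute D with coefficient exactly 1, because the
  t-sums of the classes add up to the total. Off the diagonal the classes are separated; cutting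
  them into classes modulo p^b makes the bilinear inequality available and costs p^b.\<close>

lemma decoupling_broad_narrow:
  fixes p :: int
  assumes p: "p > 0" and k: "k > 0" and b: "0 < b" "b \<le> n"
    and dec: "decoupling p k (n - 1) D" and bil: "bilinear_decoupling p k 1 b b n B"
  shows "decoupling p k n (D + of_int p ^ b * B)"
  unfolding decoupling_def
proof (intro conjI allI impI)
  have BD: "B \<ge> 0" "D \<ge> 0" using dec bil unfolding decoupling_def bilinear_decoupling_def by auto
  then show "0 \<le> D + of_int p ^ b * B" using p by simp
  fix \<Omega> w F X t assume data: "decoupling_data p k n \<Omega> w F X t"
  define s where "s = vinogradov_s k"
  have s: "s > 0" unfolding s_def using vinogradov_s_pos[OF k] .
  define f where "f \<omega> i = norm (residue_sum (F \<omega>) X (p ^ b) i)" for \<omega> i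
  define G where "G \<omega> i = norm (residue_sum (F \<omega>) X (p ^ 1) i)" for \<omega> i
  define T where "T i = residue_sum t {0..<p ^ n} (p ^ 1) i" for i
  define Tb where "Tb i = residue_sum t {0..<p ^ n} (p ^ b) i" for i
  have T: "T i \<ge> 0" "Tb i \<ge> 0" for i
    unfolding T_def Tb_def using decoupling_dataD(3)[OF data] by (auto intro: residue_sum_nonneg)
  have w: "\<And>\<omega>. \<omega> \<in> \<Omega> \<Longrightarrow> 0 \<le> w \<omega>" using decoupling_dataD(5)[OF data] .
  have fin: "finite X" "finite \<Omega>" using decoupling_dataD(2,4)[OF data] .
  have fG: "f \<omega> i \<ge> 0" "G \<omega> i \<ge> 0" for \<omega> i unfolding f_def G_def by auto
  have bb: "1 + (b - 1) = b" using b by simp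
  let ?I = "{0..<p ^ 1}" and ?U = "{0..<p ^ (b - 1)}"
  have refT: "T i = (\<Sum>u\<in>?U. Tb (i + p ^ 1 * u))" for i
    using residue_sum_refine[OF p, of "{0..<p ^ n}" t 1 i "b - 1"] unfolding T_def Tb_def bb by simp
  have refG: "G \<omega> i \<le> (\<Sum>u\<in>?U. f \<omega> (i + p ^ 1 * u))" for \<omega> i
    using residue_sum_refine[OF p fin(1), of "F \<omega>" 1 i "b - 1"] norm_sum unfolding G_def f_def bb by metis
  \<comment> \<open>For l = 1 the exponents 2 and 2 (s - 1) are unequal. Cauchy-Schwarz combines the
    inequalities for (i, j) and (j, i) into a symmetric one, and the arithmetic mean then makes the
    bound additive in i and j.\<close>
  have pair: "(\<Sum>\<omega>\<in>\<Omega>. w \<omega> * (f \<omega> i * f \<omega> j) ^ s) \<le> (B * ((Tb i + Tb j) / 2)) ^ s" if ij: "\<not> [i = j] (mod p)" for i j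
  proof -
    have one: "(\<Sum>\<omega>\<in>\<Omega>. w \<omega> * (f \<omega> i ^ 2 * f \<omega> j ^ (2 * (s - 1)))) \<le> B ^ s * (Tb i * Tb j ^ (s - 1))"
      if "\<not> [i = j] (mod p)" for i j
      using bil data that unfolding bilinear_decoupling_def f_def Tb_def s_def by fastforce
    have ji: "\<not> [j = i] (mod p)" using ij by (simp add: cong_sym_eq)
    obtain r where r: "s = Suc r" using s by (cases s) auto
    have "(\<Sum>\<omega>\<in>\<Omega>. w \<omega> * (f \<omega> i * f \<omega> j) ^ s) ^ (1 + 1) \<le>
      (\<Sum>\<omega>\<in>\<Omega>. w \<omega> * (f \<omega> i ^ 2 * f \<omega> j ^ (2 * (s - 1)))) ^ 1 * (\<Sum>\<omega>\<in>\<Omega>. w \<omega> * (f \<omega> j ^ 2 * f \<omega> i ^ (2 * (s - 1)))) ^ 1"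
    proof (rule weighted_sum_holder)
      fix \<omega>
      have "((f \<omega> i * f \<omega> j) ^ s) ^ (1 + 1) = (f \<omega> i ^ 2 * f \<omega> j ^ (2 * (s - 1))) ^ 1 * (f \<omega> j ^ 2 * f \<omega> i ^ (2 * (s - 1))) ^ 1"
        unfolding r by (simp add: power_mult_distrib power_mult power2_eq_square mult_ac)
      then show "((f \<omega> i * f \<omega> j) ^ s) ^ (1 + 1) \<le> (f \<omega> i ^ 2 * f \<omega> j ^ (2 * (s - 1))) ^ 1 * (f \<omega> j ^ 2 * f \<omega> i ^ (2 * (s - 1))) ^ 1"
        by simp
    qed (use fin w fG in auto)
    also have "\<dots> \<le> (B ^ s * (Tb i * Tb j ^ (s - 1))) * (B ^ s * (Tb j * Tb i ^ (s - 1)))"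
      unfolding power_one_right using BD T
      by (intro mult_mono one ij ji) (auto intro!: sum_nonneg mult_nonneg_nonneg zero_le_power w fG)
    also have "\<dots> = (B ^ 2 * (Tb i * Tb j)) ^ s"
      unfolding r by (simp add: power_mult_distrib power2_eq_square mult_ac)
    also have "\<dots> \<le> ((B * ((Tb i + Tb j) / 2)) ^ 2) ^ s"
    proof (rule power_mono)
      have "Tb i * Tb j \<le> ((Tb i + Tb j) / 2) ^ 2"
        using zero_le_power2[of "Tb i - Tb j"] by (simp add: power2_eq_square field_simps)
      then show "B ^ 2 * (Tb i * Tb j) \<le> (B * ((Tb i + Tb j) / 2)) ^ 2"
        unfolding power_mult_distrib by (intro mult_left_mono) auto
    qed (use T in auto)
    also have "\<dots> = ((B * ((Tb i + Tb j) / 2)) ^ s) ^ Suc 1"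
      by (simp only: power_mult[symmetric] mult.commute numeral_2_eq_2 One_nat_def)
    finally have "(\<Sum>\<omega>\<in>\<Omega>. w \<omega> * (f \<omega> i * f \<omega> j) ^ s) ^ Suc 1 \<le> ((B * ((Tb i + Tb j) / 2)) ^ s) ^ Suc 1" by simp
    then show ?thesis by (rule power_le_imp_le_base) (use BD T in auto)
  qed
  \<comment> \<open>Each of the p^(b - 1) subclasses of i is paired with all those of j, so summing
    the additive bounds repeats every term p^(b - 1) times.\<close>
  define M where "M = B * of_int p ^ (b - 1)"
  have M: "M \<ge> 0" unfolding M_def using BD p by simp
  define c where "c ij = (case ij of (i, j) \<Rightarrow> (if i = j then D * T i else M * ((T i + T j) / 2)))" for ij
  have "(\<Sum>\<omega>\<in>\<Omega>. w \<omega> * (norm (\<Sum>x\<in>X. F \<omega> x) ^ 2) ^ s) \<le> (\<Sum>ij\<in>?I \<times> ?I. c ij) ^ s"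
  proof (rule weighted_sum_minkowski[where g = "\<lambda>ij \<omega>. case ij of (i, j) \<Rightarrow> G \<omega> i * G \<omega> j"])
    fix \<omega>
    have "norm (\<Sum>x\<in>X. F \<omega> x) \<le> (\<Sum>i\<in>?I. G \<omega> i)"
      unfolding G_def sum_eq_residue_sums[OF p fin(1), of _ 1] by (rule norm_sum)
    then have "norm (\<Sum>x\<in>X. F \<omega> x) ^ 2 \<le> (\<Sum>i\<in>?I. G \<omega> i) ^ 2" by (intro power_mono) auto
    then show "norm (\<Sum>x\<in>X. F \<omega> x) ^ 2 \<le> (\<Sum>ij\<in>?I \<times> ?I. case ij of (i, j) \<Rightarrow> G \<omega> i * G \<omega> j)"
      by (simp add: power2_eq_square sum_product sum.cartesian_product)
  next
    fix ij assume "ij \<in> ?I \<times> ?I"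
    then obtain i j where ij: "ij = (i, j)" "i \<in> ?I" "j \<in> ?I" by auto
    show "(\<Sum>\<omega>\<in>\<Omega>. w \<omega> * (case ij of (i, j) \<Rightarrow> G \<omega> i * G \<omega> j) ^ s) \<le> c ij ^ s"
    proof (cases "i = j")
      case True
      have "(\<Sum>\<omega>\<in>\<Omega>. w \<omega> * (G \<omega> i * G \<omega> i) ^ s) = (\<Sum>\<omega>\<in>\<Omega>. w \<omega> * G \<omega> i ^ (2 * s))"
        by (simp add: power_mult power2_eq_square)
      also have "\<dots> \<le> (D * T i) ^ s"
        using decoupling_rescaled[OF p dec _ data, of i] b unfolding G_def T_def s_def by simp
      finally show ?thesis using True ij unfolding c_def by simp
    next
      case False
      have "(\<Sum>\<omega>\<in>\<Omega>. w \<omega> * (G \<omega> i * G \<omega> j) ^ s) \<le> (\<Sum>uv\<in>?U \<times> ?U. case uv of (u, v) \<Rightarrow> B * ((Tb (i + p ^ 1 * u) + Tb (j + p ^ 1 * v)) / 2)) ^ s"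
      proof (rule weighted_sum_minkowski[where g = "\<lambda>uv \<omega>. case uv of (u, v) \<Rightarrow> f \<omega> (i + p ^ 1 * u) * f \<omega> (j + p ^ 1 * v)"])
        fix \<omega>
        have "G \<omega> i * G \<omega> j \<le> (\<Sum>u\<in>?U. f \<omega> (i + p ^ 1 * u)) * (\<Sum>v\<in>?U. f \<omega> (j + p ^ 1 * v))"
          using fG by (intro mult_mono refG sum_nonneg) auto
        then show "G \<omega> i * G \<omega> j \<le> (\<Sum>uv\<in>?U \<times> ?U. case uv of (u, v) \<Rightarrow> f \<omega> (i + p ^ 1 * u) * f \<omega> (j + p ^ 1 * v))"
          by (simp add: sum_product sum.cartesian_product)
      next
        fix uv assume "uv \<in> ?U \<times> ?U"
        obtain u v where uv: "uv = (u, v)" by fastforce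
        have "\<not> [i + p ^ 1 * u = j + p ^ 1 * v] (mod p)" using False ij by (simp add: cong_def)
        from pair[OF this]
        show "(\<Sum>\<omega>\<in>\<Omega>. w \<omega> * (case uv of (u, v) \<Rightarrow> f \<omega> (i + p ^ 1 * u) * f \<omega> (j + p ^ 1 * v)) ^ s)
          \<le> (case uv of (u, v) \<Rightarrow> B * ((Tb (i + p ^ 1 * u) + Tb (j + p ^ 1 * v)) / 2)) ^ s"
          unfolding uv by simp
      qed (use fin w fG T BD s in auto)
      also have "(\<Sum>uv\<in>?U \<times> ?U. case uv of (u, v) \<Rightarrow> B * ((Tb (i + p ^ 1 * u) + Tb (j + p ^ 1 * v)) / 2)) = M * ((T i + T j) / 2)"
      proof -
        have "(\<Sum>uv\<in>?U \<times> ?U. case uv of (u, v) \<Rightarrow> B * ((Tb (i + p ^ 1 * u) + Tb (j + p ^ 1 * v)) / 2))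
          = B / 2 * (\<Sum>u\<in>?U. \<Sum>v\<in>?U. Tb (i + p ^ 1 * u) + Tb (j + p ^ 1 * v))"
          by (simp add: sum.cartesian_product sum_distrib_left split_def algebra_simps add_divide_distrib)
        also have "(\<Sum>u\<in>?U. \<Sum>v\<in>?U. Tb (i + p ^ 1 * u) + Tb (j + p ^ 1 * v)) = of_int p ^ (b - 1) * (T i + T j)"
          unfolding refT using p by (simp add: sum.distrib sum_distrib_left algebra_simps)
        finally show ?thesis unfolding M_def by simp
      qed
      finally show ?thesis using False ij unfolding c_def by simp
    qed
  qed (use fin w fG T BD M s in \<open>auto simp: c_def\<close>)
  also have "\<dots> \<le> ((D + of_int p ^ b * B) * (\<Sum>J\<in>{0..<p ^ n}. t J)) ^ s"
  proof (rule power_mono)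
    have tot: "(\<Sum>J\<in>{0..<p ^ n}. t J) = (\<Sum>i\<in>?I. T i)"
      unfolding T_def by (rule sum_eq_residue_sums[OF p]) simp
    \<comment> \<open>The summation over the second index modulo p supplies the last factor
      p.\<close>
    have pb: "real_of_int p ^ b = of_int p * of_int p ^ (b - 1)" using b by (cases b) auto
    have "(\<Sum>ij\<in>?I \<times> ?I. c ij) \<le> (\<Sum>ij\<in>?I \<times> ?I. case ij of (i, j) \<Rightarrow> (if j = i then D * T i else 0) + M * ((T i + T j) / 2))"
      using M T by (intro sum_mono) (auto simp: c_def)
    also have "\<dots> = (\<Sum>i\<in>?I. \<Sum>j\<in>?I. (if j = i then D * T i else 0) + M * ((T i + T j) / 2))"
      by (simp only: sum.cartesian_product)
    also have "\<dots> = (\<Sum>i\<in>?I. D * T i + M / 2 * (of_int p * T i + (\<Sum>j\<in>?I. T j)))"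
      using p by (intro sum.cong) (auto simp: sum.distrib sum_distrib_left algebra_simps sum_divide_distrib[symmetric])
    also have "\<dots> = D * (\<Sum>i\<in>?I. T i) + M / 2 * (of_int p * (\<Sum>i\<in>?I. T i) + of_int p * (\<Sum>j\<in>?I. T j))"
      using p by (simp add: sum.distrib sum_distrib_left[symmetric] sum_divide_distrib[symmetric])
    also have "\<dots> = (D + of_int p ^ b * B) * (\<Sum>i\<in>?I. T i)" unfolding pb M_def by (simp add: algebra_simps)
    finally show "(\<Sum>ij\<in>?I \<times> ?I. c ij) \<le> (D + of_int p ^ b * B) * (\<Sum>J\<in>{0..<p ^ n}. t J)" unfolding tot .
    show "0 \<le> (\<Sum>ij\<in>?I \<times> ?I. c ij)" using T M BD by (intro sum_nonneg) (auto simp: c_def)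
  qed
  finally show "(\<Sum>\<omega>\<in>\<Omega>. w \<omega> * norm (\<Sum>x\<in>X. F \<omega> x) ^ (2 * vinogradov_s k)) \<le> ((D + of_int p ^ b * B) * (\<Sum>J\<in>{0..<p ^ n}. t J)) ^ vinogradov_s k"
    unfolding s_def by (simp add: power_mult)
qed

section \<open>Iterating the bilinear inequalities\<close>

lemma decoupling_mono:
  assumes p: "p > 0" and dec: "decoupling p k n D" and le: "D \<le> D'"
  shows "decoupling p k n D'"
  unfolding decoupling_def
proof (intro conjI allI impI)
  have D: "0 \<le> D" using dec unfolding decoupling_def by simp
  then show "0 \<le> D'" using le by simp
  fix \<Omega> w F X t assume data: "decoupling_data p k n \<Omega> w F X t"
  have "(D * (\<Sum>J\<in>{0..<p ^ n}. t J)) ^ vinogradov_s k \<le> (D' * (\<Sum>J\<in>{0..<p ^ n}. t J)) ^ vinogradov_s k"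
    using D le decoupling_dataD(3)[OF data] by (intro power_mono mult_right_mono) (auto intro!: sum_nonneg mult_nonneg_nonneg)
  then show "(\<Sum>\<omega>\<in>\<Omega>. w \<omega> * norm (\<Sum>x\<in>X. F \<omega> x) ^ (2 * vinogradov_s k)) \<le> (D' * (\<Sum>J\<in>{0..<p ^ n}. t J)) ^ vinogradov_s k"
    using decouplingD[OF dec data] by linarith
qed

lemma bilinear_decoupling_mono:
  assumes bil: "bilinear_decoupling p k l a b n B" and le: "B \<le> B'"
  shows "bilinear_decoupling p k l a b n B'"
  unfolding bilinear_decoupling_def
proof (intro conjI allI impI)
  have B: "0 \<le> B" using bil unfolding bilinear_decoupling_def by simp
  then show "0 \<le> B'" using le by simp
  fix \<Omega> w F X t \<xi> \<eta> assume data: "decoupling_data p k n \<Omega> w F X t" and sep: "\<not> [\<xi> = \<eta>] (mod p)"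
  let ?T = "residue_sum t {0..<p ^ n} (p ^ a) \<xi> ^ vinogradov_s l * residue_sum t {0..<p ^ n} (p ^ b) \<eta> ^ (vinogradov_s k - vinogradov_s l)"
  have "B ^ vinogradov_s k * ?T \<le> B' ^ vinogradov_s k * ?T"
    using B le decoupling_dataD(3)[OF data]
    by (intro power_mono mult_right_mono) (auto intro!: residue_sum_nonneg mult_nonneg_nonneg zero_le_power)
  moreover have "(\<Sum>\<omega>\<in>\<Omega>. w \<omega> * (norm (residue_sum (F \<omega>) X (p ^ a) \<xi>) ^ (2 * vinogradov_s l) *
        norm (residue_sum (F \<omega>) X (p ^ b) \<eta>) ^ (2 * (vinogradov_s k - vinogradov_s l)))) \<le> B ^ vinogradov_s k * ?T"
    using bil data sep unfolding bilinear_decoupling_def by blast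
  ultimately show "(\<Sum>\<omega>\<in>\<Omega>. w \<omega> * (norm (residue_sum (F \<omega>) X (p ^ a) \<xi>) ^ (2 * vinogradov_s l) *
        norm (residue_sum (F \<omega>) X (p ^ b) \<eta>) ^ (2 * (vinogradov_s k - vinogradov_s l)))) \<le> B' ^ vinogradov_s k * ?T"
    by linarith
qed

text \<open>\<open>bilinear_decoupling_transverse\<close> advances the scale at most by the factor 1
  + 1/l, so a long way needs several steps, each with its own constant C. For a >= a0 the steps are
  long enough to absorb it by doubling \<epsilon>, and only the last step leaves a factor C.\<close>

lemma bilinear_decoupling_refine:
  fixes p :: int
  assumes p: "prime p" "int k < p" and \<epsilon>: "\<epsilon> > 0" and C: "C \<ge> 1"
    and dec: "\<And>l m. 0 < l \<Longrightarrow> l < k \<Longrightarrow> decoupling p l m (C * of_int p powr (\<epsilon> * real m))"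
  shows "\<exists>a0. \<forall>l a a' b n B. 0 < l \<longrightarrow> l < k \<longrightarrow> a0 \<le> a \<longrightarrow> a \<le> a' \<longrightarrow> a' \<le> n \<longrightarrow> l * a' \<le> (k - l + 1) * b \<longrightarrow>
    bilinear_decoupling p k l a' b n B \<longrightarrow> bilinear_decoupling p k l a b n (C * of_int p powr (2 * \<epsilon> * real (a' - a)) * B)"
proof -
  define q where "q = real_of_int p"
  have q: "q > 1" unfolding q_def using prime_gt_1_int[OF p(1)] by simp
  obtain m0 :: nat where m0: "log q C / \<epsilon> \<le> real m0" using real_arch_simple by blast
  have "C = q powr (log q C)" using q C by simp
  also have "\<dots> \<le> q powr (\<epsilon> * real m0)" using m0 \<epsilon> q by (intro powr_mono) (auto simp: field_simps)
  finally have Cm0: "C \<le> q powr (\<epsilon> * real m0)" .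
  \<comment> \<open>Ensures \<open>a div l > m0\<close> for every l < k, so a step of this length
    absorbs C.\<close>
  define a0 where "a0 = k * (m0 + 1)"
  have "bilinear_decoupling p k l a b n (C * q powr (2 * \<epsilon> * real (a' - a)) * B)"
    if l: "0 < l" "l < k" and a: "a0 \<le> a" "a \<le> a'" "a' \<le> n" and lb: "l * a' \<le> (k - l + 1) * b" and bil: "bilinear_decoupling p k l a' b n B"
    for l a a' b n B
    using a
  proof (induction "a' - a" arbitrary: a rule: less_induct)
    case less
    have B: "B \<ge> 0" using bil unfolding bilinear_decoupling_def by simp
    have l0: "l * (m0 + 1) \<le> a" using less.prems(1) mult_le_mono1[of l k "m0 + 1"] l unfolding a0_def by linarith
    then have apos: "0 < a" using l by (metis add_gr_0 less_one mult_pos_pos order_less_le_trans)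
    show ?case
    proof (cases "l * a' \<le> (l + 1) * a")
      case True
      have D: "1 \<le> C * q powr (\<epsilon> * real (a' - a))"
        using C q \<epsilon> mult_mono[of 1 C 1 "q powr (\<epsilon> * real (a' - a))"] by (simp add: ge_one_powr_ge_zero)
      have "bilinear_decoupling p k l a b n (C * q powr (\<epsilon> * real (a' - a)) * B)"
        using l less.prems True lb apos dec[OF l, of "a' - a"] D bil unfolding q_def
        by (intro bilinear_decoupling_transverse[OF p]) auto
      moreover have "C * q powr (\<epsilon> * real (a' - a)) * B \<le> C * q powr (2 * \<epsilon> * real (a' - a)) * B"
        using C q \<epsilon> B by (intro mult_right_mono mult_left_mono powr_mono) auto
      ultimately show ?thesis by (rule bilinear_decoupling_mono)
    next
      case False
      \<comment> \<open>The longest admissible step: l (a + m) <= (l + 1) a means m <= a /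
        l.\<close>
      define m where "m = a div l"
      have m: "m0 + 1 \<le> m" "l * m \<le> a" unfolding m_def using l0 l by (auto simp: less_eq_div_iff_mult_less_eq mult.commute)
      define a1 where "a1 = a + m"
      have a1: "l * a1 \<le> (l + 1) * a" using m unfolding a1_def by (simp add: algebra_simps)
      then have "l * a1 < l * a'" using False by linarith
      then have a1': "a1 < a'" by simp
      have ih: "bilinear_decoupling p k l a1 b n (C * q powr (2 * \<epsilon> * real (a' - a1)) * B)"
        using less.hyps[of a1] less.prems a1' m unfolding a1_def by linarith
      have "l * a1 \<le> (k - l + 1) * b" using \<open>l * a1 < l * a'\<close> lb by linarith
      moreover have "C * q powr (\<epsilon> * real m) \<ge> 1"
        using C q \<epsilon> mult_mono[of 1 C 1 "q powr (\<epsilon> * real m)"] by (simp add: ge_one_powr_ge_zero)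
      ultimately have "bilinear_decoupling p k l a b n (C * q powr (\<epsilon> * real m) * (C * q powr (2 * \<epsilon> * real (a' - a1)) * B))"
        using l less.prems a1 a1' apos dec[OF l, of m] ih unfolding q_def
        by - (rule bilinear_decoupling_transverse[OF p, where a' = a1], auto simp: a1_def)
      moreover have "C * q powr (\<epsilon> * real m) * (C * q powr (2 * \<epsilon> * real (a' - a1)) * B) \<le> C * q powr (2 * \<epsilon> * real (a' - a)) * B"
      proof -
        have "C * q powr (\<epsilon> * real m) \<le> q powr (\<epsilon> * real m) * q powr (\<epsilon> * real m)"
          using order_trans[OF Cm0, of "q powr (\<epsilon> * real m)"] q \<epsilon> m by (intro mult_right_mono) (auto intro!: powr_mono)
        also have "\<dots> = q powr (2 * \<epsilon> * real m)"
          unfolding powr_add[symmetric] by (rule arg_cong[where f = "\<lambda>z. q powr z"]) simp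
        finally have "C * q powr (\<epsilon> * real m) * (C * q powr (2 * \<epsilon> * real (a' - a1)) * B) \<le> q powr (2 * \<epsilon> * real m) * (C * q powr (2 * \<epsilon> * real (a' - a1)) * B)"
          using C B by (intro mult_right_mono) auto
        also have "\<dots> = C * (q powr (2 * \<epsilon> * real m) * q powr (2 * \<epsilon> * real (a' - a1))) * B" by simp
        also have "q powr (2 * \<epsilon> * real m) * q powr (2 * \<epsilon> * real (a' - a1)) = q powr (2 * \<epsilon> * real (a' - a))"
          unfolding powr_add[symmetric] using a1' unfolding a1_def
          by (intro arg_cong[where f = "\<lambda>z. q powr z"]) (simp add: of_nat_diff algebra_simps)
        finally show ?thesis .
      qed
      ultimately show ?thesis by (rule bilinear_decoupling_mono)
    qed
  qed
  then show ?thesis unfolding q_def by blast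
qed

text \<open>The saving in units of \<eta> b after M rounds. The formula is an explicit lower bound
  for the recursion imposed by \<open>bilinear_decoupling_swap\<close>, not its exact solution; it
  grows linearly in M for 0 < l < k and is constantly 1 for l = 0.\<close>

definition bootstrap_gain :: "nat \<Rightarrow> nat \<Rightarrow> nat \<Rightarrow> real" where
  "bootstrap_gain k l M = real (k - l) / real k * (1 + real l * real M / real k ^ 2)"

text \<open>This is the Hoelder combination of the exponents for b = l b' and a' = (k - l + 1) b'.
  All terms in M cancel except the increment, which is paid for by the surplus of the terms without
  M, since l (k - l) <= k^2.\<close>

lemma bootstrap_gain_step:
  assumes l: "0 < l" "l < k"
  shows "real (k - l + 1) * real l * bootstrap_gain k l (Suc M) \<le>
    real (k - l) * real l * bootstrap_gain k (l - 1) M + real (k - l + 1) * bootstrap_gain k (k - l) M"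
proof -
  obtain j where j: "l = Suc j" using l by (cases l) auto
  define x where "x = real l"
  define y where "y = real (k - l)"
  define K where "K = real k"
  have K: "K = x + y" "K > 0" "x \<ge> 0" "y \<ge> 0" unfolding x_def y_def K_def using l by auto
  have r: "real (k - l + 1) = y + 1" "real (k - (l - 1)) = y + 1" "real (l - 1) = x - 1" "real (k - (k - l)) = x"
    unfolding x_def y_def using l by (auto simp: j of_nat_diff)
  have "x * y \<le> K ^ 2" unfolding K(1) using K by (simp add: power2_eq_square algebra_simps)
  then have g: "1 / K - y * x / K ^ 3 \<ge> 0" using K(2) by (simp add: field_simps power3_eq_cube power2_eq_square)
  have "(y * x * ((y + 1) / K * (1 + (x - 1) * real M / K ^ 2)) + (y + 1) * (x / K * (1 + y * real M / K ^ 2))) -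
    (y + 1) * x * (y / K * (1 + x * real (Suc M) / K ^ 2)) = (y + 1) * x * (1 / K - y * x / K ^ 3)"
    using K(2) by (simp add: field_simps power3_eq_cube power2_eq_square)
  also have "\<dots> \<ge> 0" using g K by simp
  finally show ?thesis unfolding bootstrap_gain_def r x_def[symmetric] y_def[symmetric] K_def[symmetric] by simp
qed

lemma powr_bound_product:
  fixes q C :: real
  assumes "q > 0" "C \<ge> 0"
  shows "(C * q powr x) ^ m * (C * q powr y) ^ r = C ^ (m + r) * q powr (real m * x + real r * y)"
  using assms by (simp add: power_mult_distrib power_add powr_add powr_power mult_ac)

text \<open>With s for \<open>vinogradov_s\<close>: Hoelder's inequality saves the proportion (s(k)
  - s(l)) / s(k), which is at least (k - l) / k.\<close>

lemma bootstrap_gain_0_le: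
  assumes "0 < k" "l \<le> k"
  shows "real (vinogradov_s k) * bootstrap_gain k l 0 \<le> real (vinogradov_s k - vinogradov_s l)"
proof -
  have s: "2 * real (vinogradov_s i) = real i * (real i + 1)" for i
    using arg_cong[OF vinogradov_s_double[of i], of real] by (simp add: algebra_simps)
  have "2 * (real (vinogradov_s k) * bootstrap_gain k l 0) = (real k - real l) * (real k + 1)"
    using assms s[of k] unfolding bootstrap_gain_def by (simp add: of_nat_diff field_simps)
  also have "\<dots> \<le> real k * (real k + 1) - real l * (real l + 1)"
    using assms mult_left_mono[of "real l" "real k" "real l"] by (simp add: algebra_simps)
  also have "\<dots> = 2 * real (vinogradov_s k - vinogradov_s l)"
    using s[of k] s[of l] vinogradov_s_mono[OF assms(2)] by (simp add: of_nat_diff)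
  finally show ?thesis by simp
qed

text \<open>The side conditions keep the recursion running for M rounds. Divisibility by
  \<open>fact k ^ M\<close> lets b be divided by some l in each round, l a <= (k - l + 1) b is the
  range of transversality, and k^(M + 1) b <= n leaves space for scales that grow by a factor of at
  most k per round.\<close>

lemma bilinear_decoupling_bootstrap:
  fixes p :: int
  assumes p: "prime p" "int k < p"
    and low: "\<And>\<epsilon>. \<epsilon> > 0 \<Longrightarrow> \<exists>C\<ge>1. \<forall>l m. 0 < l \<longrightarrow> l < k \<longrightarrow> decoupling p l m (C * of_int p powr (\<epsilon> * real m))"
    and \<eta>: "\<eta> \<ge> 0" and C0: "C0 \<ge> 1" and dec: "\<And>n. decoupling p k n (C0 * of_int p powr (\<eta> * real n))"
  shows "\<forall>\<epsilon>>0. \<exists>C\<ge>1. \<exists>a0. \<forall>l<k. \<forall>a b n. a0 \<le> a \<longrightarrow> a0 \<le> b \<longrightarrow> fact k ^ M dvd b \<longrightarrow>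
    l * a \<le> (k - l + 1) * b \<longrightarrow> k ^ (M + 1) * b \<le> n \<longrightarrow>
    bilinear_decoupling p k l a b n (C * of_int p powr (\<eta> * real n - bootstrap_gain k l M * \<eta> * real b + \<epsilon> * real n))"
proof (induction M)
  case 0
  define q where "q = real_of_int p"
  have p0: "p > 0" and q: "q > 1" unfolding q_def using prime_gt_1_int[OF p(1)] by simp_all
  have "bilinear_decoupling p k l a b n (C0 * q powr (\<eta> * real n - bootstrap_gain k l 0 * \<eta> * real b + \<epsilon> * real n))"
    if \<epsilon>: "\<epsilon> > 0" and l: "l < k" "l * a \<le> (k - l + 1) * b" "k ^ (0 + 1) * b \<le> n" for \<epsilon> l a b n
  proof -
    have k: "k > 0" using l by simp
    have bn: "b \<le> n" using l(3) k by (metis One_nat_def Suc_leI add_0 le_trans mult_le_mono1 nat_mult_1 power_one_right)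
    have l0: "real (vinogradov_s k) * bootstrap_gain k l 0 \<le> real (vinogradov_s k - vinogradov_s l)"
      using bootstrap_gain_0_le[OF k] l by simp
    have le: "C0 * q powr (\<eta> * real n - bootstrap_gain k l 0 * \<eta> * real b) \<le> C0 * q powr (\<eta> * real n - bootstrap_gain k l 0 * \<eta> * real b + \<epsilon> * real n)"
      using C0 q \<epsilon> by (intro mult_left_mono powr_mono) auto
    show ?thesis
    proof (cases "l = 0")
      case True
      have "bilinear_decoupling p k 0 a b n (C0 * q powr (\<eta> * real (n - b)))"
        using dec bn unfolding q_def by (intro bilinear_decoupling_0 p0)
      moreover have "\<eta> * real (n - b) = \<eta> * real n - bootstrap_gain k 0 0 * \<eta> * real b"
        using bn k unfolding bootstrap_gain_def by (simp add: of_nat_diff algebra_simps)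
      ultimately show ?thesis using True le bilinear_decoupling_mono by metis
    next
      case False
      have an: "a \<le> n"
      proof -
        have "a \<le> l * a" using False by simp
        also have "\<dots> \<le> (k - l + 1) * b" by (rule l)
        also have "\<dots> \<le> k * b" using False l by (intro mult_le_mono1) auto
        finally show ?thesis using l by simp
      qed
      define s where "s = vinogradov_s k"
      define sl where "sl = vinogradov_s l"
      have s: "sl + (s - sl) = s" unfolding s_def sl_def using vinogradov_s_mono[of l k] l by simp
      have "bilinear_decoupling p k l a b n (C0 * q powr (\<eta> * real n - bootstrap_gain k l 0 * \<eta> * real b))"
      proof (rule bilinear_decoupling_holder[OF p0 k _ an bn])
        \<comment> \<open>The saving at the scale a is thrown away; the claim only records the one
          at b.\<close>
        show "decoupling p k (n - a) (C0 * q powr (\<eta> * real n))"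
          by (rule decoupling_mono[OF p0 dec]) (use C0 q \<eta> in \<open>auto simp: q_def intro!: mult_left_mono powr_mono\<close>)
        show "decoupling p k (n - b) (C0 * q powr (\<eta> * real n - \<eta> * real b))"
          using dec[of "n - b"] bn unfolding q_def by (simp add: of_nat_diff algebra_simps)
        have "(C0 * q powr (\<eta> * real n)) ^ sl * (C0 * q powr (\<eta> * real n - \<eta> * real b)) ^ (s - sl) =
          C0 ^ s * q powr (real sl * (\<eta> * real n) + real (s - sl) * (\<eta> * real n - \<eta> * real b))"
          using q C0 s by (subst powr_bound_product) auto
        also have "\<dots> \<le> C0 ^ s * q powr (real s * (\<eta> * real n - bootstrap_gain k l 0 * \<eta> * real b))"
        proof (intro mult_left_mono powr_mono)
          have "real s = real sl + real (s - sl)" using arg_cong[OF s, of real] by (simp only: of_nat_add)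
          then have "real sl * (\<eta> * real n) + real (s - sl) * (\<eta> * real n - \<eta> * real b) = real s * (\<eta> * real n) - real (s - sl) * (\<eta> * real b)"
            by (simp only: algebra_simps)
          also have "\<dots> \<le> real s * (\<eta> * real n) - real s * bootstrap_gain k l 0 * (\<eta> * real b)"
            using mult_right_mono[OF l0, of "\<eta> * real b"] \<eta> unfolding s_def sl_def by simp
          finally show "real sl * (\<eta> * real n) + real (s - sl) * (\<eta> * real n - \<eta> * real b) \<le> real s * (\<eta> * real n - bootstrap_gain k l 0 * \<eta> * real b)"
            by (simp add: algebra_simps)
        qed (use q C0 in auto)
        also have "\<dots> = (C0 * q powr (\<eta> * real n - bootstrap_gain k l 0 * \<eta> * real b)) ^ s"
          using powr_bound_product[of q C0 _ s 0 0] q C0 by simp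
        finally show "(C0 * q powr (\<eta> * real n)) ^ vinogradov_s l * (C0 * q powr (\<eta> * real n - \<eta> * real b)) ^ (vinogradov_s k - vinogradov_s l)
          \<le> (C0 * q powr (\<eta> * real n - bootstrap_gain k l 0 * \<eta> * real b)) ^ vinogradov_s k"
          unfolding s_def sl_def .
      qed (use C0 q l in auto)
      then show ?thesis using le by (rule bilinear_decoupling_mono)
    qed
  qed
  then show ?case using C0 unfolding q_def by (intro allI impI exI[of _ C0] conjI exI[of _ "0::nat"]) auto
next
  case (Suc M)
  show ?case
  proof (intro allI impI)
    fix \<epsilon> :: real assume \<epsilon>: "\<epsilon> > 0"
    define q where "q = real_of_int p"
    have p0: "p > 0" and q: "q > 1" unfolding q_def using prime_gt_1_int[OF p(1)] by simp_all
    obtain C1 a1 where C1: "C1 \<ge> 1" and IH: "\<And>l a b n. l < k \<Longrightarrow> a1 \<le> a \<Longrightarrow> a1 \<le> b \<Longrightarrow> fact k ^ M dvd b \<Longrightarrow>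
        l * a \<le> (k - l + 1) * b \<Longrightarrow> k ^ (M + 1) * b \<le> n \<Longrightarrow>
        bilinear_decoupling p k l a b n (C1 * q powr (\<eta> * real n - bootstrap_gain k l M * \<eta> * real b + \<epsilon> / 2 * real n))"
      using Suc.IH[rule_format, of "\<epsilon> / 2"] \<epsilon> unfolding q_def by (metis half_gt_zero)
    obtain C2 where C2: "C2 \<ge> 1" "\<And>l m. 0 < l \<Longrightarrow> l < k \<Longrightarrow> decoupling p l m (C2 * of_int p powr (\<epsilon> / 4 * real m))"
      using low[of "\<epsilon> / 4"] \<epsilon> by auto
    have e4: "\<epsilon> / 4 > 0" using \<epsilon> by simp
    obtain a2 where a2: "\<And>l a a' b n B. 0 < l \<Longrightarrow> l < k \<Longrightarrow> a2 \<le> a \<Longrightarrow> a \<le> a' \<Longrightarrow> a' \<le> n \<Longrightarrow> l * a' \<le> (k - l + 1) * b \<Longrightarrow>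
        bilinear_decoupling p k l a' b n B \<Longrightarrow> bilinear_decoupling p k l a b n (C2 * q powr (2 * (\<epsilon> / 4) * real (a' - a)) * B)"
      using bilinear_decoupling_refine[OF p e4 C2] unfolding q_def by metis
    have C12: "C1 \<le> C1 * C2" using C1 C2(1) by simp
    have "bilinear_decoupling p k l a b n (C1 * C2 * q powr (\<eta> * real n - bootstrap_gain k l (Suc M) * \<eta> * real b + \<epsilon> * real n))"
      if l: "l < k" and ab: "max a1 a2 \<le> a" "max a1 a2 \<le> b" and b: "fact k ^ Suc M dvd b" and la: "l * a \<le> (k - l + 1) * b"
        and n: "k ^ (Suc M + 1) * b \<le> n" for l a b n
    proof (cases "l = 0")
      \<comment> \<open>For l = 0 the gain does not depend on M, so the induction hypothesis
        suffices.\<close>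
      case True
      have k: "k > 0" using l by simp
      have M: "fact k ^ M dvd b" using b by (rule dvd_trans[rotated]) (simp add: le_imp_power_dvd)
      have "k ^ (M + 1) * b \<le> k ^ (Suc M + 1) * b" using k by (intro mult_le_mono1 power_increasing) auto
      then have "k ^ (M + 1) * b \<le> n" using n by linarith
      then have "bilinear_decoupling p k 0 a b n (C1 * q powr (\<eta> * real n - bootstrap_gain k 0 M * \<eta> * real b + \<epsilon> / 2 * real n))"
        using k ab M by (intro IH) auto
      moreover have "C1 * q powr (\<eta> * real n - bootstrap_gain k 0 M * \<eta> * real b + \<epsilon> / 2 * real n) \<le>
          C1 * C2 * q powr (\<eta> * real n - bootstrap_gain k 0 (Suc M) * \<eta> * real b + \<epsilon> * real n)"
        using C1 C12 q \<epsilon> by (intro mult_mono powr_mono) (auto simp: bootstrap_gain_def)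
      ultimately show ?thesis unfolding True by (rule bilinear_decoupling_mono)
    next
      case False
      then have l0: "0 < l" and k: "0 < k" using l by auto
      obtain f where f: "fact k = l * f" using dvd_fact[of l k] l l0 by (auto simp: dvd_def)
      obtain c where c: "b = fact k ^ Suc M * c" using b by blast
      define b' where "b' = fact k ^ M * (f * c)"
      have b': "b = l * b'" unfolding c b'_def power_Suc f by (simp add: mult_ac)
      \<comment> \<open>The largest scale within transversality,
        \<open>l * a' = (k - l + 1) * b\<close>. It is an integer as l divides b, and it keeps the
        divisor \<open>fact k ^ M\<close> needed by the induction hypothesis.\<close>
      define a' where "a' = (k - l + 1) * b'"
      have div: "fact k ^ M dvd b" "fact k ^ M dvd a'" unfolding b' a'_def by (simp_all add: b'_def)
      have la': "l * a' = (k - l + 1) * b" unfolding a'_def b' by (rule mult.left_commute)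
      then have aa': "a \<le> a'" using la l0 by (metis mult_le_cancel1)
      have kl: "k - l + 1 \<le> k" using l0 l by simp
      have a'kb: "a' \<le> k * b" unfolding a'_def b' using kl l0 by (intro mult_le_mono) auto
      have kM: "k ^ (M + 1) * b \<le> n" "k ^ (M + 1) * a' \<le> n" "a' \<le> n"
      proof -
        have "k ^ (M + 1) * a' \<le> k ^ (M + 1) * (k * b)" using a'kb by (rule mult_le_mono2)
        also have "\<dots> = k ^ (Suc M + 1) * b" by (simp add: mult_ac)
        finally show *: "k ^ (M + 1) * a' \<le> n" using n by (rule le_trans)
        have "k ^ (M + 1) * b \<le> k ^ (Suc M + 1) * b" using k by (intro mult_le_mono1 power_increasing) auto
        then show "k ^ (M + 1) * b \<le> n" using n by linarith
        have "1 * a' \<le> k ^ (M + 1) * a'" using k by (intro mult_le_mono1) (simp add: Suc_leI)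
        then show "a' \<le> n" using * by linarith
      qed
      define m where "m = k - l"
      define E where "E = \<eta> * real n + \<epsilon> / 2 * real n"
      define x1 where "x1 = E - bootstrap_gain k (l - 1) M * \<eta> * real b"
      define x2 where "x2 = E - bootstrap_gain k (k - l) M * \<eta> * real a'"
      define x where "x = E - bootstrap_gain k l (Suc M) * \<eta> * real b"
      \<comment> \<open>The classes are exchanged at the scales a' and b; the result is brought down
        to a afterwards.\<close>
      have "bilinear_decoupling p k (l - 1) a' b n (C1 * q powr (\<eta> * real n - bootstrap_gain k (l - 1) M * \<eta> * real b + \<epsilon> / 2 * real n))"
      proof (rule IH)
        have "(l - 1) * a' \<le> (l * b') * (k - (l - 1) + 1)"
          unfolding a'_def using l0 l by (subst mult.commute[of "k - l + 1" b'], subst mult.assoc[symmetric]) (intro mult_le_mono; simp)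
        then show "(l - 1) * a' \<le> (k - (l - 1) + 1) * b" unfolding b' by (simp add: mult.commute)
      qed (use l ab aa' div kM in auto)
      then have bil1: "bilinear_decoupling p k (l - 1) a' b n (C1 * q powr x1)" unfolding x1_def E_def by (simp add: algebra_simps)
      have "bilinear_decoupling p k (k - l) b a' n (C1 * q powr (\<eta> * real n - bootstrap_gain k (k - l) M * \<eta> * real a' + \<epsilon> / 2 * real n))"
      proof (rule IH)
        have "(k - l) * (l * b') \<le> (k - l + 1) * ((l + 1) * b')" by (intro mult_le_mono) auto
        also have "\<dots> = (l + 1) * a'" unfolding a'_def by (rule mult.left_commute)
        also have "l + 1 = k - (k - l) + 1" using l by simp
        finally show "(k - l) * b \<le> (k - (k - l) + 1) * a'" unfolding b' .
      qed (use l l0 ab aa' div kM in auto)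
      then have bil2: "bilinear_decoupling p k (k - l) b a' n (C1 * q powr x2)" unfolding x2_def E_def by (simp add: algebra_simps)
      have ineq: "real m * x1 + x2 \<le> (real m + 1) * x"
      proof -
        have "real (m + 1) * real l * bootstrap_gain k l (Suc M) \<le> real m * real l * bootstrap_gain k (l - 1) M + real (m + 1) * bootstrap_gain k (k - l) M"
          using bootstrap_gain_step[OF l0 l] unfolding m_def .
        then have "(real (m + 1) * real l * bootstrap_gain k l (Suc M)) * (\<eta> * real b') \<le>
          (real m * real l * bootstrap_gain k (l - 1) M + real (m + 1) * bootstrap_gain k (k - l) M) * (\<eta> * real b')"
          using \<eta> by (intro mult_right_mono) auto
        moreover have "real b = real l * real b'" "real a' = real (m + 1) * real b'" unfolding b' a'_def m_def by (simp_all only: of_nat_mult)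
        ultimately show ?thesis unfolding x1_def x2_def x_def by (simp add: algebra_simps)
      qed
      have "(C1 * q powr x1) ^ m * (C1 * q powr x2) ^ 1 = C1 ^ (m + 1) * q powr (real m * x1 + real 1 * x2)"
        using q C1 by (intro powr_bound_product) auto
      also have "\<dots> \<le> C1 ^ (m + 1) * q powr (real (m + 1) * x + real 0 * 0)"
        using q C1 ineq by (intro mult_left_mono powr_mono) (auto simp: add.commute)
      also have "\<dots> = (C1 * q powr x) ^ (m + 1) * (C1 * q powr 0) ^ 0"
        using q C1 by (subst powr_bound_product) (auto simp only: add_0_right)
      finally have "bilinear_decoupling p k l a' b n (C1 * q powr x)"
        using bilinear_decoupling_swap[OF l0 l bil1 bil2] C1 unfolding m_def by simp
      \<comment> \<open>The way from a' down to a costs at most \<epsilon> / 2 times n in the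
        exponent; the other half of \<epsilon> was given to the induction hypothesis.\<close>
      from a2[OF l0 l _ aa' kM(3) _ this]
      have "bilinear_decoupling p k l a b n (C2 * q powr (2 * (\<epsilon> / 4) * real (a' - a)) * (C1 * q powr x))"
        using ab la' by simp
      moreover have "C2 * q powr (2 * (\<epsilon> / 4) * real (a' - a)) * (C1 * q powr x) \<le> C1 * C2 * q powr (\<eta> * real n - bootstrap_gain k l (Suc M) * \<eta> * real b + \<epsilon> * real n)"
      proof -
        have "C2 * q powr (2 * (\<epsilon> / 4) * real (a' - a)) * (C1 * q powr x) = C1 * C2 * q powr (2 * (\<epsilon> / 4) * real (a' - a) + x)"
          by (simp add: powr_add)
        also have "\<dots> \<le> C1 * C2 * q powr (\<epsilon> / 2 * real n + x)"
          using C1 C2(1) q \<epsilon> kM(3) by (intro mult_left_mono powr_mono) auto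
        finally show ?thesis unfolding x_def E_def by (simp add: algebra_simps)
      qed
      ultimately show ?thesis by (rule bilinear_decoupling_mono)
    qed
    moreover have "C1 * C2 \<ge> 1" using C12 C1 by linarith
    ultimately show "\<exists>C\<ge>1. \<exists>a0. \<forall>l<k. \<forall>a b n. a0 \<le> a \<longrightarrow> a0 \<le> b \<longrightarrow> fact k ^ Suc M dvd b \<longrightarrow>
        l * a \<le> (k - l + 1) * b \<longrightarrow> k ^ (Suc M + 1) * b \<le> n \<longrightarrow>
        bilinear_decoupling p k l a b n (C * of_int p powr (\<eta> * real n - bootstrap_gain k l (Suc M) * \<eta> * real b + \<epsilon> * real n))"
      unfolding q_def by (intro exI[of _ "C1 * C2"] conjI exI[of _ "max a1 a2"]) auto
  qed
qed

section \<open>Lowering the exponent of the linear inequality\<close>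

lemma decoupling_exponent_mono:
  fixes p :: int
  assumes p: "prime p" and dec: "\<And>n. decoupling p k n (C * of_int p powr (\<eta> * real n))" and le: "\<eta> \<le> \<eta>'" and C: "C \<ge> 1"
  shows "decoupling p k n (C * of_int p powr (\<eta>' * real n))"
proof (rule decoupling_mono[OF prime_gt_0_int[OF p] dec])
  have "real_of_int p > 1" using prime_gt_1_int[OF p] by simp
  then show "C * of_int p powr (\<eta> * real n) \<le> C * of_int p powr (\<eta>' * real n)"
    using C le by (intro mult_left_mono powr_mono mult_right_mono) auto
qed

text \<open>M is taken so large that the bilinear saving p^(c \<eta> b) is at least p^(2 b) for all
  \<eta> >= \<eta>0. It outweighs the broad-narrow loss p^b by another p^b, and since b is about
  \<kappa> n this gains a power of p^n.\<close>

lemma decoupling_exponent_improvement: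
  fixes p :: int
  assumes p: "prime p" "int k < p" and k: "k \<ge> 2" and \<eta>0: "\<eta>0 > 0"
    and low: "\<And>\<epsilon>. \<epsilon> > 0 \<Longrightarrow> \<exists>C\<ge>1. \<forall>l m. 0 < l \<longrightarrow> l < k \<longrightarrow> decoupling p l m (C * of_int p powr (\<epsilon> * real m))"
  shows "\<exists>\<delta>>0. \<forall>\<eta>\<ge>\<eta>0. (\<exists>C\<ge>1. \<forall>n. decoupling p k n (C * of_int p powr (\<eta> * real n))) \<longrightarrow>
    (\<exists>C\<ge>1. \<forall>n. decoupling p k n (C * of_int p powr ((\<eta> - \<delta>) * real n)))"
proof -
  define q where "q = real_of_int p"
  have p0: "p > 0" and q: "q > 1" unfolding q_def using prime_gt_1_int[OF p(1)] by simp_all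
  obtain M :: nat where M: "4 * real k ^ 2 / \<eta>0 \<le> real M" using real_arch_simple by blast
  define c where "c = bootstrap_gain k 1 M"
  have c: "c * \<eta>0 \<ge> 2"
  proof -
    have "2 / \<eta>0 \<le> 1 / 2 * (real M / real k ^ 2)" using M k \<eta>0 by (simp add: field_simps)
    also have "\<dots> \<le> real (k - 1) / real k * (1 + real 1 * real M / real k ^ 2)"
    proof (rule mult_mono)
      show "1 / 2 \<le> real (k - 1) / real k" using k by (simp add: of_nat_diff field_simps)
    qed (use k in auto)
    finally show ?thesis unfolding c_def bootstrap_gain_def using \<eta>0 by (simp add: field_simps)
  qed
  define K where "K = k ^ (M + 1)"
  define L :: nat where "L = fact k ^ M"
  have KL: "K > 0" "L > 0" unfolding K_def L_def using k by auto
  define \<kappa> where "\<kappa> = 1 / real K"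
  \<comment> \<open>At most half of \<kappa>, as a quarter is spent on the bootstrap, and below
    \<eta>0, so that the new exponent is positive and the recursion in n sums like a geometric
    series.\<close>
  define \<delta> where "\<delta> = min \<kappa> \<eta>0 / 2"
  have \<kappa>: "\<kappa> > 0" unfolding \<kappa>_def using KL by simp
  have \<delta>: "\<delta> > 0" "\<delta> < \<eta>0" "\<delta> \<le> \<kappa> / 2" unfolding \<delta>_def using \<kappa> \<eta>0 by auto
  have "\<exists>C\<ge>1. \<forall>n. decoupling p k n (C * q powr ((\<eta> - \<delta>) * real n))"
    if \<eta>: "\<eta> \<ge> \<eta>0" and ex: "\<exists>C\<ge>1. \<forall>n. decoupling p k n (C * q powr (\<eta> * real n))" for \<eta>
  proof -
    obtain C0 where C0: "C0 \<ge> 1" "\<And>n. decoupling p k n (C0 * of_int p powr (\<eta> * real n))" using ex unfolding q_def by blast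
    have \<eta>n: "\<eta> \<ge> 0" using \<eta> \<eta>0 by simp
    have "\<kappa> / 4 > 0" using \<kappa> by simp
    from bilinear_decoupling_bootstrap[OF p low \<eta>n C0, of M, rule_format, OF _ this]
    obtain C1 a0 where C1: "C1 \<ge> 1" and bil: "\<And>l a b n. l < k \<Longrightarrow> a0 \<le> a \<Longrightarrow> a0 \<le> b \<Longrightarrow> L dvd b \<Longrightarrow>
        l * a \<le> (k - l + 1) * b \<Longrightarrow> K * b \<le> n \<Longrightarrow>
        bilinear_decoupling p k l a b n (C1 * q powr (\<eta> * real n - bootstrap_gain k l M * \<eta> * real b + \<kappa> / 4 * real n))"
      unfolding q_def K_def L_def by blast
    define \<sigma> where "\<sigma> = \<eta> - \<delta>"
    have \<sigma>: "\<sigma> > 0" unfolding \<sigma>_def using \<delta> \<eta> by simp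
    define n0 where "n0 = K * L * (a0 + 1)"
    have step: "\<exists>b B. 0 < b \<and> b \<le> n \<and> bilinear_decoupling p k 1 b b n B \<and> of_int p ^ b * B \<le> C1 * q powr real L * q powr (\<sigma> * real n)"
      if n: "n \<ge> n0" for n
    proof -
      \<comment> \<open>b will be the largest multiple of L with K b <= n; then b >= \<kappa> n - L,
        and rounding costs only the constant p^L.\<close>
      define d where "d = n div (K * L)"
      define b where "b = L * d"
      have "a0 + 1 \<le> d" unfolding d_def using n KL unfolding n0_def by (simp add: less_eq_div_iff_mult_less_eq mult.commute)
      then have d: "a0 < d" by simp
      have "d \<le> b" unfolding b_def using KL by simp
      then have b: "a0 \<le> b" "0 < b" using d by auto
      have "K * b = K * L * d" unfolding b_def by simp
      also have "\<dots> \<le> n" unfolding d_def by simp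
      finally have Kb: "K * b \<le> n" .
      have bn: "b \<le> n" using Kb KL by (metis dual_order.trans le_square mult_le_mono1 nat_mult_1 Suc_leI One_nat_def)
      have "n < K * L * d + K * L" 
      proof -
        have "0 < K * L" using KL by simp
        from mod_less_divisor[OF this, of n] show ?thesis
          using mult_div_mod_eq[of "K * L" n] unfolding d_def by linarith
      qed
      then have "n < K * (b + L)" unfolding b_def by (simp add: algebra_simps)
      then have "real n < real K * real (b + L)" by (metis of_nat_less_iff of_nat_mult)
      then have bL: "\<kappa> * real n \<le> real b + real L" unfolding \<kappa>_def using KL by (simp add: field_simps)
      define B where "B = C1 * q powr (\<eta> * real n - c * \<eta> * real b + \<kappa> / 4 * real n)"
      have "bilinear_decoupling p k 1 b b n B"
        unfolding B_def c_def using k b Kb by (intro bil) (auto simp: b_def)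
      moreover have "of_int p ^ b * B \<le> C1 * q powr real L * q powr (\<sigma> * real n)"
      proof -
        have "c * \<eta> \<ge> 2"
        proof -
          have "c \<ge> 0" unfolding c_def bootstrap_gain_def by simp
          then show ?thesis using c mult_left_mono[OF \<eta>, of c] by linarith
        qed
        then have "2 * real b \<le> c * \<eta> * real b" by (intro mult_right_mono) auto
        moreover have "\<delta> * real n \<le> \<kappa> / 2 * real n" using \<delta>(3) by (intro mult_right_mono) auto
        moreover have "\<kappa> * real n \<ge> 0" using \<kappa> by simp
        ultimately have e: "real b + (\<eta> * real n - c * \<eta> * real b + \<kappa> / 4 * real n) \<le> real L + \<sigma> * real n"
          using bL unfolding \<sigma>_def left_diff_distrib by linarith
        have "of_int p ^ b * B = C1 * q powr (real b + (\<eta> * real n - c * \<eta> * real b + \<kappa> / 4 * real n))"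
          unfolding B_def using q by (simp add: powr_add powr_realpow q_def[symmetric])
        also have "\<dots> \<le> C1 * q powr (real L + \<sigma> * real n)"
          using C1 q e by (intro mult_left_mono powr_mono) auto
        finally show ?thesis by (simp add: powr_add)
      qed
      ultimately show ?thesis using b bn by blast
    qed
    define \<rho> where "\<rho> = 1 - q powr (- \<sigma>)"
    have \<rho>: "\<rho> > 0" unfolding \<rho>_def using powr_less_mono[of "- \<sigma>" 0 q] q \<sigma> by simp
    \<comment> \<open>The first entry lets the trivial bound cover n < n0. The second closes the
      induction: the term carried over from n - 1 takes up the proportion 1 - \<rho> of the target,
      and the bilinear term fits into the remaining \<rho>.\<close>
    define A where "A = max (q ^ n0) (C1 * q powr real L / \<rho>)"
    have A: "A \<ge> q ^ n0" "C1 * q powr real L \<le> A * \<rho>"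
    proof -
      show "A \<ge> q ^ n0" unfolding A_def by simp
      have "C1 * q powr real L = C1 * q powr real L / \<rho> * \<rho>" using \<rho> by simp
      also have "\<dots> \<le> A * \<rho>" unfolding A_def using \<rho> by (intro mult_right_mono) auto
      finally show "C1 * q powr real L \<le> A * \<rho>" .
    qed
    have A1: "A \<ge> 1" using A(1) one_le_power[of q n0] q by linarith
    have "decoupling p k n (A * q powr (\<sigma> * real n))" for n
    proof (induction n rule: less_induct)
      case (less n)
      show ?case
      proof (cases "n < n0")
        case True
        have "q ^ n \<le> q ^ n0" using True q by (intro power_increasing) auto
        also have "\<dots> \<le> A * 1" using A(1) by simp
        also have "\<dots> \<le> A * q powr (\<sigma> * real n)" using A1 q \<sigma> by (intro mult_left_mono ge_one_powr_ge_zero) auto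
        finally have "of_int p ^ n \<le> A * q powr (\<sigma> * real n)" unfolding q_def .
        then show ?thesis using decoupling_mono[OF p0 decoupling_trivial[OF p0]] k by auto
      next
        case False
        then obtain b B where b: "0 < b" "b \<le> n" "bilinear_decoupling p k 1 b b n B"
          "of_int p ^ b * B \<le> C1 * q powr real L * q powr (\<sigma> * real n)" using step[of n] by auto
        have n: "n - 1 < n" using b by simp
        have k0: "k > 0" using k by simp
        have "decoupling p k n (A * q powr (\<sigma> * real (n - 1)) + of_int p ^ b * B)"
          by (rule decoupling_broad_narrow[OF p0 k0 b(1,2) less.IH[OF n] b(3)])
        moreover have "A * q powr (\<sigma> * real (n - 1)) + of_int p ^ b * B \<le> A * q powr (\<sigma> * real n)"
        proof -
          have "\<sigma> * real (n - 1) = - \<sigma> + \<sigma> * real n" using b by (simp add: of_nat_diff algebra_simps)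
          then have "q powr (\<sigma> * real (n - 1)) = q powr (- \<sigma>) * q powr (\<sigma> * real n)"
            by (simp only: powr_add)
          then have "A * q powr (\<sigma> * real (n - 1)) = A * (1 - \<rho>) * q powr (\<sigma> * real n)"
            unfolding \<rho>_def by simp
          moreover have "of_int p ^ b * B \<le> A * \<rho> * q powr (\<sigma> * real n)"
            using b(4) mult_right_mono[OF A(2), of "q powr (\<sigma> * real n)"] by simp
          ultimately show ?thesis by (simp add: algebra_simps)
        qed
        ultimately show ?thesis by (rule decoupling_mono[OF p0])
      qed
    qed
    then show ?thesis using A1 unfolding \<sigma>_def by blast
  qed
  then show ?thesis using \<delta>(1) unfolding q_def by blast
qed

text \<open>All lower degrees enter, through \<open>bilinear_decoupling_refine\<close>; hence strong
  induction on k. For fixed k the exponent falls from 1 in steps of the fixed size \<delta>.\<close>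

theorem decoupling_inequality:
  fixes p :: int
  assumes "prime p" "0 < k" "int k < p" "\<epsilon> > 0"
  shows "\<exists>C\<ge>1. \<forall>n. decoupling p k n (C * of_int p powr (\<epsilon> * real n))"
  using assms(2-4)
proof (induction k arbitrary: \<epsilon> rule: less_induct)
  case (less k)
  note p = assms(1)
  have p0: "p > 0" and q: "real_of_int p > 1" using prime_gt_1_int[OF p] by simp_all
  show ?case
  proof (cases "k = 1")
    case True
    have "decoupling p 1 n (1 * of_int p powr (\<epsilon> * real n))" for n
      using decoupling_mono[OF p0 decoupling_1[OF p0]] q less.prems(3) by (simp add: ge_one_powr_ge_zero)
    then show ?thesis using True by blast
  next
    case False
    then have k: "k \<ge> 2" using less.prems by simp
    have low: "\<exists>C\<ge>1. \<forall>l m. 0 < l \<longrightarrow> l < k \<longrightarrow> decoupling p l m (C * of_int p powr (\<epsilon>' * real m))" if "\<epsilon>' > 0" for \<epsilon>' :: real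
    proof -
      have "\<forall>l\<in>{0<..<k}. \<exists>C\<ge>1. \<forall>m. decoupling p l m (C * of_int p powr (\<epsilon>' * real m))"
        using less.IH less.prems that by auto
      then obtain C where C: "\<And>l. l \<in> {0<..<k} \<Longrightarrow> C l \<ge> 1" "\<And>l m. l \<in> {0<..<k} \<Longrightarrow> decoupling p l m (C l * of_int p powr (\<epsilon>' * real m))"
        by metis
      define C' where "C' = 1 + (\<Sum>l\<in>{0<..<k}. C l)"
      have le: "C l \<le> C'" if "l \<in> {0<..<k}" for l
        using member_le_sum[OF that, of C] C(1) unfolding C'_def by (force intro: order_trans[of 0 1])
      have "C' \<ge> 1" unfolding C'_def by (auto intro!: sum_nonneg order_trans[OF zero_le_one C(1)])
      moreover have "decoupling p l m (C' * of_int p powr (\<epsilon>' * real m))" if "0 < l" "l < k" for l m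
        using that le[of l] by (intro decoupling_mono[OF p0 C(2)] mult_right_mono) auto
      ultimately show ?thesis by blast
    qed
    define Q where "Q \<eta> \<longleftrightarrow> (\<exists>C\<ge>1. \<forall>n. decoupling p k n (C * of_int p powr (\<eta> * real n)))" for \<eta> :: real
    have Q_mono: "Q \<eta>'" if "Q \<eta>" "\<eta> \<le> \<eta>'" for \<eta> \<eta>'
      using that decoupling_exponent_mono[OF p] unfolding Q_def by meson
    obtain \<delta> where \<delta>: "\<delta> > 0" "\<And>\<eta>. \<eta> \<ge> \<epsilon> \<Longrightarrow> Q \<eta> \<Longrightarrow> Q (\<eta> - \<delta>)"
      using decoupling_exponent_improvement[OF p less.prems(2) k less.prems(3) low] unfolding Q_def by blast
    \<comment> \<open>The improvement is available only for exponents of at least \<epsilon>; the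
      maximum stops the descent there.\<close>
    have "Q (max \<epsilon> (1 - real j * \<delta>))" for j
    proof (induction j)
      case 0
      have "decoupling p k n (1 * of_int p powr (1 * real n))" for n
        using decoupling_trivial[OF p0, of k n] k p0 by (simp add: powr_realpow)
      then have "Q 1" unfolding Q_def by blast
      then show ?case by (rule Q_mono) simp
    next
      case (Suc j)
      show ?case
      proof (cases "1 - real j * \<delta> \<ge> \<epsilon>")
        case True
        then have "Q (1 - real j * \<delta> - \<delta>)" using Suc \<delta>(2) by (simp add: max_def)
        then show ?thesis by (rule Q_mono) (simp add: algebra_simps)
      next
        case False
        then show ?thesis using Suc by (intro Q_mono[OF Suc]) auto
      qed
    qed
    moreover obtain j :: nat where "1 / \<delta> \<le> real j" using real_arch_simple by blast
    moreover have "max \<epsilon> (1 - real j * \<delta>) = \<epsilon>" if "1 / \<delta> \<le> real j" for j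
      using that \<delta>(1) less.prems(3) by (simp add: field_simps)
    ultimately have "Q \<epsilon>" by metis
    then show ?thesis unfolding Q_def .
  qed
qed

section \<open>Discrete exponential sums and the Vinogradov system\<close>

definition integer_exponential :: "nat \<Rightarrow> int \<Rightarrow> (nat \<Rightarrow> int) \<Rightarrow> int \<Rightarrow> complex" where
  "integer_exponential d q \<omega> x = unit_exp (real_of_int (\<Sum>j\<in>{1..d}. \<omega> j * x ^ j) / real_of_int q)"

abbreviation residue_vectors :: "nat \<Rightarrow> int \<Rightarrow> (nat \<Rightarrow> int) set" where
  "residue_vectors d q \<equiv> {1..d} \<rightarrow>\<^sub>E {0..<q}"

text \<open>A polynomial phase translates \<omega> by the coefficients of P modulo q. The exponent
  has no term of degree 0, so \<kappa> compensates the constant coefficient.\<close>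

lemma phase_invariant_integer_exponential:
  assumes q: "q > 0"
  shows "phase_invariant d q (residue_vectors d q) (\<lambda>\<omega>. 1) (integer_exponential d q)"
  unfolding phase_invariant_def
proof (intro conjI allI impI ballI)
  show "finite (residue_vectors d q)" by (intro finite_PiE) auto
  fix P :: "int poly" assume P: "degree P \<le> d"
  define sh where "sh c \<omega> = restrict (\<lambda>j. (\<omega> j + c j) mod q) {1..d}" for c \<omega> :: "nat \<Rightarrow> int"
  have sh: "sh c \<omega> \<in> residue_vectors d q" for c \<omega> unfolding sh_def using q by auto
  have inv: "sh (\<lambda>j. - c j) (sh c \<omega>) = \<omega>" if "\<omega> \<in> residue_vectors d q" for c \<omega>
  proof (rule PiE_ext[OF sh that])
    fix j assume j: "j \<in> {1..d}"
    have "((\<omega> j + c j) mod q + - c j) mod q = \<omega> j mod q" by (simp add: mod_diff_left_eq)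
    moreover have "\<omega> j \<in> {0..<q}" using that j by blast
    ultimately show "sh (\<lambda>j. - c j) (sh c \<omega>) j = \<omega> j" unfolding sh_def using j by simp
  qed
  have "bij_betw (sh (coeff P)) (residue_vectors d q) (residue_vectors d q)"
  proof (rule bij_betw_byWitness[where f' = "sh (\<lambda>j. - coeff P j)"])
    show "\<forall>\<omega>\<in>residue_vectors d q. sh (\<lambda>j. - coeff P j) (sh (coeff P) \<omega>) = \<omega>" by (intro ballI inv)
    show "\<forall>\<omega>\<in>residue_vectors d q. sh (coeff P) (sh (\<lambda>j. - coeff P j) \<omega>) = \<omega>"
      using inv[of _ "\<lambda>j. - coeff P j"] by simp
  qed (intro image_subsetI sh)+
  moreover have "integer_exponential d q (sh (coeff P) \<omega>) x = unit_exp (- (real_of_int (coeff P 0) / real_of_int q)) * integer_exponential d q \<omega> x * unit_exp (real_of_int (poly P x) / real_of_int q)" for \<omega> x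
  proof -
    have "poly P x = coeff P 0 + (\<Sum>j\<in>{1..d}. coeff P j * x ^ j)"
      by (simp add: poly_eq_sum_atMost[OF P] atMost_atLeast0 sum.atLeast_Suc_atMost)
    then have e: "(\<Sum>j\<in>{1..d}. (\<omega> j + coeff P j) * x ^ j) = - coeff P 0 + (\<Sum>j\<in>{1..d}. \<omega> j * x ^ j) + poly P x"
      by (simp add: sum.distrib distrib_right)
    have "[(\<Sum>j\<in>{1..d}. sh (coeff P) \<omega> j * x ^ j) = (\<Sum>j\<in>{1..d}. (\<omega> j + coeff P j) * x ^ j)] (mod q)"
      by (intro cong_sum cong_mult cong_refl) (auto simp: sh_def cong_def)
    then have "integer_exponential d q (sh (coeff P) \<omega>) x = unit_exp (real_of_int (- coeff P 0 + (\<Sum>j\<in>{1..d}. \<omega> j * x ^ j) + poly P x) / real_of_int q)"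
      unfolding integer_exponential_def e[symmetric] using q by (intro unit_exp_cong_mod) auto
    also have "real_of_int (- coeff P 0 + (\<Sum>j\<in>{1..d}. \<omega> j * x ^ j) + poly P x) / real_of_int q =
      - (real_of_int (coeff P 0) / real_of_int q) + real_of_int (\<Sum>j\<in>{1..d}. \<omega> j * x ^ j) / real_of_int q + real_of_int (poly P x) / real_of_int q"
      by (simp only: of_int_add of_int_minus add_divide_distrib minus_divide_left)
    finally show ?thesis unfolding integer_exponential_def by (simp only: unit_exp_add)
  qed
  ultimately show "\<exists>\<tau>. bij_betw \<tau> (residue_vectors d q) (residue_vectors d q) \<and> (\<forall>\<omega>\<in>residue_vectors d q. (1::real) = 1 \<and>
      (\<exists>\<kappa>. norm \<kappa> = 1 \<and> (\<forall>x. integer_exponential d q (\<tau> \<omega>) x = \<kappa> * integer_exponential d q \<omega> x * unit_exp (real_of_int (poly P x) / real_of_int q))))"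
    by (intro exI[of _ "sh (coeff P)"] conjI ballI exI[of _ "unit_exp (- (real_of_int (coeff P 0) / real_of_int q))"]) (auto simp: norm_unit_exp)
qed simp

text \<open>As N <= p^n, each class modulo p^n contains at most one term, so every piece is bounded
  by 1 and decoupling gives square root cancellation on average.\<close>

lemma exponential_sum_mean_value:
  fixes p :: int
  assumes p: "p > 0" and d: "d > 0" and dec: "decoupling p d n D" and N: "int N \<le> p ^ n"
  shows "(\<Sum>\<omega>\<in>residue_vectors d (p ^ (d * n)). norm (\<Sum>x\<in>{1..N}. integer_exponential d (p ^ (d * n)) \<omega> (int x)) ^ (2 * vinogradov_s d))
    \<le> (D * of_int p ^ n) ^ vinogradov_s d * real (card (residue_vectors d (p ^ (d * n))))"
proof -
  define q where "q = p ^ (d * n)"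
  define s where "s = vinogradov_s d"
  have q: "q > 0" unfolding q_def using p by simp
  have s: "s > 0" unfolding s_def using vinogradov_s_pos[OF d] .
  define \<Omega> where "\<Omega> = residue_vectors d q"
  define F where "F = integer_exponential d q"
  \<comment> \<open>The number of points of \<open>\<Omega>\<close> is \<open>r ^ s\<close>, so the
    constant r majorizes every piece.\<close>
  define r where "r = root s (real (card \<Omega>))"
  have r: "r \<ge> 0" "r ^ s = real (card \<Omega>)" unfolding r_def using s by (auto simp: real_root_pow_pos2)
  have nF: "norm (F \<omega> x) = 1" for \<omega> x unfolding F_def integer_exponential_def by (rule norm_unit_exp)
  have "decoupling_data p d n \<Omega> (\<lambda>\<omega>. 1) F (int ` {1..N}) (\<lambda>J. r)"
    unfolding decoupling_data_def
  proof (intro conjI allI ballI)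
    show "phase_invariant d (p ^ (d * n)) \<Omega> (\<lambda>\<omega>. 1) F"
      unfolding \<Omega>_def F_def q_def[symmetric] by (rule phase_invariant_integer_exponential[OF q])
    fix J assume "J \<in> {0..<p ^ n}"
    have "norm (residue_sum (F \<omega>) (int ` {1..N}) (p ^ n) J) \<le> 1" for \<omega>
    proof -
      let ?S = "{x \<in> int ` {1..N}. [x = J] (mod p ^ n)}"
      have "x = y" if "x \<in> ?S" "y \<in> ?S" for x y
      proof -
        have "[x = J] (mod p ^ n)" "[y = J] (mod p ^ n)" using that by simp_all
        then have "[x = y] (mod p ^ n)" using cong_sym cong_trans by blast
        \<comment> \<open>The range starts at 1 and may end at p^n itself; shifted by one, both
          numbers are standard residues.\<close>
        then have "[x - 1 = y - 1] (mod p ^ n)" by (rule cong_diff) (rule cong_refl)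
        moreover have "0 \<le> x - 1" "x - 1 < p ^ n" "0 \<le> y - 1" "y - 1 < p ^ n" using that N by auto
        ultimately show ?thesis by (simp add: cong_def)
      qed
      moreover have "finite ?S" by simp
      ultimately have "card ?S \<le> 1" unfolding One_nat_def by (subst card_le_Suc0_iff_eq) blast+
      moreover have "norm (residue_sum (F \<omega>) (int ` {1..N}) (p ^ n) J) \<le> (\<Sum>x\<in>?S. norm (F \<omega> x))"
        unfolding residue_sum_def by (rule norm_sum)
      ultimately show ?thesis by (simp add: nF)
    qed
    then have "(\<Sum>\<omega>\<in>\<Omega>. 1 * norm (residue_sum (F \<omega>) (int ` {1..N}) (p ^ n) J) ^ (2 * s)) \<le> (\<Sum>\<omega>\<in>\<Omega>. 1)"
      by (intro sum_mono) (simp add: power_le_one)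
    then show "(\<Sum>\<omega>\<in>\<Omega>. 1 * norm (residue_sum (F \<omega>) (int ` {1..N}) (p ^ n) J) ^ (2 * vinogradov_s d)) \<le> r ^ vinogradov_s d"
      using r unfolding s_def by simp
  qed (use r in auto)
  note decouplingD[OF dec this]
  moreover have "(\<Sum>x\<in>int ` {1..N}. F \<omega> x) = (\<Sum>x\<in>{1..N}. F \<omega> (int x))" for \<omega>
    by (subst sum.reindex) auto
  moreover have "(D * (\<Sum>J\<in>{0..<p ^ n}. r)) ^ s = (D * of_int p ^ n) ^ s * real (card \<Omega>)"
    using p by (simp add: power_mult_distrib r(2))
  ultimately show ?thesis unfolding \<Omega>_def F_def q_def s_def by simp
qed

lemma unit_exp_sum: "finite A \<Longrightarrow> unit_exp (\<Sum>i\<in>A. f i) = (\<Prod>i\<in>A. unit_exp (f i))"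
  by (induction A rule: finite_induct) (auto simp: unit_exp_add)

lemma unit_exp_of_nat_mult: "unit_exp (real n * x) = unit_exp x ^ n"
  by (induction n) (auto simp: unit_exp_add distrib_right)

text \<open>Only the sign and the value at h = 0 are recorded. Other multiples of q also give a
  nonzero sum, but a nonnegative one, which does no harm in an upper bound for the number of
  solutions.\<close>

lemma complete_exponential_sum:
  assumes q: "q > (0::int)"
  shows "\<exists>r\<ge>0. (\<Sum>y\<in>{0..<q}. unit_exp (real_of_int (y * h) / real_of_int q)) = of_real r \<and> (h = 0 \<longrightarrow> r = real_of_int q)"
proof -
  define z where "z = unit_exp (real_of_int h / real_of_int q)"
  have "(\<Sum>y\<in>{0..<q}. unit_exp (real_of_int (y * h) / real_of_int q)) = (\<Sum>m\<in>{..<nat q}. z ^ m)"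
  proof (rule sum.reindex_bij_witness[where i = int and j = nat])
    fix y assume y: "y \<in> {0..<q}"
    then have "real_of_int (y * h) / real_of_int q = real (nat y) * (real_of_int h / real_of_int q)" by simp
    then show "z ^ nat y = unit_exp (real_of_int (y * h) / real_of_int q)"
      unfolding z_def by (simp only: unit_exp_of_nat_mult)
  qed (use q in auto)
  also have "\<dots> = (if z = 1 then of_int q else 0)"
  proof (cases "z = 1")
    case True
    then show ?thesis using q by simp
  next
    case False
    have "z ^ nat q = unit_exp (real (nat q) * (real_of_int h / real_of_int q))" unfolding z_def by (simp only: unit_exp_of_nat_mult)
    also have "\<dots> = 1" using q by simp
    finally show ?thesis using False geometric_sum[OF False, of "nat q"] by simp
  qed
  finally show ?thesis using q
    by (intro exI[of _ "if z = 1 then real_of_int q else 0"]) (auto simp: z_def)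
qed

lemma complete_exponential_sum_vectors:
  assumes q: "q > 0"
  shows "\<exists>r\<ge>0. (\<Sum>\<omega>\<in>residue_vectors d q. unit_exp (real_of_int (\<Sum>j\<in>{1..d}. \<omega> j * h j) / real_of_int q)) = of_real r \<and>
    ((\<forall>j\<in>{1..d}. h j = 0) \<longrightarrow> r = real (card (residue_vectors d q)))"
proof -
  have "(\<Sum>\<omega>\<in>residue_vectors d q. unit_exp (real_of_int (\<Sum>j\<in>{1..d}. \<omega> j * h j) / real_of_int q))
    = (\<Sum>\<omega>\<in>residue_vectors d q. \<Prod>j\<in>{1..d}. unit_exp (real_of_int (\<omega> j * h j) / real_of_int q))"
    by (simp only: of_int_sum sum_divide_distrib unit_exp_sum[OF finite_atLeastAtMost])
  also have "\<dots> = (\<Prod>j\<in>{1..d}. \<Sum>y\<in>{0..<q}. unit_exp (real_of_int (y * h j) / real_of_int q))"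
    by (rule prod_sum_PiE[symmetric]) auto
  finally have e: "(\<Sum>\<omega>\<in>residue_vectors d q. unit_exp (real_of_int (\<Sum>j\<in>{1..d}. \<omega> j * h j) / real_of_int q))
    = (\<Prod>j\<in>{1..d}. \<Sum>y\<in>{0..<q}. unit_exp (real_of_int (y * h j) / real_of_int q))" .
  have "\<forall>j. \<exists>r\<ge>0. (\<Sum>y\<in>{0..<q}. unit_exp (real_of_int (y * h j) / real_of_int q)) = of_real r \<and> (h j = 0 \<longrightarrow> r = real_of_int q)"
    by (intro allI complete_exponential_sum q)
  from choice[OF this] obtain r where r: "\<And>j. r j \<ge> 0" "\<And>j. (\<Sum>y\<in>{0..<q}. unit_exp (real_of_int (y * h j) / real_of_int q)) = of_real (r j)"
    "\<And>j. h j = 0 \<Longrightarrow> r j = real_of_int q"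
    by blast
  have "real (card (residue_vectors d q)) = real_of_int q ^ d" using q by (simp add: card_PiE)
  then show ?thesis unfolding e r(2) using r(1,3)
    by (intro exI[of _ "\<Prod>j\<in>{1..d}. r j"]) (auto intro: prod_nonneg)
qed

definition power_moment :: "nat \<Rightarrow> (nat \<Rightarrow> nat) \<Rightarrow> nat \<Rightarrow> int" where
  "power_moment s u j = (\<Sum>i<s. int (u i) ^ j)"

lemma norm_sum_power_expand:
  fixes f :: "nat \<Rightarrow> complex"
  assumes "finite B"
  shows "of_real (norm (\<Sum>n\<in>B. f n) ^ (2 * s)) =
    (\<Sum>u\<in>{..<s} \<rightarrow>\<^sub>E B. \<Sum>v\<in>{..<s} \<rightarrow>\<^sub>E B. (\<Prod>i<s. f (u i)) * cnj (\<Prod>i<s. f (v i)))"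
proof -
  have e: "(\<Sum>n\<in>B. f n) ^ s = (\<Sum>u\<in>{..<s} \<rightarrow>\<^sub>E B. \<Prod>i<s. f (u i))"
    using prod_sum_PiE[of "{..<s}" "\<lambda>i. B" "\<lambda>i. f"] assms by simp
  have "complex_of_real (norm (\<Sum>n\<in>B. f n) ^ (2 * s)) = complex_of_real (norm ((\<Sum>n\<in>B. f n) ^ s) ^ 2)"
    by (simp add: norm_power mult.commute flip: power_mult)
  also have "\<dots> = (\<Sum>n\<in>B. f n) ^ s * cnj ((\<Sum>n\<in>B. f n) ^ s)" by (rule complex_norm_square)
  finally show ?thesis unfolding e cnj_sum sum_product .
qed

text \<open>Twisting the mean value over the grid by the character of h isolates the system. Every
  pair contributes a nonnegative real number, so the pairs that do not solve it may be dropped; the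
  triangle inequality then removes the twist, which makes the bound independent of h.\<close>

lemma vinogradov_system_count:
  fixes p :: int
  assumes p: "p > 0" and d: "d > 0" and dec: "decoupling p d n D" and N: "int N \<le> p ^ n"
  defines "U \<equiv> {..<vinogradov_s d} \<rightarrow>\<^sub>E {1..N}"
  shows "real (card {(u, v) \<in> U \<times> U. \<forall>j\<in>{1..d}. power_moment (vinogradov_s d) v j - power_moment (vinogradov_s d) u j = h j})
    \<le> (D * of_int p ^ n) ^ vinogradov_s d"
proof -
  define s where "s = vinogradov_s d"
  define q where "q = p ^ (d * n)"
  have q: "q > 0" unfolding q_def using p by simp
  define \<Omega> where "\<Omega> = residue_vectors d q"
  define F where "F = integer_exponential d q"
  define S where "S \<omega> = norm (\<Sum>x\<in>{1..N}. F \<omega> (int x)) ^ (2 * s)" for \<omega>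
  define e where "e \<omega> g = unit_exp (real_of_int (\<Sum>j\<in>{1..d}. \<omega> j * g j) / real_of_int q)" for \<omega> and g :: "nat \<Rightarrow> int"
  define G where "G u v j = h j - (power_moment s v j - power_moment s u j)" for u v j
  have fin: "finite U" unfolding U_def by (intro finite_PiE) auto
  define Z where "Z = {(u, v) \<in> U \<times> U. \<forall>j\<in>{1..d}. power_moment s v j - power_moment s u j = h j}"
  have card\<Omega>: "card \<Omega> > 0"
  proof -
    have "\<Omega> \<noteq> {}" unfolding \<Omega>_def using q by (simp add: PiE_eq_empty_iff)
    moreover have "finite \<Omega>" unfolding \<Omega>_def by (intro finite_PiE) auto
    ultimately show ?thesis by (simp add: card_gt_0_iff)
  qed
  have "\<forall>g. \<exists>r\<ge>0. (\<Sum>\<omega>\<in>\<Omega>. e \<omega> g) = of_real r \<and> ((\<forall>j\<in>{1..d}. g j = 0) \<longrightarrow> r = real (card \<Omega>))"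
    unfolding e_def \<Omega>_def by (intro allI complete_exponential_sum_vectors q)
  from choice[OF this] obtain r where r: "\<And>g. r g \<ge> 0" "\<And>g. (\<Sum>\<omega>\<in>\<Omega>. e \<omega> g) = complex_of_real (r g)" "\<And>g. \<forall>j\<in>{1..d}. g j = 0 \<Longrightarrow> r g = real (card \<Omega>)"
    by blast
  have prodF: "(\<Prod>i<s. F \<omega> (int (u i))) = e \<omega> (power_moment s u)" for \<omega> u
  proof -
    have "(\<Prod>i<s. F \<omega> (int (u i))) = unit_exp (\<Sum>i<s. real_of_int (\<Sum>j\<in>{1..d}. \<omega> j * int (u i) ^ j) / real_of_int q)"
      unfolding F_def integer_exponential_def by (simp only: unit_exp_sum[OF finite_lessThan])
    also have "(\<Sum>i<s. real_of_int (\<Sum>j\<in>{1..d}. \<omega> j * int (u i) ^ j) / real_of_int q) = real_of_int (\<Sum>i<s. \<Sum>j\<in>{1..d}. \<omega> j * int (u i) ^ j) / real_of_int q"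
      by (simp only: of_int_sum sum_divide_distrib)
    also have "(\<Sum>i<s. \<Sum>j\<in>{1..d}. \<omega> j * int (u i) ^ j) = (\<Sum>j\<in>{1..d}. \<omega> j * power_moment s u j)"
      unfolding power_moment_def sum_distrib_left by (rule sum.swap)
    finally show ?thesis unfolding e_def .
  qed
  have summand: "e \<omega> h * (e \<omega> (power_moment s u) * cnj (e \<omega> (power_moment s v))) = e \<omega> (G u v)" for \<omega> u v
  proof -
    have "real_of_int (\<Sum>j\<in>{1..d}. \<omega> j * h j) / real_of_int q + (real_of_int (\<Sum>j\<in>{1..d}. \<omega> j * power_moment s u j) / real_of_int q
      + - (real_of_int (\<Sum>j\<in>{1..d}. \<omega> j * power_moment s v j) / real_of_int q)) = real_of_int (\<Sum>j\<in>{1..d}. \<omega> j * G u v j) / real_of_int q"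
      unfolding G_def by (simp add: algebra_simps sum.distrib sum_subtractf add_divide_distrib diff_divide_distrib)
    then show ?thesis unfolding e_def cnj_unit_exp unit_exp_add[symmetric] by simp
  qed
  have "(\<Sum>\<omega>\<in>\<Omega>. e \<omega> h * of_real (S \<omega>)) = (\<Sum>\<omega>\<in>\<Omega>. \<Sum>u\<in>U. \<Sum>v\<in>U. e \<omega> (G u v))"
    unfolding S_def norm_sum_power_expand[OF finite_atLeastAtMost] prodF U_def[symmetric] s_def[symmetric] sum_distrib_left summand
    unfolding U_def s_def by (rule refl)
  also have "\<dots> = (\<Sum>u\<in>U. \<Sum>\<omega>\<in>\<Omega>. \<Sum>v\<in>U. e \<omega> (G u v))" by (rule sum.swap)
  also have "\<dots> = (\<Sum>u\<in>U. \<Sum>v\<in>U. \<Sum>\<omega>\<in>\<Omega>. e \<omega> (G u v))" by (intro sum.cong refl sum.swap)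
  also have "\<dots> = of_real (\<Sum>uv\<in>U \<times> U. r (G (fst uv) (snd uv)))"
    unfolding r(2) by (simp add: sum.cartesian_product split_def)
  finally have eq: "(\<Sum>\<omega>\<in>\<Omega>. e \<omega> h * of_real (S \<omega>)) = of_real (\<Sum>uv\<in>U \<times> U. r (G (fst uv) (snd uv)))" .
  have "real (card \<Omega>) * real (card Z) = (\<Sum>uv\<in>Z. r (G (fst uv) (snd uv)))"
    using r(3) by (simp add: Z_def G_def split_def)
  also have "\<dots> \<le> (\<Sum>uv\<in>U \<times> U. r (G (fst uv) (snd uv)))"
    using fin r(1) unfolding Z_def by (intro sum_mono2) auto
  also have "\<dots> \<le> norm (\<Sum>\<omega>\<in>\<Omega>. e \<omega> h * of_real (S \<omega>))"
    unfolding eq norm_of_real by (rule abs_ge_self)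
  also have "\<dots> \<le> (\<Sum>\<omega>\<in>\<Omega>. norm (e \<omega> h * of_real (S \<omega>)))" by (rule norm_sum)
  also have "\<dots> = (\<Sum>\<omega>\<in>\<Omega>. S \<omega>)" unfolding S_def e_def by (simp add: norm_mult norm_unit_exp norm_power)
  also have "\<dots> \<le> (D * of_int p ^ n) ^ s * real (card \<Omega>)"
    unfolding S_def \<Omega>_def F_def q_def s_def by (rule exponential_sum_mean_value[OF p d dec N])
  finally have "real (card \<Omega>) * real (card Z) \<le> real (card \<Omega>) * (D * of_int p ^ n) ^ s" by (simp add: mult.commute)
  then have "real (card Z) \<le> (D * of_int p ^ n) ^ s" using card\<Omega> by (simp add: mult_le_cancel_left_pos)
  then show ?thesis unfolding Z_def s_def .
qed

section \<open>Moments with respect to a measure on the torus\<close>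

lemma mean_value_expand:
  assumes \<mu>: "radon_measure_on_torus d \<mu>"
  shows "complex_of_real (\<integral>x. norm (weyl_sum a d x N) ^ (2 * s) \<partial>\<mu>) =
    (\<Sum>u\<in>{..<s} \<rightarrow>\<^sub>E {1..N}. \<Sum>v\<in>{..<s} \<rightarrow>\<^sub>E {1..N}. (\<Prod>i<s. a (u i)) * cnj (\<Prod>i<s. a (v i)) *
      fourier d \<mu> (\<lambda>j\<in>{1..d}. real_of_int (power_moment s v j - power_moment s u j)))"
proof -
  define U where "U = {..<s} \<rightarrow>\<^sub>E {1..N}"
  define c where "c u v = (\<Prod>i<s. a (u i)) * cnj (\<Prod>i<s. a (v i))" for u v
  define \<xi> where "\<xi> u v = (\<lambda>j\<in>{1..d}. real_of_int (power_moment s v j - power_moment s u j))" for u v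
  have pr: "(\<Prod>i<s. a (u i) * unit_exp (\<Sum>j\<in>{1..d}. x j * real (u i) ^ j)) = (\<Prod>i<s. a (u i)) * unit_exp (\<Sum>j\<in>{1..d}. x j * real_of_int (power_moment s u j))"
    for u and x :: "nat \<Rightarrow> real"
  proof -
    have "(\<Sum>i<s. \<Sum>j\<in>{1..d}. x j * real (u i) ^ j) = (\<Sum>j\<in>{1..d}. x j * real_of_int (power_moment s u j))"
      unfolding power_moment_def by (subst sum.swap) (simp add: sum_distrib_left)
    then show ?thesis unfolding prod.distrib by (simp flip: unit_exp_sum)
  qed
  have ex: "complex_of_real (norm (weyl_sum a d x N) ^ (2 * s)) = (\<Sum>u\<in>U. \<Sum>v\<in>U. c u v * unit_exp (- (\<Sum>j\<in>{1..d}. x j * \<xi> u v j)))" for x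
  proof -
    have "(\<Prod>i<s. a (u i)) * unit_exp (\<Sum>j\<in>{1..d}. x j * real_of_int (power_moment s u j)) *
        cnj ((\<Prod>i<s. a (v i)) * unit_exp (\<Sum>j\<in>{1..d}. x j * real_of_int (power_moment s v j)))
      = c u v * unit_exp (- (\<Sum>j\<in>{1..d}. x j * \<xi> u v j))" for u v
    proof -
      have "- (\<Sum>j\<in>{1..d}. x j * \<xi> u v j) = (\<Sum>j\<in>{1..d}. x j * real_of_int (power_moment s u j)) + - (\<Sum>j\<in>{1..d}. x j * real_of_int (power_moment s v j))"
        unfolding \<xi>_def by (simp add: algebra_simps sum_subtractf sum.distrib)
      then show ?thesis unfolding c_def by (simp only: complex_cnj_mult cnj_unit_exp unit_exp_add mult_ac)
    qed
    then show ?thesis unfolding weyl_sum_def norm_sum_power_expand[OF finite_atLeastAtMost] pr U_def by simp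
  qed
  have int: "integrable \<mu> (\<lambda>x. c u v * unit_exp (- (\<Sum>j\<in>{1..d}. x j * \<xi> u v j)))" for u v
    by (intro integrable_mult_right fourier_integrable \<mu>)
  have "complex_of_real (\<integral>x. norm (weyl_sum a d x N) ^ (2 * s) \<partial>\<mu>) = (\<integral>x. (\<Sum>u\<in>U. \<Sum>v\<in>U. c u v * unit_exp (- (\<Sum>j\<in>{1..d}. x j * \<xi> u v j))) \<partial>\<mu>)"
    unfolding ex[symmetric] by (rule integral_complex_of_real[symmetric])
  also have "\<dots> = (\<Sum>u\<in>U. \<Sum>v\<in>U. \<integral>x. c u v * unit_exp (- (\<Sum>j\<in>{1..d}. x j * \<xi> u v j)) \<partial>\<mu>)"
    using int by (simp add: Bochner_Integration.integral_sum)
  also have "\<dots> = (\<Sum>u\<in>U. \<Sum>v\<in>U. c u v * fourier d \<mu> (\<xi> u v))"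
    unfolding fourier_def by (simp only: integral_mult_right_zero)
  finally show ?thesis unfolding U_def c_def \<xi>_def .
qed

lemma mean_value_le:
  assumes \<mu>: "radon_measure_on_torus d \<mu>"
    and sm: "(\<lambda>\<xi>. norm (fourier d \<mu> \<xi>)) summable_on integer_lattice d"
    and a: "\<And>n. n \<in> {1..N} \<Longrightarrow> norm (a n) \<le> A" "A \<ge> 0"
    and K: "\<And>h. real (card {(u, v) \<in> ({..<s} \<rightarrow>\<^sub>E {1..N}) \<times> ({..<s} \<rightarrow>\<^sub>E {1..N}). \<forall>j\<in>{1..d}. power_moment s v j - power_moment s u j = h j}) \<le> K"
  shows "(\<integral>x. norm (weyl_sum a d x N) ^ (2 * s) \<partial>\<mu>) \<le> A ^ (2 * s) * (K * (\<Sum>\<^sub>\<infinity>\<xi>\<in>integer_lattice d. norm (fourier d \<mu> \<xi>)))"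
proof -
  define U where "U = {..<s} \<rightarrow>\<^sub>E {1..N}"
  define \<xi> where "\<xi> uv = (\<lambda>j\<in>{1..d}. real_of_int (power_moment s (snd uv) j - power_moment s (fst uv) j))" for uv
  define \<phi> where "\<phi> z = norm (fourier d \<mu> z)" for z
  have fin: "finite (U \<times> U)" unfolding U_def by (intro finite_cartesian_product finite_PiE) auto
  have K0: "0 \<le> K" by (rule order_trans[OF of_nat_0_le_iff K[of "\<lambda>_. 0"]])
  have prod_le: "norm (\<Prod>i<s. a (u i)) \<le> A ^ s" if "u \<in> U" for u
  proof -
    have "norm (\<Prod>i<s. a (u i)) \<le> (\<Prod>i<s. A)"
      unfolding prod_norm[symmetric]
    proof (rule prod_mono)
      fix i assume "i \<in> {..<s}"
      then have "u i \<in> {1..N}" using that unfolding U_def by (rule PiE_mem[rotated])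
      then show "0 \<le> norm (a (u i)) \<and> norm (a (u i)) \<le> A" using a(1) by simp
    qed
    then show ?thesis by simp
  qed
  have "(\<integral>x. norm (weyl_sum a d x N) ^ (2 * s) \<partial>\<mu>) \<le> norm (complex_of_real (\<integral>x. norm (weyl_sum a d x N) ^ (2 * s) \<partial>\<mu>))"
    unfolding norm_of_real by (rule abs_ge_self)
  also have "\<dots> = norm (\<Sum>uv\<in>U \<times> U. (\<Prod>i<s. a (fst uv i)) * cnj (\<Prod>i<s. a (snd uv i)) * fourier d \<mu> (\<xi> uv))"
    unfolding mean_value_expand[OF \<mu>] U_def[symmetric] \<xi>_def sum.cartesian_product split_def by (rule refl)
  also have "\<dots> \<le> (\<Sum>uv\<in>U \<times> U. A ^ (2 * s) * \<phi> (\<xi> uv))"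
  proof (rule sum_norm_le)
    fix uv assume uv: "uv \<in> U \<times> U"
    have "norm (\<Prod>i<s. a (fst uv i)) * norm (\<Prod>i<s. a (snd uv i)) \<le> A ^ s * A ^ s"
      using uv a(2) by (intro mult_mono prod_le) auto
    then have "norm (\<Prod>i<s. a (fst uv i)) * norm (\<Prod>i<s. a (snd uv i)) * \<phi> (\<xi> uv) \<le> A ^ (2 * s) * \<phi> (\<xi> uv)"
      unfolding \<phi>_def by (intro mult_right_mono) (auto simp: mult_2 power_add)
    then show "norm ((\<Prod>i<s. a (fst uv i)) * cnj (\<Prod>i<s. a (snd uv i)) * fourier d \<mu> (\<xi> uv)) \<le> A ^ (2 * s) * \<phi> (\<xi> uv)"
      unfolding \<phi>_def norm_mult complex_mod_cnj .
  qed
  \<comment> \<open>Regrouping by frequency: the image is a finite set of lattice points, each hit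
    by at most K pairs.\<close>
  also have "\<dots> = A ^ (2 * s) * (\<Sum>z\<in>\<xi> ` (U \<times> U). \<Sum>uv\<in>{uv \<in> U \<times> U. \<xi> uv = z}. \<phi> (\<xi> uv))"
    unfolding sum_distrib_left[symmetric] by (subst sum.image_gen[OF fin, of _ \<xi>]) (rule refl)
  also have "\<dots> \<le> A ^ (2 * s) * (\<Sum>z\<in>\<xi> ` (U \<times> U). K * \<phi> z)"
  proof (intro mult_left_mono sum_mono)
    fix z assume "z \<in> \<xi> ` (U \<times> U)"
    then obtain u0 v0 where z: "z = \<xi> (u0, v0)" by auto
    define h where "h j = power_moment s v0 j - power_moment s u0 j" for j
    let ?Z = "{(u, v) \<in> U \<times> U. \<forall>j\<in>{1..d}. power_moment s v j - power_moment s u j = h j}"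
    have "{uv \<in> U \<times> U. \<xi> uv = z} \<subseteq> ?Z"
    proof
      fix uv assume uv: "uv \<in> {uv \<in> U \<times> U. \<xi> uv = z}"
      obtain u v where e: "uv = (u, v)" by fastforce
      have "power_moment s v j - power_moment s u j = h j" if j: "j \<in> {1..d}" for j
      proof -
        have "\<xi> (u, v) j = \<xi> (u0, v0) j" using uv e z by simp
        then have "real_of_int (power_moment s v j - power_moment s u j) = real_of_int (h j)"
          using j unfolding \<xi>_def h_def by simp
        then show ?thesis by (simp only: of_int_eq_iff)
      qed
      then show "uv \<in> ?Z" using uv e by simp
    qed
    moreover have "finite ?Z" by (rule finite_subset[OF _ fin]) auto
    ultimately have "real (card {uv \<in> U \<times> U. \<xi> uv = z}) \<le> real (card ?Z)" by (simp add: card_mono)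
    also have "\<dots> \<le> K" using K[of h] unfolding U_def .
    finally have "real (card {uv \<in> U \<times> U. \<xi> uv = z}) * \<phi> z \<le> K * \<phi> z"
      by (intro mult_right_mono) (auto simp: \<phi>_def)
    then show "(\<Sum>uv\<in>{uv \<in> U \<times> U. \<xi> uv = z}. \<phi> (\<xi> uv)) \<le> K * \<phi> z" by simp
  qed (use a(2) in auto)
  also have "\<dots> \<le> A ^ (2 * s) * (K * (\<Sum>\<^sub>\<infinity>\<xi>\<in>integer_lattice d. \<phi> \<xi>))"
    unfolding sum_distrib_left[symmetric]
  proof (intro mult_left_mono)
    show "sum \<phi> (\<xi> ` (U \<times> U)) \<le> infsum \<phi> (integer_lattice d)"
    proof (rule finite_sum_le_infsum)
      show "\<phi> summable_on integer_lattice d" using sm unfolding \<phi>_def .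
      show "\<xi> ` (U \<times> U) \<subseteq> integer_lattice d" unfolding \<xi>_def integer_lattice_def by auto
    qed (use fin in \<open>auto simp: \<phi>_def\<close>)
  qed (use a(2) K0 in auto)
  finally show ?thesis unfolding \<phi>_def .
qed

text \<open>The finitely many n below the threshold \<open>n1\<close>, where the bound n^e may fail,
  are paid for by C.\<close>

lemma le_power_o1_0_uniform:
  assumes a: "le_power_o1 b 0" and e: "e > 0"
  shows "\<exists>C\<ge>0. \<forall>N. \<forall>n\<in>{1..N}. b n \<le> C * real N powr e"
proof -
  obtain n1 where n1: "\<And>n. n \<ge> n1 \<Longrightarrow> b n \<le> real n powr e"
    using a e unfolding le_power_o1_def eventually_sequentially by auto
  define C where "C = 1 + (\<Sum>n<n1. \<bar>b n\<bar>)"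
  have C: "C \<ge> 1" unfolding C_def by (simp add: sum_nonneg)
  have "b n \<le> C * real N powr e" if n: "n \<in> {1..N}" for n N
  proof (cases "n \<ge> n1")
    case True
    have "b n \<le> 1 * real n powr e" using n1[OF True] by simp
    also have "\<dots> \<le> C * real N powr e" using C n e by (intro mult_mono powr_mono2) auto
    finally show ?thesis .
  next
    case False
    then have "\<bar>b n\<bar> \<le> (\<Sum>n<n1. \<bar>b n\<bar>)" by (intro member_le_sum) auto
    then have "b n \<le> C * 1" unfolding C_def by simp
    also have "\<dots> \<le> C * real N powr e" using C n e by (intro mult_left_mono ge_one_powr_ge_zero) auto
    finally show ?thesis .
  qed
  then show ?thesis using C by (intro exI[of _ C]) auto
qed

text \<open>With the prime p > d fixed, the next power of p above N is at most p N; this bounded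
  loss goes into \<open>C'\<close>.\<close>

lemma vinogradov_count_bound:
  assumes d: "d > 0" and e: "e > 0"
  defines "s \<equiv> vinogradov_s d"
  shows "\<exists>C\<ge>0. \<forall>N\<ge>1. \<forall>h. real (card {(u, v) \<in> ({..<s} \<rightarrow>\<^sub>E {1..N}) \<times> ({..<s} \<rightarrow>\<^sub>E {1..N}). \<forall>j\<in>{1..d}. power_moment s v j - power_moment s u j = h j})
    \<le> (C * real N powr (1 + e)) ^ s"
proof -
  obtain p' :: nat where p': "prime p'" "p' > d" using bigger_prime by blast
  define p where "p = int p'"
  have p: "prime p" "int d < p" "p > 0" using p' unfolding p_def by (auto simp: prime_gt_0_nat)
  define P where "P = real p'"
  have P: "P > 1" "real_of_int p = P" unfolding P_def p_def using prime_gt_1_nat[OF p'(1)] by auto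
  obtain C where C: "C \<ge> 1" "\<And>n. decoupling p d n (C * of_int p powr (e * real n))"
    using decoupling_inequality[OF p(1) d p(2) e] by blast
  define C' where "C' = C * P powr (1 + e)"
  have "real (card {(u, v) \<in> ({..<s} \<rightarrow>\<^sub>E {1..N}) \<times> ({..<s} \<rightarrow>\<^sub>E {1..N}). \<forall>j\<in>{1..d}. power_moment s v j - power_moment s u j = h j})
    \<le> (C' * real N powr (1 + e)) ^ s" if N: "N \<ge> 1" for N h
  proof -
    obtain n where n: "p' ^ n \<le> N" "N < p' ^ (n + 1)" using ex_power_ivl1[of p' N] N prime_ge_2_nat[OF p'(1)] by auto
    have "int N \<le> int (p' ^ (n + 1))" using n(2) by (simp only: of_nat_le_iff less_imp_le)
    then have "int N \<le> p ^ (n + 1)" unfolding p_def by (simp only: of_nat_power)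
    from vinogradov_system_count[OF p(3) d C(2) this, of h]
    have "real (card {(u, v) \<in> ({..<s} \<rightarrow>\<^sub>E {1..N}) \<times> ({..<s} \<rightarrow>\<^sub>E {1..N}). \<forall>j\<in>{1..d}. power_moment s v j - power_moment s u j = h j})
      \<le> (C * P powr (e * real (n + 1)) * P ^ (n + 1)) ^ s" unfolding s_def P(2) .
    also have "\<dots> \<le> (C' * real N powr (1 + e)) ^ s"
    proof (rule power_mono)
      have "P powr (e * real (n + 1)) * P ^ (n + 1) = (P ^ (n + 1)) powr (1 + e)"
        using P(1) by (simp add: powr_add powr_power powr_powr powr_realpow[symmetric] mult.commute del: power_Suc of_nat_Suc of_nat_add)
      also have "\<dots> \<le> (P * real N) powr (1 + e)"
      proof (rule powr_mono2)
        have "P ^ n \<le> real N" unfolding P_def using n(1) by (simp only: of_nat_power[symmetric] of_nat_le_iff)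
        then show "P ^ (n + 1) \<le> P * real N" using P(1) by simp
      qed (use P(1) e in auto)
      also have "\<dots> = P powr (1 + e) * real N powr (1 + e)" by (rule powr_mult)
      finally show "C * P powr (e * real (n + 1)) * P ^ (n + 1) \<le> C' * real N powr (1 + e)"
        unfolding C'_def using C(1) by simp
    qed (use C(1) P(1) in auto)
    finally show ?thesis .
  qed
  then show ?thesis using C(1) unfolding C'_def by (intro exI[of _ "C * P powr (1 + e)"]) auto
qed

theorem theorem2p4:
  fixes d :: nat
    and \<mu> :: "(nat \<Rightarrow> real) measure"
    and a :: "nat \<Rightarrow> complex"
  assumes "d \<ge> 2"
    and "radon_measure_on_torus d \<mu>"
    and "(\<lambda>\<xi>. norm (fourier d \<mu> \<xi>)) summable_on integer_lattice d"
    and "le_power_o1 (\<lambda>n. norm (a n)) 0"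
  shows "le_power_o1 (\<lambda>N. \<integral>x. norm (weyl_sum a d x N) ^ (2 * vinogradov_s d) \<partial>\<mu>) (real (vinogradov_s d))"
proof -
  define s where "s = vinogradov_s d"
  define W where "W = (\<Sum>\<^sub>\<infinity>\<xi>\<in>integer_lattice d. norm (fourier d \<mu> \<xi>))"
  have d: "d > 0" using assms(1) by simp
  have s: "s > 0" unfolding s_def using vinogradov_s_pos[OF d] .
  have W: "W \<ge> 0" unfolding W_def by (rule infsum_nonneg) simp
  have "\<forall>\<^sub>F N in sequentially. (\<integral>x. norm (weyl_sum a d x N) ^ (2 * s) \<partial>\<mu>) \<le> real N powr (real s + \<epsilon>)" if \<epsilon>: "\<epsilon> > 0" for \<epsilon>
  proof -
    \<comment> \<open>The coefficients cost N^(2 s e) and the count costs N^(s e), together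
      N^(\<epsilon> / 2); the other half of \<epsilon> absorbs the constant
      \<open>H\<close>.\<close>
    define e where "e = \<epsilon> / (6 * real s)"
    have e: "e > 0" unfolding e_def using \<epsilon> s by simp
    obtain A where A: "A \<ge> 0" "\<And>N n. n \<in> {1..N} \<Longrightarrow> norm (a n) \<le> A * real N powr e"
      using le_power_o1_0_uniform[OF assms(4) e] by blast
    obtain C where C: "C \<ge> 0" "\<And>N h. N \<ge> 1 \<Longrightarrow>
      real (card {(u, v) \<in> ({..<s} \<rightarrow>\<^sub>E {1..N}) \<times> ({..<s} \<rightarrow>\<^sub>E {1..N}). \<forall>j\<in>{1..d}. power_moment s v j - power_moment s u j = h j}) \<le> (C * real N powr (1 + e)) ^ s"
      using vinogradov_count_bound[OF d e] unfolding s_def by blast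
    define H where "H = max 1 (A ^ (2 * s) * (C ^ s * W))"
    have H: "H > 0" unfolding H_def by simp
    have "(\<integral>x. norm (weyl_sum a d x N) ^ (2 * s) \<partial>\<mu>) \<le> real N powr (real s + \<epsilon>)" if N: "N \<ge> max 1 (nat \<lceil>H powr (2 / \<epsilon>)\<rceil>)" for N
    proof -
      have N1: "N \<ge> 1" "real N > 0" using N by auto
      have "H powr (2 / \<epsilon>) \<le> real N" using N by linarith
      then have "(H powr (2 / \<epsilon>)) powr (\<epsilon> / 2) \<le> real N powr (\<epsilon> / 2)" using \<epsilon> by (intro powr_mono2) auto
      then have HN: "H \<le> real N powr (\<epsilon> / 2)" using \<epsilon> H by (simp add: powr_powr)
      have "(\<integral>x. norm (weyl_sum a d x N) ^ (2 * s) \<partial>\<mu>) \<le> (A * real N powr e) ^ (2 * s) * ((C * real N powr (1 + e)) ^ s * W)"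
        unfolding W_def by (rule mean_value_le[OF assms(2,3) A(2) _ C(2)[OF N1(1)]]) (use A(1) in simp_all)
      also have "\<dots> = A ^ (2 * s) * (C ^ s * W) * ((real N powr e) ^ (2 * s) * (real N powr (1 + e)) ^ s)"
        by (simp only: power_mult_distrib mult_ac)
      also have "\<dots> \<le> H * ((real N powr e) ^ (2 * s) * (real N powr (1 + e)) ^ s)"
        unfolding H_def by (intro mult_right_mono) auto
      also have "\<dots> \<le> real N powr (\<epsilon> / 2) * ((real N powr e) ^ (2 * s) * (real N powr (1 + e)) ^ s)"
        using HN by (intro mult_right_mono) auto
      also have "(real N powr e) ^ (2 * s) * (real N powr (1 + e)) ^ s = real N powr (real (2 * s) * e + real s * (1 + e))"
        using powr_bound_product[of "real N" 1 e "2 * s" "1 + e" s] N1(2) by simp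
      also have "real N powr (\<epsilon> / 2) * real N powr (real (2 * s) * e + real s * (1 + e)) = real N powr (real s + \<epsilon>)"
      proof -
        have "real s * e = \<epsilon> / 6" unfolding e_def using s by simp
        then have "\<epsilon> / 2 + (real (2 * s) * e + real s * (1 + e)) = real s + \<epsilon>" by (simp add: algebra_simps)
        then show ?thesis by (simp only: powr_add[symmetric])
      qed
      finally show ?thesis .
    qed
    then show ?thesis unfolding eventually_sequentially by blast
  qed
  then show ?thesis unfolding le_power_o1_def s_def by blast
qed

end
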